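(* (Omori–Yau type maximum principle) Let $(X,d,m)$ be a proper $\mathrm{RCD}(K,\infty)$ space with $K\in\mathbb{R}$. Let $f\in W^{1,2}\cap L^\infty\cap D(\bm{\Delta})$ be such that $\bm{\Delta}^{s}f\ge0$. Suppose that $f$ achieves one of its strict maxima in $X$ in the sense that there exists a bounded measurable subset $U\subset X$ with $m(U)>0$ and $m(X\setminus U)>0$ such that $$\operatorname*{ess\,sup}_{U}f>\operatorname*{ess\,sup}_{X\setminus U}f .$$ Then, given any $w\in W^{1,2}\cap\mathrm{Lip}_b$, for any $\varepsilon>0$ we have $$m\left(\left\{x\in X: f(x)\ge\operatorname*{ess\,sup}_Xf-\varepsilon\ \text{ and }\ (\bm{\Delta}^{ac}f)(x)+\langle\nabla f,\nabla w\rangle(x)\le\varepsilon\right\}\right)>0 .$$ In particular, there exists a sequence $(x_j)$ in $X$ such that $f(x_j)\ge\operatorname*{ess\,sup}_Xf-1/j$ and $(\bm{\Delta}^{ac}f)(x_j)+\langle\nabla f,\nabla w\rangle(x_j)\le1/j$ (for any fixed representatives of the functions involved).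
   Context: Metric measure spaces: $(X,d,m)$ with $(X,d)$ complete, separable, proper, and $m$ a non-negative Radon measure with full support, finite on bounded sets. For a Lipschitz $f$, $\mathrm{lip} f(x)=\limsup_{y\to x}|f(y)-f(x)|/d(y,x)$ (and $0$ at isolated points). The Cheeger energy is $\mathrm{Ch}(f)=\inf\{\liminf_n \frac12\int (\mathrm{lip} f_n)^2dm: f_n\in \mathrm{Lip}\cap L^2,\ f_n\to f\text{ in }L^2\}$ on $L^2=L^2(X,m)$; $W^{1,2}=\{f \in L^2:\mathrm{Ch}(f)<\infty\}$ with norm $\|f\|_{W^{1,2}}^2=\|f\|_2^2+2\mathrm{Ch}(f)$. For $f\in W^{1,2}$, $|\nabla f|\in L^2$ is the minimal relaxed gradient, so that $\mathrm{Ch}(f)=\frac12\int|\nabla f|^2dm$. The space is infinitesimally Hilbertian if $\mathrm{Ch}$ is a quadratic form; then $\langle\nabla f,\nabla g\rangle:=\lim_{\varepsilon\to0}\frac{|\nabla(f+\varepsilon g)|^2-|\nabla f|^2}{2\varepsilon}\in L^1$ is bilinear on $W^{1,2}$. Laplacian: $f\in W^{1,2}$ is in $D(\Delta)$ with $\Delta f=h\in L^2$ if $-\int\langle\nabla f,\nabla g\rangle dm=\int hg\,dm$ for all $g\in W^{1,2}$. $\mathrm{RCD}(K,\infty)$ condition ($K\in\mathbb{R}$): (i) $m(B(x,r))\le Ce^{Cr^2}$ for some $x\in X$, $C>0$; (ii) (Sobolev-to-Lip) every $f\in W^{1,2}$ with $|\nabla f|\in L^\infty$ has a Lipschitz representative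 with Lipschitz constant $\||\nabla f|\|_\infty$; (iii) infinitesimally Hilbertian; (iv) (weak Bochner) for all $f,g\in D(\Delta)$ with $\Delta f\in W^{1,2}$, $\Delta g\in L^\infty$, $g\ge0$: $\int\Delta g\frac{|\nabla f|^2}{2}dm\ge\int g\left(\langle\nabla f,\nabla\Delta f\rangle+K|\nabla f|^2\right)dm$. $\mathrm{Lip}_{bs}$ is the space of Lipschitz functions with bounded support, $\mathrm{Lip}_b$ that of bounded Lipschitz functions. $W^{1,2}_{loc}=\{f\in L^2_{loc}:\eta f\in W^{1,2}\ \forall\eta\in\mathrm{Lip}_{bs}\}$, with gradients defined by locality ($|\nabla f|:=|\nabla(\eta f)|$ $m$-a.e. on $\{\eta=1\}$). Measure-valued Laplacian: $f\in W^{1,2}_{loc}$ is in $D(\bm{\Delta})$ if there is a signed Radon measure $\mu$ on $X$ with $-\int\langle\nabla f,\nabla g\rangle dm=\int g\,d\mu$ for all $g\in\mathrm{Lip}_{bs}$; then $\bm{\Delta}f:=\mu$, with Lebesgue decomposition $\bm{\Delta}f=(\bm{\Delta}^{ac}f)\cdot m+\bm{\Delta}^{s}f$ with respect to $m$ ($\bm{\Delta}^{ac}f$ the density, $\bm{\Delta}^sf$ the singular part). *)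

theory Defs
  imports "HOL-Analysis.Analysis" "HOL-Probability.Essential_Supremum"
begin

text \<open>
  The metric space is a type of class \<open>{heine_borel, polish_space}\<close>: proper (bounded closed sets are
  compact), complete and separable. Elements of \<open>L\<^sup>2\<close>, \<open>W\<^sup>1\<^sup>,\<^sup>2\<close> etc. are represented by Borel functions
  \<open>'a \<Rightarrow> real\<close>; all notions below are invariant under changes on \<open>m\<close>-null sets, and objects that are
  only determined up to null sets are either described by a predicate or fixed by \<open>SOME\<close>.
\<close>

definition radon_measure :: "'a::metric_space measure \<Rightarrow> bool" where
  "radon_measure M \<longleftrightarrow> sets M = sets borel \<and>
     (\<forall>K. compact K \<longrightarrow> emeasure M K < \<infinity>) \<and>
     (\<forall>B\<in>sets borel. emeasure M B = (SUP K\<in>{K. compact K \<and> K \<subseteq> B}. emeasure M K))"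

definition metric_measure_space :: "'a::{heine_borel, polish_space} measure \<Rightarrow> bool" where
  "metric_measure_space m \<longleftrightarrow> radon_measure m \<and>
     (\<forall>V. open V \<and> V \<noteq> {} \<longrightarrow> emeasure m V > 0) \<and>
     (\<forall>B\<in>sets borel. bounded B \<longrightarrow> emeasure m B < \<infinity>)"

section \<open>Function spaces\<close>

definition L2 :: "'a measure \<Rightarrow> ('a \<Rightarrow> real) set" where
  "L2 m = {f \<in> borel_measurable m. integrable m (\<lambda>x. (f x)\<^sup>2)}"

definition Linf_norm :: "'a measure \<Rightarrow> ('a \<Rightarrow> real) \<Rightarrow> ennreal" where
  "Linf_norm m f = esssup m (\<lambda>x. ennreal \<bar>f x\<bar>)"

definition Linf :: "'a measure \<Rightarrow> ('a \<Rightarrow> real) set" where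
  "Linf m = {f \<in> borel_measurable m. Linf_norm m f < \<infinity>}"

definition L2_loc :: "'a::metric_space measure \<Rightarrow> ('a \<Rightarrow> real) set" where
  "L2_loc m = {f \<in> borel_measurable m. \<forall>K. compact K \<longrightarrow> set_integrable m K (\<lambda>x. (f x)\<^sup>2)}"

definition Lip :: "('a::metric_space \<Rightarrow> real) set" where
  "Lip = {f. \<exists>C. C-lipschitz_on UNIV f}"

definition Lip_b :: "('a::metric_space \<Rightarrow> real) set" where
  "Lip_b = {f \<in> Lip. bounded (range f)}"

definition Lip_bs :: "('a::metric_space \<Rightarrow> real) set" where
  "Lip_bs = {f \<in> Lip. bounded {x. f x \<noteq> 0}}"

section \<open>Cheeger energy and minimal relaxed gradient\<close>

definition lip :: "('a::metric_space \<Rightarrow> real) \<Rightarrow> 'a \<Rightarrow> ennreal" where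
  "lip f x = (if x islimpt UNIV
              then Limsup (at x) (\<lambda>y. ennreal (\<bar>f y - f x\<bar> / dist y x)) else 0)"

definition L2_tendsto :: "'a measure \<Rightarrow> (nat \<Rightarrow> 'a \<Rightarrow> real) \<Rightarrow> ('a \<Rightarrow> real) \<Rightarrow> bool" where
  "L2_tendsto m F f \<longleftrightarrow> (\<lambda>n. \<integral>\<^sup>+x. ennreal ((F n x - f x)\<^sup>2) \<partial>m) \<longlonglongrightarrow> 0"

definition L2_weak_tendsto :: "'a measure \<Rightarrow> (nat \<Rightarrow> 'a \<Rightarrow> real) \<Rightarrow> ('a \<Rightarrow> real) \<Rightarrow> bool" where
  "L2_weak_tendsto m F f \<longleftrightarrow>
     (\<forall>\<phi>\<in>L2 m. (\<lambda>n. \<integral>x. F n x * \<phi> x \<partial>m) \<longlonglongrightarrow> (\<integral>x. f x * \<phi> x \<partial>m))"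

definition Ch :: "'a::metric_space measure \<Rightarrow> ('a \<Rightarrow> real) \<Rightarrow> ennreal" where
  "Ch m f = (INF F\<in>{F::nat \<Rightarrow> 'a \<Rightarrow> real. range F \<subseteq> Lip \<inter> L2 m \<and> L2_tendsto m F f}.
               liminf (\<lambda>n. (\<integral>\<^sup>+x. (lip (F n) x)\<^sup>2 \<partial>m) / 2))"

definition W12 :: "'a::metric_space measure \<Rightarrow> ('a \<Rightarrow> real) set" where
  "W12 m = {f \<in> L2 m. Ch m f < \<infinity>}"

text \<open>
  Relaxed gradients in the sense of Ambrosio, Gigli and Savare: \<open>G\<close> dominates a weak \<open>L\<^sup>2\<close> limit of
  \<open>lip (F n)\<close> for Lipschitz functions \<open>F n\<close> converging to \<open>f\<close> in \<open>L\<^sup>2\<close>. The minimal relaxed gradient is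
  the (a.e. unique) relaxed gradient of least \<open>L\<^sup>2\<close> norm.
\<close>

definition relaxed_gradient :: "'a::metric_space measure \<Rightarrow> ('a \<Rightarrow> real) \<Rightarrow> ('a \<Rightarrow> real) \<Rightarrow> bool" where
  "relaxed_gradient m f G \<longleftrightarrow> G \<in> L2 m \<and>
     (\<exists>F H. range F \<subseteq> Lip \<inter> L2 m \<and> L2_tendsto m F f \<and>
            (\<forall>n. (\<lambda>x. enn2real (lip (F n) x)) \<in> L2 m) \<and> H \<in> L2 m \<and>
            L2_weak_tendsto m (\<lambda>n x. enn2real (lip (F n) x)) H \<and>
            (AE x in m. H x \<le> G x))"

definition minimal_relaxed_gradient ::
    "'a::metric_space measure \<Rightarrow> ('a \<Rightarrow> real) \<Rightarrow> ('a \<Rightarrow> real) \<Rightarrow> bool" where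
  "minimal_relaxed_gradient m f G \<longleftrightarrow> relaxed_gradient m f G \<and>
     (\<forall>G'. relaxed_gradient m f G' \<longrightarrow> (\<integral>x. (G x)\<^sup>2 \<partial>m) \<le> (\<integral>x. (G' x)\<^sup>2 \<partial>m))"

definition grad_norm :: "'a::metric_space measure \<Rightarrow> ('a \<Rightarrow> real) \<Rightarrow> 'a \<Rightarrow> real" where
  "grad_norm m f = (SOME G. minimal_relaxed_gradient m f G)"

definition infinitesimally_Hilbertian :: "'a::metric_space measure \<Rightarrow> bool" where
  "infinitesimally_Hilbertian m \<longleftrightarrow>
     (\<exists>B::('a \<Rightarrow> real) \<Rightarrow> ('a \<Rightarrow> real) \<Rightarrow> real.
        (\<forall>f\<in>W12 m. \<forall>g\<in>W12 m. B f g = B g f) \<and>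
        (\<forall>f\<in>W12 m. \<forall>g\<in>W12 m. \<forall>h\<in>W12 m. \<forall>a b.
           B (\<lambda>x. a * f x + b * g x) h = a * B f h + b * B g h) \<and>
        (\<forall>f\<in>W12 m. enn2real (Ch m f) = B f f))"

text \<open>
  The limit defining \<open>\<langle>\<nabla>f, \<nabla>g\<rangle>\<close> is taken in \<open>L\<^sup>1(m)\<close>: pointwise a.e. limits over the uncountable
  parameter \<open>\<epsilon>\<close> would depend on the representatives of \<open>|\<nabla>(f + \<epsilon> g)|\<close>.
\<close>

definition is_grad_inner ::
    "'a::metric_space measure \<Rightarrow> ('a \<Rightarrow> real) \<Rightarrow> ('a \<Rightarrow> real) \<Rightarrow> ('a \<Rightarrow> real) \<Rightarrow> bool" where
  "is_grad_inner m f g H \<longleftrightarrow> integrable m H \<and>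
     ((\<lambda>\<epsilon>::real. \<integral>\<^sup>+x. ennreal \<bar>((grad_norm m (\<lambda>y. f y + \<epsilon> * g y) x)\<^sup>2 - (grad_norm m f x)\<^sup>2)
                               / (2 * \<epsilon>) - H x\<bar> \<partial>m) \<longlongrightarrow> 0) (at 0)"

definition grad_inner ::
    "'a::metric_space measure \<Rightarrow> ('a \<Rightarrow> real) \<Rightarrow> ('a \<Rightarrow> real) \<Rightarrow> 'a \<Rightarrow> real" where
  "grad_inner m f g = (SOME H. is_grad_inner m f g H)"

definition has_laplacian ::
    "'a::metric_space measure \<Rightarrow> ('a \<Rightarrow> real) \<Rightarrow> ('a \<Rightarrow> real) \<Rightarrow> bool" where
  "has_laplacian m f h \<longleftrightarrow> f \<in> W12 m \<and> h \<in> L2 m \<and>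
     (\<forall>g\<in>W12 m. - (\<integral>x. grad_inner m f g x \<partial>m) = (\<integral>x. h x * g x \<partial>m))"

section \<open>The RCD condition\<close>

definition exp_volume_growth :: "'a::metric_space measure \<Rightarrow> bool" where
  "exp_volume_growth m \<longleftrightarrow>
     (\<exists>x. \<exists>C>0. \<forall>r>0. emeasure m (ball x r) \<le> ennreal (C * exp (C * r\<^sup>2)))"

definition Sobolev_to_Lip :: "'a::metric_space measure \<Rightarrow> bool" where
  "Sobolev_to_Lip m \<longleftrightarrow>
     (\<forall>f\<in>W12 m. grad_norm m f \<in> Linf m \<longrightarrow>
        (\<exists>f'. (AE x in m. f' x = f x) \<and>
              (enn2real (Linf_norm m (grad_norm m f)))-lipschitz_on UNIV f'))"

text \<open>
  The test function \<open>g\<close> need not be bounded, so the integrand on the smaller side of the Bochner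
  inequality need not be integrable; the inequality is required whenever it is (in particular for
  all bounded \<open>g\<close>). The integrand on the larger side is always integrable.
\<close>

definition weak_Bochner :: "real \<Rightarrow> 'a::metric_space measure \<Rightarrow> bool" where
  "weak_Bochner K m \<longleftrightarrow>
     (\<forall>f \<Delta>f g \<Delta>g.
        has_laplacian m f \<Delta>f \<and> \<Delta>f \<in> W12 m \<and>
        has_laplacian m g \<Delta>g \<and> \<Delta>g \<in> Linf m \<and> (AE x in m. 0 \<le> g x) \<and>
        integrable m (\<lambda>x. g x * (grad_inner m f \<Delta>f x + K * (grad_norm m f x)\<^sup>2)) \<longrightarrow>
        (\<integral>x. \<Delta>g x * ((grad_norm m f x)\<^sup>2 / 2) \<partial>m)
          \<ge> (\<integral>x. g x * (grad_inner m f \<Delta>f x + K * (grad_norm m f x)\<^sup>2) \<partial>m))"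

definition RCD :: "real \<Rightarrow> 'a::{heine_borel, polish_space} measure \<Rightarrow> bool" where
  "RCD K m \<longleftrightarrow> metric_measure_space m \<and> exp_volume_growth m \<and> Sobolev_to_Lip m \<and>
     infinitesimally_Hilbertian m \<and> weak_Bochner K m"

section \<open>Measure-valued Laplacian\<close>

text \<open>
  A signed Radon measure is a formal difference \<open>\<mu>\<^sub>1 - \<mu>\<^sub>2\<close> of two Radon measures, given as the pair
  \<open>(\<mu>\<^sub>1, \<mu>\<^sub>2)\<close>. Both may have infinite total mass, so only its values on bounded Borel sets are used.
\<close>

type_synonym 'a smeasure = "'a measure \<times> 'a measure"

definition signed_radon_measure :: "'a::metric_space smeasure \<Rightarrow> bool" where
  "signed_radon_measure \<mu> \<longleftrightarrow> radon_measure (fst \<mu>) \<and> radon_measure (snd \<mu>)"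

definition smeasure :: "'a smeasure \<Rightarrow> 'a set \<Rightarrow> real" where
  "smeasure \<mu> A = measure (fst \<mu>) A - measure (snd \<mu>) A"

definition sintegral :: "'a smeasure \<Rightarrow> ('a \<Rightarrow> real) \<Rightarrow> real" where
  "sintegral \<mu> g = (\<integral>x. g x \<partial>(fst \<mu>)) - (\<integral>x. g x \<partial>(snd \<mu>))"

definition smeasure_nonneg :: "'a::metric_space smeasure \<Rightarrow> bool" where
  "smeasure_nonneg \<mu> \<longleftrightarrow> (\<forall>A\<in>sets borel. bounded A \<longrightarrow> 0 \<le> smeasure \<mu> A)"

definition smeasure_singular :: "'a::metric_space measure \<Rightarrow> 'a smeasure \<Rightarrow> bool" where
  "smeasure_singular m \<mu> \<longleftrightarrow>
     (\<exists>S\<in>null_sets m. \<forall>A\<in>sets borel. bounded A \<and> A \<inter> S = {} \<longrightarrow> smeasure \<mu> A = 0)"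

definition Lebesgue_decomposition ::
    "'a::metric_space measure \<Rightarrow> 'a smeasure \<Rightarrow> ('a \<Rightarrow> real) \<Rightarrow> 'a smeasure \<Rightarrow> bool" where
  "Lebesgue_decomposition m \<mu> h \<sigma> \<longleftrightarrow>
     h \<in> borel_measurable m \<and> signed_radon_measure \<sigma> \<and> smeasure_singular m \<sigma> \<and>
     (\<forall>A\<in>sets borel. bounded A \<longrightarrow>
        set_integrable m A h \<and> smeasure \<mu> A = (LINT x:A|m. h x) + smeasure \<sigma> A)"

definition W12_loc :: "'a::metric_space measure \<Rightarrow> ('a \<Rightarrow> real) set" where
  "W12_loc m = {f \<in> L2_loc m. \<forall>\<eta>\<in>Lip_bs. (\<lambda>x. \<eta> x * f x) \<in> W12 m}"

definition is_grad_inner_loc ::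
    "'a::metric_space measure \<Rightarrow> ('a \<Rightarrow> real) \<Rightarrow> ('a \<Rightarrow> real) \<Rightarrow> ('a \<Rightarrow> real) \<Rightarrow> bool" where
  "is_grad_inner_loc m f g H \<longleftrightarrow> H \<in> borel_measurable m \<and>
     (\<forall>\<eta>\<in>Lip_bs. AE x in m. \<eta> x = 1 \<longrightarrow>
        H x = grad_inner m (\<lambda>y. \<eta> y * f y) (\<lambda>y. \<eta> y * g y) x)"

definition grad_inner_loc ::
    "'a::metric_space measure \<Rightarrow> ('a \<Rightarrow> real) \<Rightarrow> ('a \<Rightarrow> real) \<Rightarrow> 'a \<Rightarrow> real" where
  "grad_inner_loc m f g = (SOME H. is_grad_inner_loc m f g H)"

definition has_measure_laplacian ::
    "'a::metric_space measure \<Rightarrow> ('a \<Rightarrow> real) \<Rightarrow> 'a smeasure \<Rightarrow> bool" where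
  "has_measure_laplacian m f \<mu> \<longleftrightarrow> f \<in> W12_loc m \<and> signed_radon_measure \<mu> \<and>
     (\<forall>g\<in>Lip_bs. - (\<integral>x. grad_inner_loc m f g x \<partial>m) = sintegral \<mu> g)"

definition ess_sup_on :: "'a measure \<Rightarrow> 'a set \<Rightarrow> ('a \<Rightarrow> real) \<Rightarrow> ereal" where
  "ess_sup_on m A f = esssup (restrict_space m A) (\<lambda>x. ereal (f x))"

end

theory Submission
  imports Defs
begin

text \<open>
  The proof tests the equation for the Laplacian with a truncation of \<open>f\<close> near its maximum. Let
  \<open>M\<close> be the essential supremum of \<open>f\<close> and suppose that \<open>\<Delta>\<^sup>a\<^sup>c f + \<langle>\<nabla>f, \<nabla>w\<rangle> > \<epsilon>\<close> almost everywhere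
  on \<open>{f \<ge> M - \<epsilon>}\<close>. For \<open>c < M\<close> close to \<open>M\<close> the set \<open>{f > c}\<close> lies in the bounded set \<open>U\<close> up to a
  null set. Let \<open>\<theta>\<close> be a bounded nondecreasing function, continuously differentiable, that
  vanishes below \<open>c\<close> and behaves like \<open>(s - c)\<^sup>2\<close> just above it, and let \<open>\<phi> = \<theta>(f)\<close>. As \<open>\<Delta>\<^sup>s f \<ge> 0\<close>,
  integration by parts gives \<open>\<integral> \<phi> \<Delta>\<^sup>a\<^sup>c f \<le> - \<integral> \<theta>'(f) |\<nabla>f|\<^sup>2\<close>, and \<open>|\<langle>\<nabla>f, \<nabla>w\<rangle>| \<le> L |\<nabla>f|\<close> when \<open>w\<close> is
  \<open>L\<close>-Lipschitz. Hence
  \<open>\<epsilon> \<integral> \<phi> \<le> \<integral> (L \<theta>(f) |\<nabla>f| - \<theta>'(f) |\<nabla>f|\<^sup>2) \<le> (L\<^sup>2 / 4) \<integral> \<theta>(f)\<^sup>2 / \<theta>'(f) \<le> (L\<^sup>2 / 4) (M - c) \<integral> \<phi>\<close>,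
  because \<open>\<theta>(s) \<le> (s - c) \<theta>'(s)\<close> for \<open>s\<close> slightly above \<open>c\<close>. Since \<open>\<integral> \<phi> > 0\<close>, this fails once
  \<open>M - c\<close> is small. The lemmas that carry this argument are \<open>test_fun_laplacian_le\<close>,
  \<open>test_fun_absorption\<close> and \<open>maximum_principle_AE\<close>.

  The calculus behind these lines has to be derived from the Cheeger energy. A minimal relaxed
  gradient is defined through weak limits of slopes. The upper bounds of slopes of Lipschitz
  functions close to \<open>f\<close> form convex subsets of \<open>L\<^sup>2\<close>; the elements of least norm in their closures
  converge strongly, and the limit is the only minimal relaxed gradient (\<open>grad_norm_W12\<close>). So
  \<open>|\<nabla>f|\<close> is a strong limit of upper bounds of slopes. Such limits can be glued along Borel sets
  (\<open>strong_relaxed_glue\<close>), and therefore the one of least norm is also the smallest one almost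
  everywhere. The rules for slopes of sums and of compositions then pass to \<open>|\<nabla>f|\<close>, and locality
  follows by composing with functions that are flat at \<open>0\<close>.

  When the Cheeger energy is quadratic, the quotients \<open>(|\<nabla>(f + \<epsilon> g)|\<^sup>2 - |\<nabla>f|\<^sup>2) / (2 \<epsilon>)\<close> increase
  with \<open>\<epsilon>\<close> and have integrals that are affine in \<open>\<epsilon>\<close>. They are thus Lipschitz in \<open>\<epsilon>\<close> with values
  in \<open>L\<^sup>1\<close>, so that \<open>\<langle>\<nabla>f, \<nabla>g\<rangle>\<close> exists, and its integral is the polar form of twice the energy
  (\<open>grad_inner_facts\<close>). The integration by parts with the discontinuous function \<open>\<phi>\<close> is carried
  out with this form. Comparing the energies of \<open>f\<close> and \<open>f - t \<phi>\<close> bounds it from below by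
  \<open>\<integral> \<theta>'(f) |\<nabla>f|\<^sup>2\<close>. Approximating \<open>\<phi>\<close> by Lipschitz functions \<open>g\<^sub>n \<ge> 0\<close> of bounded energy bounds it
  from above by \<open>- \<integral> \<phi> \<Delta>\<^sup>a\<^sup>c f\<close>: for each \<open>g\<^sub>n\<close> the singular part contributes with a sign and can be
  dropped before the limit is taken.
\<close>

section \<open>Square-integrable functions\<close>

lemma power2_add_le: "(a + b)\<^sup>2 \<le> 2 * a\<^sup>2 + 2 * b\<^sup>2" for a b :: real
  using sum_squares_bound[of a b] by (simp add: power2_sum)

text \<open>
  Elements of \<open>L\<^sup>2\<close> are functions and not classes, so the Hilbert space arguments are phrased with
  this function of two arguments. It is left squared because it is then an integral; a triangle
  inequality with the factor \<open>2\<close> suffices throughout.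
\<close>

definition sqdist :: "'a measure \<Rightarrow> ('a \<Rightarrow> real) \<Rightarrow> ('a \<Rightarrow> real) \<Rightarrow> real" where
  "sqdist m u v = (\<integral>x. (u x - v x)\<^sup>2 \<partial>m)"

lemma L2D:
  assumes "u \<in> L2 m"
  shows "u \<in> borel_measurable m" "integrable m (\<lambda>x. (u x)\<^sup>2)"
  using assms by (auto simp: L2_def)

lemma L2_dominated:
  assumes "v \<in> L2 m" "u \<in> borel_measurable m" "AE x in m. \<bar>u x\<bar> \<le> \<bar>v x\<bar>"
  shows "u \<in> L2 m"
proof -
  have "integrable m (\<lambda>x. (u x)\<^sup>2)"
    by (rule Bochner_Integration.integrable_bound[OF L2D(2)[OF assms(1)]])
      (use assms in \<open>auto simp: abs_le_square_iff\<close>)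
  then show ?thesis using assms(2) by (simp add: L2_def)
qed

lemma L2_mult_integrable:
  assumes "u \<in> L2 m" "v \<in> L2 m"
  shows "integrable m (\<lambda>x. u x * v x)"
proof (rule Bochner_Integration.integrable_bound[of m "\<lambda>x. (u x)\<^sup>2 + (v x)\<^sup>2"])
  show "integrable m (\<lambda>x. (u x)\<^sup>2 + (v x)\<^sup>2)" using assms by (auto simp: L2_def)
  show "(\<lambda>x. u x * v x) \<in> borel_measurable m" using assms by (auto simp: L2_def)
  have "\<bar>a * b\<bar> \<le> a\<^sup>2 + b\<^sup>2" for a b :: real
    using sum_squares_bound[of "\<bar>a\<bar>" "\<bar>b\<bar>"] mult_nonneg_nonneg[OF abs_ge_zero[of a] abs_ge_zero[of b]]
    unfolding abs_mult mult.assoc power2_abs by linarith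
  then show "AE x in m. norm (u x * v x) \<le> norm ((u x)\<^sup>2 + (v x)\<^sup>2)" by auto
qed

lemma L2_cmult: assumes "u \<in> L2 m" shows "(\<lambda>x. c * u x) \<in> L2 m"
  using assms by (auto simp: L2_def power_mult_distrib)

lemma L2_add:
  assumes "u \<in> L2 m" "v \<in> L2 m"
  shows "(\<lambda>x. u x + v x) \<in> L2 m"
  using assms L2_mult_integrable[OF assms] by (auto simp: L2_def power2_sum mult.assoc)

lemma L2_diff:
  assumes "u \<in> L2 m" "v \<in> L2 m"
  shows "(\<lambda>x. u x - v x) \<in> L2 m"
  using assms L2_mult_integrable[OF assms] by (auto simp: L2_def power2_diff mult.assoc)

lemma L2_abs: assumes "u \<in> L2 m" shows "(\<lambda>x. \<bar>u x\<bar>) \<in> L2 m"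
  using assms by (auto simp: L2_def)

lemma L2_mult_bounded:
  assumes "u \<in> L2 m" "b \<in> borel_measurable m" "\<And>x. \<bar>b x\<bar> \<le> C"
  shows "(\<lambda>x. b x * u x) \<in> L2 m"
proof (rule L2_dominated[OF L2_cmult[OF assms(1), of C]])
  show "(\<lambda>x. b x * u x) \<in> borel_measurable m" using assms(2) L2D(1)[OF assms(1)] by measurable
  have "\<bar>b x\<bar> * \<bar>u x\<bar> \<le> \<bar>C\<bar> * \<bar>u x\<bar>" for x
    using assms(3)[of x] by (intro mult_right_mono) auto
  then show "AE x in m. \<bar>b x * u x\<bar> \<le> \<bar>C * u x\<bar>" by (simp add: abs_mult)
qed

lemma sqdist_nonneg: "0 \<le> sqdist m u v" by (simp add: sqdist_def)

lemma sqdist_commute: "sqdist m u v = sqdist m v u"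
  by (simp add: sqdist_def power2_commute)

lemma sqdist_self [simp]: "sqdist m u u = 0" by (simp add: sqdist_def)

lemma sqdist_expand:
  assumes "u \<in> L2 m" "v \<in> L2 m"
  shows "sqdist m u v = (\<integral>x. (u x)\<^sup>2 \<partial>m) - 2 * (\<integral>x. u x * v x \<partial>m) + (\<integral>x. (v x)\<^sup>2 \<partial>m)"
  using L2_mult_integrable[OF assms] L2D(2)[OF assms(1)] L2D(2)[OF assms(2)]
  by (simp add: sqdist_def power2_diff mult.assoc)

lemma sqdist_triangle:
  assumes "u \<in> L2 m" "v \<in> L2 m" "w \<in> L2 m"
  shows "sqdist m u w \<le> 2 * sqdist m u v + 2 * sqdist m v w"
proof -
  have i: "integrable m (\<lambda>x. (u x - v x)\<^sup>2)" "integrable m (\<lambda>x. (v x - w x)\<^sup>2)"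
    "integrable m (\<lambda>x. (u x - w x)\<^sup>2)"
    using L2D(2)[OF L2_diff] assms by auto
  have *: "(a - c)\<^sup>2 \<le> 2 * (a - b)\<^sup>2 + 2 * (b - c)\<^sup>2" for a b c :: real
  proof -
    have "2 * (a - b)\<^sup>2 + 2 * (b - c)\<^sup>2 - (a - c)\<^sup>2 = (a - 2 * b + c)\<^sup>2" by algebra
    then show ?thesis using zero_le_power2[of "a - 2 * b + c"] by linarith
  qed
  have "sqdist m u w \<le> (\<integral>x. 2 * (u x - v x)\<^sup>2 + 2 * (v x - w x)\<^sup>2 \<partial>m)"
    unfolding sqdist_def by (rule integral_mono) (use i * in auto)
  also have "\<dots> = 2 * sqdist m u v + 2 * sqdist m v w"
    unfolding sqdist_def using i by simp
  finally show ?thesis .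
qed

lemma sqdist_mono:
  assumes "u \<in> L2 m" "v \<in> L2 m" "u' \<in> L2 m" "v' \<in> L2 m"
    "AE x in m. \<bar>u x - v x\<bar> \<le> \<bar>u' x - v' x\<bar>"
  shows "sqdist m u v \<le> sqdist m u' v'"
  unfolding sqdist_def
  by (rule integral_mono_AE) (use L2D(2)[OF L2_diff] assms in \<open>auto simp: abs_le_square_iff\<close>)

lemma nn_integral_sqdist:
  assumes "u \<in> L2 m" "v \<in> L2 m"
  shows "(\<integral>\<^sup>+x. ennreal ((u x - v x)\<^sup>2) \<partial>m) = ennreal (sqdist m u v)"
  unfolding sqdist_def by (rule nn_integral_eq_integral) (use L2D(2)[OF L2_diff] assms in auto)

lemma L2_tendsto_iff:
  assumes "\<And>n. F n \<in> L2 m" "f \<in> L2 m"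
  shows "L2_tendsto m F f \<longleftrightarrow> (\<lambda>n. sqdist m (F n) f) \<longlonglongrightarrow> 0"
proof -
  have "(\<lambda>n. ennreal (sqdist m (F n) f)) \<longlonglongrightarrow> ennreal 0 \<longleftrightarrow> (\<lambda>n. sqdist m (F n) f) \<longlonglongrightarrow> 0"
    by (rule tendsto_ennreal_iff) (auto simp: sqdist_nonneg)
  then show ?thesis
    using assms by (simp add: L2_tendsto_def nn_integral_sqdist)
qed

lemma sqdist_tendsto_zero_le:
  assumes "\<And>n. sqdist m (F n) f \<le> a n" "a \<longlonglongrightarrow> 0"
  shows "(\<lambda>n. sqdist m (F n) f) \<longlonglongrightarrow> 0"
  by (rule tendsto_sandwich[OF _ _ tendsto_const assms(2)]) (simp_all add: sqdist_nonneg assms(1))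

lemma sqdist_tendsto_zeroI:
  assumes "\<And>n. sqdist m (F n) f < 1 / real (Suc n)"
  shows "(\<lambda>n. sqdist m (F n) f) \<longlonglongrightarrow> 0"
proof (rule tendsto_sandwich[OF _ _ tendsto_const])
  show "(\<lambda>n. 1 / real (Suc n)) \<longlonglongrightarrow> 0"
    using LIMSEQ_inverse_real_of_nat by (simp add: inverse_eq_divide)
  show "\<forall>\<^sub>F n in sequentially. sqdist m (F n) f \<le> 1 / real (Suc n)"
    by (rule always_eventually) (blast intro: less_imp_le assms)
qed (simp add: sqdist_nonneg)

lemma L2_Cauchy_Schwarz:
  assumes "u \<in> L2 m" "v \<in> L2 m"
  shows "(\<integral>x. u x * v x \<partial>m)\<^sup>2 \<le> (\<integral>x. (u x)\<^sup>2 \<partial>m) * (\<integral>x. (v x)\<^sup>2 \<partial>m)"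
proof -
  define A B C where "A = (\<integral>x. (u x)\<^sup>2 \<partial>m)" "B = (\<integral>x. u x * v x \<partial>m)" "C = (\<integral>x. (v x)\<^sup>2 \<partial>m)"
  have q: "0 \<le> A - 2 * t * B + t\<^sup>2 * C" for t
    using sqdist_expand[OF assms(1) L2_cmult[OF assms(2), of t]] sqdist_nonneg[of m u "\<lambda>x. t * v x"]
    by (simp add: A_B_C_def power_mult_distrib mult.left_commute[of _ t] mult.assoc)
  have "0 \<le> C" by (simp add: A_B_C_def)
  show "B\<^sup>2 \<le> A * C"
  proof (cases "C = 0")
    case True
    have "B = 0"
    proof (rule ccontr)
      assume "B \<noteq> 0"
      then show False using q[of "(A + 1) / (2 * B)"] True by (simp add: field_simps)
    qed
    then show ?thesis using True by simp
  next
    case False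
    then show ?thesis using q[of "B / C"] \<open>0 \<le> C\<close> by (simp add: field_simps power2_eq_square)
  qed
qed

lemma tendsto_inner_L2:
  assumes "\<And>n. F n \<in> L2 m" "f \<in> L2 m" "\<phi> \<in> L2 m" "(\<lambda>n. sqdist m (F n) f) \<longlonglongrightarrow> 0"
  shows "(\<lambda>n. \<integral>x. F n x * \<phi> x \<partial>m) \<longlonglongrightarrow> (\<integral>x. f x * \<phi> x \<partial>m)"
proof -
  have b: "\<bar>(\<integral>x. F n x * \<phi> x \<partial>m) - (\<integral>x. f x * \<phi> x \<partial>m)\<bar>
      \<le> sqrt (sqdist m (F n) f * (\<integral>x. (\<phi> x)\<^sup>2 \<partial>m))" for n
  proof -
    have "(\<integral>x. F n x * \<phi> x \<partial>m) - (\<integral>x. f x * \<phi> x \<partial>m) = (\<integral>x. (F n x - f x) * \<phi> x \<partial>m)"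
      using L2_mult_integrable[OF assms(1)[of n] assms(3)] L2_mult_integrable[OF assms(2,3)]
      by (simp add: left_diff_distrib)
    moreover have "(\<integral>x. (F n x - f x) * \<phi> x \<partial>m)\<^sup>2 \<le> sqdist m (F n) f * (\<integral>x. (\<phi> x)\<^sup>2 \<partial>m)"
      unfolding sqdist_def by (rule L2_Cauchy_Schwarz) (use assms L2_diff in auto)
    ultimately show ?thesis by (metis real_le_rsqrt real_sqrt_abs real_sqrt_le_mono)
  qed
  have "(\<lambda>n. sqrt (sqdist m (F n) f * (\<integral>x. (\<phi> x)\<^sup>2 \<partial>m))) \<longlonglongrightarrow> sqrt (0 * (\<integral>x. (\<phi> x)\<^sup>2 \<partial>m))"
    by (intro tendsto_intros assms)
  then have l: "(\<lambda>n. sqrt (sqdist m (F n) f * (\<integral>x. (\<phi> x)\<^sup>2 \<partial>m))) \<longlonglongrightarrow> 0" by simp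
  have "(\<lambda>n. (\<integral>x. F n x * \<phi> x \<partial>m) - (\<integral>x. f x * \<phi> x \<partial>m)) \<longlonglongrightarrow> 0"
    by (rule Lim_null_comparison[OF _ l]) (simp add: b)
  then show ?thesis by (simp only: LIM_zero_iff)
qed

lemma tendsto_square_L2:
  assumes "\<And>n. F n \<in> L2 m" "f \<in> L2 m" "(\<lambda>n. sqdist m (F n) f) \<longlonglongrightarrow> 0"
  shows "(\<lambda>n. \<integral>x. (F n x)\<^sup>2 \<partial>m) \<longlonglongrightarrow> (\<integral>x. (f x)\<^sup>2 \<partial>m)"
proof -
  have "(\<lambda>n. sqdist m (F n) f + 2 * (\<integral>x. F n x * f x \<partial>m) - (\<integral>x. (f x)\<^sup>2 \<partial>m))
      \<longlonglongrightarrow> 0 + 2 * (\<integral>x. f x * f x \<partial>m) - (\<integral>x. (f x)\<^sup>2 \<partial>m)"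
    by (intro tendsto_intros assms tendsto_inner_L2)
  then show ?thesis
    using assms by (simp add: sqdist_expand power2_eq_square)
qed

lemma L2_tendsto_AE_subseq:
  assumes "\<And>n. F n \<in> L2 m" "f \<in> L2 m" "(\<lambda>n. sqdist m (F n) f) \<longlonglongrightarrow> 0"
  obtains r :: "nat \<Rightarrow> nat" where "strict_mono r" "AE x in m. (\<lambda>n. F (r n) x) \<longlonglongrightarrow> f x"
proof -
  have "\<exists>r::nat\<Rightarrow>nat. strict_mono r \<and> (AE x in m. (\<lambda>n. (F (r n) x - f x)\<^sup>2) \<longlonglongrightarrow> 0)"
    by (rule tendsto_L1_AE_subseq) (use assms L2D(2)[OF L2_diff] in \<open>auto simp: sqdist_def\<close>)
  then obtain r :: "nat \<Rightarrow> nat" where r: "strict_mono r" "AE x in m. (\<lambda>n. (F (r n) x - f x)\<^sup>2) \<longlonglongrightarrow> 0" by blast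
  have "(\<lambda>n. F (r n) x) \<longlonglongrightarrow> f x" if "(\<lambda>n. (F (r n) x - f x)\<^sup>2) \<longlonglongrightarrow> 0" for x
    using that tendsto_real_sqrt[OF that] by (simp add: LIM_zero_iff tendsto_rabs_zero_iff)
  with r show ?thesis by (intro that[of r]) auto
qed

text \<open>
  Riesz--Fischer. Along a subsequence whose increments \<open>D k\<close> have square integral at most \<open>4\<^sup>-\<^sup>k\<close>,
  the series \<open>\<Sum>k. 2\<^sup>k (D k x)\<^sup>2\<close> is finite almost everywhere, whence \<open>\<bar>D k x\<bar>\<close> decays geometrically;
  Fatou's lemma turns pointwise convergence into convergence in \<open>L\<^sup>2\<close>.
\<close>

lemma L2_complete:
  assumes F: "\<And>n. F n \<in> L2 m" and C: "\<And>i j. i \<le> j \<Longrightarrow> sqdist m (F i) (F j) \<le> a i"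
    and a: "a \<longlonglongrightarrow> 0"
  obtains g where "g \<in> L2 m" "(\<lambda>n. sqdist m (F n) g) \<longlonglongrightarrow> 0"
proof -
  note [measurable] = L2D(1)[OF F]
  have "\<exists>N. \<forall>n\<ge>N. a n < (1/4)^k" for k
    using order_tendstoD(2)[OF a, of "(1/4)^k"] by (auto simp: eventually_sequentially)
  then obtain N where N: "\<And>k n. n \<ge> N k \<Longrightarrow> a n < (1/4)^k" by metis
  define r where "r = rec_nat (N 0) (\<lambda>k p. max (Suc p) (N (Suc k)))"
  have rs: "r (Suc k) = max (Suc (r k)) (N (Suc k))" for k by (simp add: r_def)
  have sm: "strict_mono r" by (rule strict_monoI_Suc) (simp add: rs)
  have rN: "r k \<ge> N k" for k by (cases k) (auto simp: r_def)
  define D where "D k x = F (r (Suc k)) x - F (r k) x" for k x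
  have [measurable]: "D k \<in> borel_measurable m" for k by (simp add: D_def[abs_def])
  have Dint: "integrable m (\<lambda>x. (D k x)\<^sup>2)" for k
    unfolding D_def by (rule L2D(2)[OF L2_diff[OF F F]])
  have Dle: "(\<integral>x. (D k x)\<^sup>2 \<partial>m) \<le> (1/4)^k" for k
  proof -
    have "(\<integral>x. (D k x)\<^sup>2 \<partial>m) = sqdist m (F (r k)) (F (r (Suc k)))"
      by (simp add: sqdist_def D_def power2_commute)
    also have "\<dots> \<le> a (r k)" by (rule C) (use sm in \<open>simp add: strict_mono_less_eq\<close>)
    also have "\<dots> \<le> (1/4)^k" using N rN less_imp_le by blast
    finally show ?thesis .
  qed
  have fin: "(\<integral>\<^sup>+x. (\<Sum>k. ennreal (2^k * (D k x)\<^sup>2)) \<partial>m) \<noteq> \<infinity>"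
  proof -
    have "(\<integral>\<^sup>+x. (\<Sum>k. ennreal (2^k * (D k x)\<^sup>2)) \<partial>m) = (\<Sum>k. \<integral>\<^sup>+x. ennreal (2^k * (D k x)\<^sup>2) \<partial>m)"
      by (rule nn_integral_suminf) measurable
    also have "\<dots> = (\<Sum>k. ennreal (2^k * (\<integral>x. (D k x)\<^sup>2 \<partial>m)))"
      by (subst nn_integral_eq_integral) (use Dint in auto)
    also have "\<dots> \<le> (\<Sum>k. ennreal ((1/2)^k))"
    proof (rule suminf_le)
      have "2^k * (\<integral>x. (D k x)\<^sup>2 \<partial>m) \<le> (1/2)^k" for k
      proof -
        have "2^k * (\<integral>x. (D k x)\<^sup>2 \<partial>m) \<le> 2^k * (1/4)^k" using Dle[of k] by simp
        also have "\<dots> = (1/2::real)^k" by (simp flip: power_mult_distrib)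
        finally show ?thesis .
      qed
      then show "ennreal (2^k * (\<integral>x. (D k x)\<^sup>2 \<partial>m)) \<le> ennreal ((1/2)^k)" for k by (rule ennreal_leI)
    qed auto
    also have "\<dots> < \<infinity>" by (simp add: suminf_ennreal2 summable_geometric)
    finally show ?thesis by simp
  qed
  have ae: "AE x in m. (\<Sum>k. ennreal (2^k * (D k x)\<^sup>2)) \<noteq> \<infinity>"
    by (rule nn_integral_PInf_AE) (use fin in auto)
  define g where "g x = lim (\<lambda>k. F (r k) x)" for x
  have [measurable]: "g \<in> borel_measurable m"
    unfolding g_def by measurable
  have conv: "AE x in m. (\<lambda>k. F (r k) x) \<longlonglongrightarrow> g x"
    using ae
  proof eventually_elim
    case (elim x)
    then have sb: "summable (\<lambda>k. 2^k * (D k x)\<^sup>2)"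
      by (intro summable_suminf_not_top) (auto simp: top_ennreal_def infinity_ennreal_def)
    then obtain B where B: "\<And>k. \<bar>2^k * (D k x)\<^sup>2\<bar> \<le> B"
      using summable_imp_Bseq[OF sb] by (auto simp: Bseq_def)
    have "\<bar>D k x\<bar> \<le> sqrt B * (sqrt (1/2))^k" for k
    proof -
      have "(D k x)\<^sup>2 \<le> B * (1/2)^k" using B[of k] by (simp add: field_simps abs_mult)
      then have "sqrt ((D k x)\<^sup>2) \<le> sqrt (B * (1/2)^k)" by (rule real_sqrt_le_mono)
      then show ?thesis
        unfolding real_sqrt_abs by (simp only: real_sqrt_mult real_sqrt_power)
    qed
    then have le: "norm (D k x) \<le> sqrt B * (sqrt (1/2))^k" for k by simp
    have "summable (\<lambda>k. sqrt B * (sqrt (1/2))^k)"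
      by (intro summable_mult summable_geometric) simp
    from summable_comparison_test'[OF this le] have "summable (\<lambda>k. D k x)" .
    then have "convergent (\<lambda>n. \<Sum>k<n. D k x)" by (simp add: summable_iff_convergent)
    then have "convergent (\<lambda>n. (\<Sum>k<n. D k x) + F (r 0) x)"
      by (rule convergent_add[OF _ convergent_const])
    moreover have "(\<Sum>k<n. D k x) + F (r 0) x = F (r n) x" for n
      unfolding D_def by (subst sum_lessThan_telescope) simp
    ultimately show ?case unfolding g_def by (simp add: convergent_LIMSEQ_iff)
  qed
  have key: "(\<integral>\<^sup>+x. ennreal ((F i x - g x)\<^sup>2) \<partial>m) \<le> ennreal (a i)" for i
  proof -
    have "(\<integral>\<^sup>+x. ennreal ((F i x - g x)\<^sup>2) \<partial>m) =
        (\<integral>\<^sup>+x. liminf (\<lambda>k. ennreal ((F i x - F (r k) x)\<^sup>2)) \<partial>m)"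
      using conv
      by (intro nn_integral_cong_AE, eventually_elim)
        (auto intro!: lim_imp_Liminf[symmetric] tendsto_intros)
    also have "\<dots> \<le> liminf (\<lambda>k. \<integral>\<^sup>+x. ennreal ((F i x - F (r k) x)\<^sup>2) \<partial>m)"
      by (rule nn_integral_liminf) measurable
    also have "\<dots> \<le> ennreal (a i)"
    proof (rule Liminf_le)
      show "\<forall>\<^sub>F k in sequentially. (\<integral>\<^sup>+x. ennreal ((F i x - F (r k) x)\<^sup>2) \<partial>m) \<le> ennreal (a i)"
        using eventually_ge_at_top[of i]
      proof eventually_elim
        case (elim k)
        then have "i \<le> r k" using sm by (meson order_trans seq_suble)
        then show ?case using C[of i "r k"] F by (simp add: nn_integral_sqdist ennreal_leI)
      qed
    qed simp
    finally show ?thesis .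
  qed
  have gi: "integrable m (\<lambda>x. (F i x - g x)\<^sup>2)" for i
    using key[of i] by (intro integrableI_bounded) (auto simp: less_top[symmetric] top_unique)
  have "(\<lambda>x. F 0 x - g x) \<in> L2 m" using gi[of 0] by (simp add: L2_def)
  from L2_diff[OF F[of 0] this] have gL: "g \<in> L2 m" by simp
  have "sqdist m (F i) g \<le> a i" for i
    using key[of i] C[of i i] by (simp add: nn_integral_sqdist[OF F gL] sqdist_nonneg)
  then have "(\<lambda>n. sqdist m (F n) g) \<longlonglongrightarrow> 0"
    by (intro tendsto_sandwich[OF _ _ tendsto_const a]) (auto simp: sqdist_nonneg)
  with gL show ?thesis by (rule that)
qed

text \<open>
  The element of least norm in the closure of a convex set. By the parallelogram identity a
  minimising sequence is Cauchy, and minimality along segments gives the variational inequality.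
  The inequality is linear in \<open>k\<close> and therefore survives weak limits, which is what makes weak
  limits of slopes accessible.
\<close>

lemma L2_projection:
  assumes K: "K \<subseteq> L2 m" "K \<noteq> {}"
    and conv: "\<And>u v t. u \<in> K \<Longrightarrow> v \<in> K \<Longrightarrow> 0 \<le> t \<Longrightarrow> t \<le> 1 \<Longrightarrow> (\<lambda>x. (1 - t) * u x + t * v x) \<in> K"
  obtains c F where "c \<in> L2 m" "\<And>n::nat. F n \<in> K" "(\<lambda>n. sqdist m (F n) c) \<longlonglongrightarrow> 0"
    "\<And>k. k \<in> K \<Longrightarrow> (\<integral>x. (c x)\<^sup>2 \<partial>m) \<le> (\<integral>x. c x * k x \<partial>m)"
proof -
  define I where "I u = (\<integral>x. (u x)\<^sup>2 \<partial>m)" for u :: "'a \<Rightarrow> real"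
  define d where "d = Inf (I ` K)"
  have I0: "0 \<le> I u" for u by (simp add: I_def)
  have bdd: "bdd_below (I ` K)" by (rule bdd_belowI[of _ 0]) (auto simp: I0)
  have dle: "d \<le> I u" if "u \<in> K" for u
    unfolding d_def using that bdd by (intro cInf_lower) auto
  have "\<exists>u\<in>K. I u < d + 1 / real (Suc n)" for n
    using cInf_lessD[of "I ` K" "d + 1 / real (Suc n)"] K(2) unfolding d_def[symmetric] by auto
  then obtain F where F: "\<And>n. F n \<in> K" "\<And>n. I (F n) < d + 1 / real (Suc n)" by metis
  have FL: "F n \<in> L2 m" for n using F K by auto
  have lin: "I (\<lambda>x. (1 - t) * u x + t * v x) = (1-t)\<^sup>2 * I u + 2 * t * (1-t) * (\<integral>x. u x * v x \<partial>m) + t\<^sup>2 * I v"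
    if "u \<in> L2 m" "v \<in> L2 m" for u v t
  proof -
    have "((1 - t) * u x + t * v x)\<^sup>2 = (1-t)\<^sup>2 * (u x)\<^sup>2 + 2 * t * (1-t) * (u x * v x) + t\<^sup>2 * (v x)\<^sup>2" for x
      by algebra
    then show ?thesis
      unfolding I_def using L2D[OF that(1)] L2D[OF that(2)] L2_mult_integrable[OF that] by simp
  qed
  have cau: "sqdist m (F i) (F j) \<le> 4 / real (Suc i)" if "i \<le> j" for i j
  proof -
    have "d \<le> I (\<lambda>x. (1 - 1/2) * F i x + 1/2 * F j x)"
      by (intro dle conv F) auto
    then have "d \<le> I (F i) / 4 + (\<integral>x. F i x * F j x \<partial>m) / 2 + I (F j) / 4"
      by (subst (asm) lin[OF FL FL]) (simp add: power2_eq_square)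
    then have "sqdist m (F i) (F j) \<le> 2 * I (F i) + 2 * I (F j) - 4 * d"
      unfolding sqdist_expand[OF FL FL] I_def by simp
    also have "\<dots> \<le> 2 / real (Suc i) + 2 / real (Suc j)"
      using F(2)[of i] F(2)[of j] by simp
    also have "2 / real (Suc j) \<le> 2 / real (Suc i)" using that by (intro divide_left_mono) auto
    finally show ?thesis by simp
  qed
  have "(\<lambda>i. 4 / real (Suc i)) \<longlonglongrightarrow> 0"
    using tendsto_mult_right[OF LIMSEQ_inverse_real_of_nat, of 4] by (simp add: field_simps)
  from L2_complete[OF FL cau this] obtain c where c: "c \<in> L2 m" "(\<lambda>n. sqdist m (F n) c) \<longlonglongrightarrow> 0" by blast
  have Ic: "(\<lambda>n. I (F n)) \<longlonglongrightarrow> I c"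
    unfolding I_def by (rule tendsto_square_L2[OF FL c])
  have dn: "(\<lambda>n. d + 1 / real (Suc n)) \<longlonglongrightarrow> d + 0"
    using LIMSEQ_inverse_real_of_nat by (intro tendsto_intros) (simp add: inverse_eq_divide)
  have "\<exists>N. \<forall>n\<ge>N. I (F n) \<le> d + 1 / real (Suc n)"
    using F(2) less_imp_le by blast
  then have "I c \<le> d"
    using LIMSEQ_le[OF Ic dn] by simp
  have "(\<integral>x. (c x)\<^sup>2 \<partial>m) \<le> (\<integral>x. c x * k x \<partial>m)" if k: "k \<in> K" for k
  proof -
    define P where "P = (\<integral>x. c x * k x \<partial>m)"
    have kL: "k \<in> L2 m" using k K by auto
    \<comment> \<open>The segment from \<open>c\<close> to \<open>k\<close> is a limit of segments inside \<open>K\<close>, so the norm on it is at least that of \<open>c\<close>.\<close>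
    have t: "I c \<le> (1-t)\<^sup>2 * I c + 2 * t * (1-t) * P + t\<^sup>2 * I k" if t: "0 \<le> t" "t \<le> 1" for t
    proof -
      have "d \<le> (1-t)\<^sup>2 * I (F n) + 2 * t * (1-t) * (\<integral>x. F n x * k x \<partial>m) + t\<^sup>2 * I k" for n
        using dle[OF conv[OF F(1)[of n] k t]] lin[OF FL kL] by simp
      moreover have "(\<lambda>n. (1-t)\<^sup>2 * I (F n) + 2 * t * (1-t) * (\<integral>x. F n x * k x \<partial>m) + t\<^sup>2 * I k)
          \<longlonglongrightarrow> (1-t)\<^sup>2 * I c + 2 * t * (1-t) * P + t\<^sup>2 * I k"
        unfolding P_def by (intro tendsto_intros Ic tendsto_inner_L2 FL c kL)
      ultimately have "d \<le> (1-t)\<^sup>2 * I c + 2 * t * (1-t) * P + t\<^sup>2 * I k"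
        by (intro LIMSEQ_le_const) auto
      with \<open>I c \<le> d\<close> show ?thesis by simp
    qed
    have "2 * (I c - P) \<le> t * (I c - 2 * P + I k)" if "0 < t" "t \<le> 1" for t
    proof -
      have "0 \<le> t * (2 * (P - I c) + t * (I c - 2 * P + I k))"
        using t[of t] that by (simp add: algebra_simps power2_eq_square)
      then have "0 \<le> 2 * (P - I c) + t * (I c - 2 * P + I k)"
        using that by (simp add: zero_le_mult_iff)
      then show ?thesis by (simp add: algebra_simps)
    qed
    then have "2 * (I c - P) \<le> inverse (real (Suc n)) * (I c - 2 * P + I k)" for n
      by (auto simp: inverse_le_1_iff)
    moreover have "(\<lambda>n. inverse (real (Suc n)) * (I c - 2 * P + I k)) \<longlonglongrightarrow> 0 * (I c - 2 * P + I k)"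
      by (intro tendsto_intros LIMSEQ_inverse_real_of_nat)
    ultimately have "2 * (I c - P) \<le> 0 * (I c - 2 * P + I k)"
      by (intro LIMSEQ_le_const[of "\<lambda>n. inverse (real (Suc n)) * (I c - 2 * P + I k)"]) auto
    then show ?thesis by (simp add: I_def P_def)
  qed
  with c F(1) show ?thesis by (intro that[of c F]) auto
qed

section \<open>Slopes of Lipschitz functions\<close>

text \<open>
  For Lipschitz functions \<^const>\<open>lip\<close> is finite, so that nothing is lost by passing to real numbers.
\<close>

definition slope :: "('a::metric_space \<Rightarrow> real) \<Rightarrow> 'a \<Rightarrow> real" where
  "slope u x = enn2real (lip u x)"

text \<open>
  At an isolated point the filter is trivial and the upper limit is \<open>0\<close>, in agreement with the
  convention for \<^const>\<open>lip\<close>.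
\<close>

lemma lip_eq_Limsup: "lip u x = Limsup (at x) (\<lambda>y. ennreal (\<bar>u y - u x\<bar> / dist y x))"
proof (cases "x islimpt UNIV")
  case False
  then have "at x = bot" by (simp add: trivial_limit_within[symmetric] trivial_limit_def)
  then show ?thesis using False by (simp add: lip_def bot_ennreal)
qed (simp add: lip_def)

text \<open>
  This form of an upper bound for the slope turns all rules for slopes into estimates of
  increments.
\<close>

lemma lip_le_iff:
  assumes "0 \<le> c"
  shows "lip u x \<le> ennreal c \<longleftrightarrow> (\<forall>e>0. \<forall>\<^sub>F y in at x. \<bar>u y - u x\<bar> \<le> (c + e) * dist y x)"
proof -
  have ne: "\<forall>\<^sub>F y in at x. y \<noteq> x" by (simp add: eventually_at_filter)
  show ?thesis
    unfolding lip_eq_Limsup Limsup_le_iff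
  proof safe
    fix e :: real assume e: "0 < e"
      and "\<forall>y>ennreal c. \<forall>\<^sub>F xa in at x. ennreal (\<bar>u xa - u x\<bar> / dist xa x) < y"
    then have "\<forall>\<^sub>F y in at x. ennreal (\<bar>u y - u x\<bar> / dist y x) < ennreal (c + e)"
      using assms by (simp add: ennreal_less_iff)
    with ne show "\<forall>\<^sub>F y in at x. \<bar>u y - u x\<bar> \<le> (c + e) * dist y x"
    proof eventually_elim
      case (elim y)
      then show ?case by (simp add: ennreal_less_iff divide_less_eq)
    qed
  next
    fix b :: ennreal
    assume b: "ennreal c < b"
      and E: "\<forall>e>0. \<forall>\<^sub>F y in at x. \<bar>u y - u x\<bar> \<le> (c + e) * dist y x"
    obtain e where e: "0 < e" "ennreal (c + e) < b"
    proof (cases b)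
      case (real r)
      then show ?thesis using b assms by (intro that[of "(r - c) / 2"]) (auto simp: ennreal_less_iff field_simps)
    qed (auto intro: that[of 1])
    from E e(1) have "\<forall>\<^sub>F y in at x. \<bar>u y - u x\<bar> \<le> (c + e) * dist y x" by blast
    with ne show "\<forall>\<^sub>F y in at x. ennreal (\<bar>u y - u x\<bar> / dist y x) < b"
    proof eventually_elim
      case (elim y)
      then have "ennreal (\<bar>u y - u x\<bar> / dist y x) \<le> ennreal (c + e)"
        by (intro ennreal_leI) (simp add: divide_le_eq)
      with e show ?case by simp
    qed
  qed
qed

lemma slope_nonneg [simp]: "0 \<le> slope u x" by (simp add: slope_def)

lemma slope_leI:
  assumes "0 \<le> c" "\<And>e. 0 < e \<Longrightarrow> \<forall>\<^sub>F y in at x. \<bar>u y - u x\<bar> \<le> (c + e) * dist y x"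
  shows "slope u x \<le> c"
  using enn2real_mono[of "lip u x" "ennreal c"] lip_le_iff[OF assms(1), of u x] assms
  by (auto simp: slope_def)

lemma LipE:
  assumes "u \<in> Lip"
  obtains C where "0 \<le> C" "\<And>x y. \<bar>u x - u y\<bar> \<le> C * dist x y"
  using assms by (force simp: Lip_def lipschitz_on_def dist_real_def)

lemma LipI:
  assumes "0 \<le> C" "\<And>x y. \<bar>u x - u y\<bar> \<le> C * dist x y"
  shows "u \<in> Lip"
  using assms by (auto simp: Lip_def lipschitz_on_def dist_real_def)

lemma lip_le_Lipschitz_const:
  assumes "0 \<le> C" "\<And>x y. \<bar>u x - u y\<bar> \<le> C * dist x y"
  shows "lip u x \<le> ennreal C"
  unfolding lip_le_iff[OF assms(1)]
proof (intro allI impI always_eventually)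
  fix e :: real and y assume "0 < e"
  have "\<bar>u y - u x\<bar> \<le> C * dist y x" by (rule assms)
  also have "\<dots> \<le> (C + e) * dist y x" using \<open>0 < e\<close> by (intro mult_right_mono) auto
  finally show "\<bar>u y - u x\<bar> \<le> (C + e) * dist y x" .
qed

lemma slope_le_Lipschitz_const:
  assumes "0 \<le> C" "\<And>x y. \<bar>u x - u y\<bar> \<le> C * dist x y"
  shows "slope u x \<le> C"
  using enn2real_mono[OF lip_le_Lipschitz_const[OF assms, of x]] assms(1)
  by (simp add: slope_def)

lemma ennreal_slope: "u \<in> Lip \<Longrightarrow> ennreal (slope u x) = lip u x"
  unfolding slope_def
  by (rule ennreal_enn2real) (metis LipE lip_le_Lipschitz_const ennreal_less_top le_less_trans)

lemma slopeD:
  assumes "u \<in> Lip" "0 < e"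
  shows "\<forall>\<^sub>F y in at x. \<bar>u y - u x\<bar> \<le> (slope u x + e) * dist y x"
  using lip_le_iff[of "slope u x" u x] ennreal_slope[OF assms(1), of x] assms(2) by auto

lemma continuous_Lip: "u \<in> Lip \<Longrightarrow> continuous_on UNIV u"
  by (auto simp: Lip_def intro: lipschitz_on_continuous_on)

lemma tendsto_Lip: "u \<in> Lip \<Longrightarrow> (u \<longlongrightarrow> u x) (at x)"
  using continuous_Lip[of u] by (simp add: continuous_on_def)

lemma slope_dominated:
  assumes u: "u \<in> Lip" and "0 \<le> C" "0 \<le> D"
    and ev: "\<forall>\<^sub>F y in at x. \<bar>v y - v x\<bar> \<le> C * \<bar>u y - u x\<bar> + D * dist y x"
  shows "slope v x \<le> C * slope u x + D"
proof (rule slope_leI)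
  show "0 \<le> C * slope u x + D" using assms by simp
  fix e :: real assume e: "0 < e"
  define d where "d = e / (C + 1)"
  have d: "0 < d" "C * d \<le> e" using e \<open>0 \<le> C\<close> by (auto simp: d_def field_simps)
  from slopeD[OF u d(1), of x] ev
  show "\<forall>\<^sub>F y in at x. \<bar>v y - v x\<bar> \<le> (C * slope u x + D + e) * dist y x"
  proof eventually_elim
    case (elim y)
    have "\<bar>v y - v x\<bar> \<le> C * ((slope u x + d) * dist y x) + D * dist y x"
      using elim mult_left_mono[OF elim(1) \<open>0 \<le> C\<close>] by linarith
    also have "\<dots> = (C * slope u x + D + C * d) * dist y x" by (simp add: algebra_simps)
    also have "\<dots> \<le> (C * slope u x + D + e) * dist y x"
      using d by (intro mult_right_mono) auto
    finally show ?case .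
  qed
qed

lemma slope_contraction:
  assumes "u \<in> Lip" "0 \<le> C" "\<And>s t. \<bar>S s - S t\<bar> \<le> C * \<bar>s - t\<bar>"
  shows "slope (\<lambda>x. S (u x)) x \<le> C * slope u x"
  using slope_dominated[where u = u and C = C and D = 0 and x = x and v = "\<lambda>x. S (u x)"] assms by simp

text \<open>
  The common pattern of the sum rule and of the interpolation rule: an increment is bounded by
  increments of two Lipschitz functions and by an error of first order with a continuous
  coefficient \<open>k\<close>.
\<close>

lemma slope_combination:
  assumes u: "u \<in> Lip" and v: "v \<in> Lip" and ab: "0 \<le> a" "0 \<le> b" "0 \<le> L"
    and w: "\<And>y. \<bar>w y - w x\<bar> \<le> a * \<bar>u y - u x\<bar> + b * \<bar>v y - v x\<bar> + L * k y * dist y x"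
    and k: "(k \<longlongrightarrow> k x) (at x)" "0 \<le> k x"
  shows "slope w x \<le> a * slope u x + b * slope v x + L * k x"
proof (rule slope_leI)
  show "0 \<le> a * slope u x + b * slope v x + L * k x" using assms by simp
  fix e :: real assume e: "0 < e"
  define d where "d = e / (a + b + L + 1)"
  have d: "0 < d" using e ab by (auto simp: d_def)
  have d': "(a + b + L) * d \<le> e" using e ab by (simp add: d_def field_simps)
  have "\<forall>\<^sub>F y in at x. k y < k x + d" using order_tendstoD(2)[OF k(1), of "k x + d"] d by simp
  then show "\<forall>\<^sub>F y in at x. \<bar>w y - w x\<bar> \<le> (a * slope u x + b * slope v x + L * k x + e) * dist y x"
    using slopeD[OF u d, of x] slopeD[OF v d, of x]
  proof eventually_elim
    case (elim y)
    have "L * k y * dist y x \<le> L * (k x + d) * dist y x"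
      using elim(1) ab by (intro mult_right_mono mult_left_mono) auto
    then have "\<bar>w y - w x\<bar> \<le> a * ((slope u x + d) * dist y x) + b * ((slope v x + d) * dist y x)
        + L * (k x + d) * dist y x"
      using w[of y] mult_left_mono[OF elim(2) ab(1)] mult_left_mono[OF elim(3) ab(2)] by linarith
    also have "\<dots> = (a * slope u x + b * slope v x + L * k x + (a + b + L) * d) * dist y x"
      by (simp add: algebra_simps)
    also have "\<dots> \<le> (a * slope u x + b * slope v x + L * k x + e) * dist y x"
      using d' by (intro mult_right_mono) auto
    finally show ?case .
  qed
qed

lemma abs_lincomb_diff_le:
  fixes a b s t s' t' :: real
  shows "\<bar>a * s + b * t - (a * s' + b * t')\<bar> \<le> \<bar>a\<bar> * \<bar>s - s'\<bar> + \<bar>b\<bar> * \<bar>t - t'\<bar>"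
proof -
  have "a * s + b * t - (a * s' + b * t') = a * (s - s') + b * (t - t')" by algebra
  then show ?thesis by (metis abs_mult abs_triangle_ineq)
qed

lemma slope_lincomb:
  assumes "u \<in> Lip" "v \<in> Lip"
  shows "slope (\<lambda>x. a * u x + b * v x) x \<le> \<bar>a\<bar> * slope u x + \<bar>b\<bar> * slope v x"
proof -
  have "\<bar>a * u y + b * v y - (a * u x + b * v x)\<bar> \<le> \<bar>a\<bar> * \<bar>u y - u x\<bar> + \<bar>b\<bar> * \<bar>v y - v x\<bar>" for y
    by (rule abs_lincomb_diff_le)
  then show ?thesis
    using slope_combination[OF assms, where a = "\<bar>a\<bar>" and b = "\<bar>b\<bar>" and L = 0 and k = "\<lambda>_. 0"]
    by simp
qed

text \<open>
  A convex combination with variable weights. The derivative of the weight enters only through the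
  difference of the two functions, which disappears when both converge to the same limit.
\<close>

lemma slope_interpolation:
  assumes u: "u \<in> Lip" and v: "v \<in> Lip"
    and p: "\<And>x. 0 \<le> p x" "\<And>x. p x \<le> 1" "0 \<le> L" "\<And>x y. \<bar>p x - p y\<bar> \<le> L * dist x y"
  shows "slope (\<lambda>x. p x * u x + (1 - p x) * v x) x
      \<le> p x * slope u x + (1 - p x) * slope v x + L * \<bar>u x - v x\<bar>"
proof (rule slope_combination[OF u v])
  show "((\<lambda>y. \<bar>u y - v y\<bar>) \<longlongrightarrow> \<bar>u x - v x\<bar>) (at x)"
    by (intro tendsto_intros tendsto_Lip u v)
  fix y
  have "p y * u y + (1 - p y) * v y - (p x * u x + (1 - p x) * v x)
      = p x * (u y - u x) + (1 - p x) * (v y - v x) + (p y - p x) * (u y - v y)"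
    by algebra
  also have "\<bar>\<dots>\<bar> \<le> \<bar>p x * (u y - u x)\<bar> + \<bar>(1 - p x) * (v y - v x)\<bar> + \<bar>(p y - p x) * (u y - v y)\<bar>"
    by linarith
  also have "\<dots> = p x * \<bar>u y - u x\<bar> + (1 - p x) * \<bar>v y - v x\<bar> + \<bar>p y - p x\<bar> * \<bar>u y - v y\<bar>"
    using p(1)[of x] p(2)[of x] by (simp add: abs_mult)
  also have "\<bar>p y - p x\<bar> * \<bar>u y - v y\<bar> \<le> (L * dist y x) * \<bar>u y - v y\<bar>"
    by (rule mult_right_mono[OF p(4)]) simp
  finally show "\<bar>p y * u y + (1 - p y) * v y - (p x * u x + (1 - p x) * v x)\<bar>
      \<le> p x * \<bar>u y - u x\<bar> + (1 - p x) * \<bar>v y - v x\<bar> + L * \<bar>u y - v y\<bar> * dist y x"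
    by (simp add: mult_ac)
qed (use p in auto)

lemma slope_chain:
  assumes u: "u \<in> Lip" and S: "(S has_real_derivative D) (at (u x))"
  shows "slope (\<lambda>x. S (u x)) x \<le> \<bar>D\<bar> * slope u x"
proof (rule field_le_epsilon)
  fix e :: real assume "0 < e"
  define d where "d = e / (slope u x + 1)"
  have "0 \<le> slope u x" by simp
  then have d: "0 < d" "d * slope u x \<le> e" using \<open>0 < e\<close> by (auto simp: d_def field_simps add_pos_nonneg)
  have "\<forall>\<^sub>F t in at (u x). dist ((S t - S (u x)) / (t - u x)) D < d"
    using S d(1) unfolding has_field_derivative_iff by (rule tendstoD)
  then have "\<forall>\<^sub>F t in nhds (u x). \<bar>S t - S (u x)\<bar> \<le> (\<bar>D\<bar> + d) * \<bar>t - u x\<bar>"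
    unfolding eventually_at_filter
  proof eventually_elim
    case (elim t)
    show ?case
    proof (cases "t = u x")
      case False
      with elim have "\<bar>(S t - S (u x)) / (t - u x) - D\<bar> < d" by (simp add: dist_real_def)
      then have "\<bar>(S t - S (u x)) / (t - u x)\<bar> \<le> \<bar>D\<bar> + d" by linarith
      then show ?thesis using False by (simp add: abs_divide divide_le_eq)
    qed simp
  qed
  then have "\<forall>\<^sub>F y in at x. \<bar>S (u y) - S (u x)\<bar> \<le> (\<bar>D\<bar> + d) * \<bar>u y - u x\<bar>"
    using tendsto_Lip[OF u, of x] by (rule eventually_compose_filterlim)
  then have "slope (\<lambda>x. S (u x)) x \<le> (\<bar>D\<bar> + d) * slope u x + 0"
    using d by (intro slope_dominated[OF u]) auto
  with d show "slope (\<lambda>x. S (u x)) x \<le> \<bar>D\<bar> * slope u x + e" by (simp add: algebra_simps)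
qed

text \<open>
  For fixed error and radius, the points at which the difference quotient exceeds a bound form a
  union of open sets indexed by the second argument; the sublevel sets of the slope are obtained
  from these by countable operations.
\<close>

lemma borel_measurable_slope:
  fixes u :: "'a::metric_space \<Rightarrow> real"
  assumes u: "u \<in> Lip"
  shows "slope u \<in> borel_measurable borel"
  unfolding borel_measurable_iff_le
proof
  fix c :: real
  have cont: "continuous_on UNIV u" by (rule continuous_Lip[OF u])
  show "{x \<in> space borel. slope u x \<le> c} \<in> sets borel"
  proof (cases "0 \<le> c")
    case False
    then have "{x \<in> space borel. slope u x \<le> c} = {}" using slope_nonneg by (auto simp: not_le intro: less_le_trans)
    then show ?thesis by simp
  next
    case True
    define A where "A n k = {x. \<exists>y. dist y x < 1 / real (Suc k) \<and> \<bar>u y - u x\<bar> > (c + 1 / real (Suc n)) * dist y x}" for n k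
    have "open (A n k)" for n k
    proof -
      have "A n k = (\<Union>y. {x. dist y x < 1 / real (Suc k)} \<inter> {x. \<bar>u y - u x\<bar> > (c + 1 / real (Suc n)) * dist y x})"
        by (auto simp: A_def)
      also have "open \<dots>"
        by (intro open_UN ballI open_Int open_Collect_less continuous_intros cont)
      finally show ?thesis .
    qed
    then have A: "- A n k \<in> sets borel" for n k by auto
    have "slope u x \<le> c \<longleftrightarrow> (\<forall>n. \<exists>k. x \<notin> A n k)" for x
    proof
      assume le: "slope u x \<le> c"
      show "\<forall>n. \<exists>k. x \<notin> A n k"
      proof
        fix n
        obtain d where d: "d > 0" "\<And>y. y \<noteq> x \<Longrightarrow> dist y x < d \<Longrightarrow> \<bar>u y - u x\<bar> \<le> (slope u x + 1 / real (Suc n)) * dist y x"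
          using slopeD[OF u, of "1 / real (Suc n)" x] unfolding eventually_at by auto
        obtain k where k: "1 / real (Suc k) < d" using d(1) nat_approx_posE by blast
        have "\<bar>u y - u x\<bar> \<le> (c + 1 / real (Suc n)) * dist y x" if "dist y x < 1 / real (Suc k)" for y
        proof (cases "y = x")
          case False
          then have "\<bar>u y - u x\<bar> \<le> (slope u x + 1 / real (Suc n)) * dist y x" using d(2) that k by simp
          also have "\<dots> \<le> (c + 1 / real (Suc n)) * dist y x" using le by (intro mult_right_mono) auto
          finally show ?thesis .
        qed simp
        then have "x \<notin> A n k" unfolding A_def using leD by blast
        then show "\<exists>k. x \<notin> A n k" ..
      qed
    next
      assume R: "\<forall>n. \<exists>k. x \<notin> A n k"
      show "slope u x \<le> c"
      proof (rule slope_leI[OF True])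
        fix e :: real assume "0 < e"
        then obtain n where n: "1 / real (Suc n) < e" using nat_approx_posE by blast
        from R obtain k where k: "x \<notin> A n k" by blast
        have "\<bar>u y - u x\<bar> \<le> (c + e) * dist y x" if "dist y x < 1 / real (Suc k)" for y
        proof -
          have "\<bar>u y - u x\<bar> \<le> (c + 1 / real (Suc n)) * dist y x" using k that unfolding A_def by force
          also have "\<dots> \<le> (c + e) * dist y x" using n by (intro mult_right_mono) auto
          finally show ?thesis .
        qed
        then show "\<forall>\<^sub>F y in at x. \<bar>u y - u x\<bar> \<le> (c + e) * dist y x"
          unfolding eventually_at by (intro exI[of _ "1 / real (Suc k)"]) auto
      qed
    qed
    then have "{x \<in> space borel. slope u x \<le> c} = (\<Inter>n. \<Union>k. - A n k)" by auto
    also have "\<dots> \<in> sets borel" using A by auto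
    finally show ?thesis .
  qed
qed

lemma Lip_lincomb: assumes "u \<in> Lip" "v \<in> Lip" shows "(\<lambda>x. a * u x + b * v x) \<in> Lip"
proof -
  obtain C where C: "0 \<le> C" "\<And>x y. \<bar>u x - u y\<bar> \<le> C * dist x y" using LipE[OF assms(1)] by blast
  obtain D where D: "0 \<le> D" "\<And>x y. \<bar>v x - v y\<bar> \<le> D * dist x y" using LipE[OF assms(2)] by blast
  show ?thesis
  proof (rule LipI[of "\<bar>a\<bar> * C + \<bar>b\<bar> * D"])
    fix x y
    have "\<bar>a * u x + b * v x - (a * u y + b * v y)\<bar> \<le> \<bar>a\<bar> * \<bar>u x - u y\<bar> + \<bar>b\<bar> * \<bar>v x - v y\<bar>"
      by (rule abs_lincomb_diff_le)
    also have "\<dots> \<le> \<bar>a\<bar> * (C * dist x y) + \<bar>b\<bar> * (D * dist x y)"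
      by (intro add_mono mult_left_mono C D) auto
    finally show "\<bar>a * u x + b * v x - (a * u y + b * v y)\<bar> \<le> (\<bar>a\<bar> * C + \<bar>b\<bar> * D) * dist x y"
      by (simp add: algebra_simps)
  qed (use C D in auto)
qed

lemma Lip_contraction:
  assumes "u \<in> Lip" "0 \<le> C" "\<And>s t. \<bar>S s - S t\<bar> \<le> C * \<bar>s - t\<bar>"
  shows "(\<lambda>x. S (u x)) \<in> Lip"
proof -
  obtain D where D: "0 \<le> D" "\<And>x y. \<bar>u x - u y\<bar> \<le> D * dist x y" using LipE[OF assms(1)] by blast
  show ?thesis
  proof (rule LipI[of "C * D"])
    fix x y
    show "\<bar>S (u x) - S (u y)\<bar> \<le> C * D * dist x y"
      using order_trans[OF assms(3)[of "u x" "u y"] mult_left_mono[OF D(2) assms(2), of x y]] by (simp add: mult.assoc)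
  qed (use D assms in auto)
qed

lemma Lip_mult:
  assumes "u \<in> Lip" "v \<in> Lip" "\<And>x. \<bar>u x\<bar> \<le> M" "\<And>x. \<bar>v x\<bar> \<le> N"
  shows "(\<lambda>x. u x * v x) \<in> Lip"
proof -
  obtain C where C: "0 \<le> C" "\<And>x y. \<bar>u x - u y\<bar> \<le> C * dist x y" using LipE[OF assms(1)] by blast
  obtain D where D: "0 \<le> D" "\<And>x y. \<bar>v x - v y\<bar> \<le> D * dist x y" using LipE[OF assms(2)] by blast
  have MN: "0 \<le> M" "0 \<le> N" using assms(3,4) abs_ge_zero order_trans by blast+
  show ?thesis
  proof (rule LipI[of "M * D + N * C"])
    fix x y
    have "u x * v x - u y * v y = u x * (v x - v y) + v y * (u x - u y)" by algebra
    then have "\<bar>u x * v x - u y * v y\<bar> \<le> \<bar>u x\<bar> * \<bar>v x - v y\<bar> + \<bar>v y\<bar> * \<bar>u x - u y\<bar>"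
      by (metis abs_mult abs_triangle_ineq)
    also have "\<dots> \<le> M * (D * dist x y) + N * (C * dist x y)"
      by (intro add_mono mult_mono C D assms MN) auto
    finally show "\<bar>u x * v x - u y * v y\<bar> \<le> (M * D + N * C) * dist x y"
      by (simp add: algebra_simps)
  qed (use C D MN in auto)
qed

lemma Lip_b_Lip: "u \<in> Lip_b \<Longrightarrow> u \<in> Lip" by (simp add: Lip_b_def)

lemma Lip_b_bound: assumes "u \<in> Lip_b" obtains M where "\<And>x. \<bar>u x\<bar> \<le> M"
  using assms by (force simp: Lip_b_def bounded_iff)

lemma Lip_b_lincomb: assumes "u \<in> Lip_b" "v \<in> Lip_b" shows "(\<lambda>x. a * u x + b * v x) \<in> Lip_b"
proof -
  obtain M where M: "\<And>x. \<bar>u x\<bar> \<le> M" by (rule Lip_b_bound[OF assms(1)]) blast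
  obtain N where N: "\<And>x. \<bar>v x\<bar> \<le> N" by (rule Lip_b_bound[OF assms(2)]) blast
  have "\<bar>a * u x + b * v x\<bar> \<le> \<bar>a\<bar> * M + \<bar>b\<bar> * N" for x
  proof -
    have "\<bar>a * u x + b * v x\<bar> \<le> \<bar>a\<bar> * \<bar>u x\<bar> + \<bar>b\<bar> * \<bar>v x\<bar>"
      using abs_triangle_ineq[of "a * u x" "b * v x"] by (simp add: abs_mult)
    also have "\<dots> \<le> \<bar>a\<bar> * M + \<bar>b\<bar> * N" by (intro add_mono mult_left_mono M N) auto
    finally show ?thesis .
  qed
  then have "bounded (range (\<lambda>x. a * u x + b * v x))" by (intro boundedI[of _ "\<bar>a\<bar> * M + \<bar>b\<bar> * N"]) auto
  with assms show ?thesis by (auto simp: Lip_b_def intro: Lip_lincomb)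
qed

lemma Lip_b_mult: assumes "u \<in> Lip_b" "v \<in> Lip_b" shows "(\<lambda>x. u x * v x) \<in> Lip_b"
proof -
  obtain M where M: "\<And>x. \<bar>u x\<bar> \<le> M" by (rule Lip_b_bound[OF assms(1)]) blast
  obtain N where N: "\<And>x. \<bar>v x\<bar> \<le> N" by (rule Lip_b_bound[OF assms(2)]) blast
  have "\<bar>u x * v x\<bar> \<le> M * N" for x
    unfolding abs_mult by (rule mult_mono[OF M N order_trans[OF abs_ge_zero M] abs_ge_zero])
  then have "bounded (range (\<lambda>x. u x * v x))" by (intro boundedI[of _ "M * N"]) auto
  with Lip_mult[OF Lip_b_Lip[OF assms(1)] Lip_b_Lip[OF assms(2)] M N] show ?thesis by (simp add: Lip_b_def)
qed

lemma Lip_bs_Lip_b: assumes "u \<in> Lip_bs" shows "u \<in> Lip_b"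
proof -
  have u: "u \<in> Lip" "bounded {x. u x \<noteq> 0}" using assms by (auto simp: Lip_bs_def)
  obtain C where C: "0 \<le> C" "\<And>x y. \<bar>u x - u y\<bar> \<le> C * dist x y" by (rule LipE[OF u(1)]) blast
  show ?thesis
  proof (cases "\<exists>z. u z \<noteq> 0")
    case True
    then obtain z where z: "u z \<noteq> 0" by blast
    obtain R where R: "\<And>x. u x \<noteq> 0 \<Longrightarrow> dist z x \<le> R" using u(2) unfolding bounded_any_center[of _ z] by blast
    have "\<bar>u x\<bar> \<le> \<bar>u z\<bar> + C * R" for x
    proof (cases "u x = 0")
      case True
      have "0 \<le> R" using R[OF z] by simp
      then show ?thesis using True C by simp
    next
      case False
      have "\<bar>u x - u z\<bar> \<le> C * R" using C(2)[of x z] mult_left_mono[OF R[OF False] C(1)] by (simp add: dist_commute)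
      then show ?thesis by linarith
    qed
    then show ?thesis using u(1) by (auto simp: Lip_b_def intro!: boundedI)
  next
    case False
    then show ?thesis using u(1) by (auto simp: Lip_b_def intro!: boundedI[of _ 0])
  qed
qed

lemma Lip_bs_mult: assumes "u \<in> Lip_bs" "v \<in> Lip_b" shows "(\<lambda>x. u x * v x) \<in> Lip_bs"
proof -
  have "{x. u x * v x \<noteq> 0} \<subseteq> {x. u x \<noteq> 0}" by auto
  then have "bounded {x. u x * v x \<noteq> 0}" using assms(1) bounded_subset by (auto simp: Lip_bs_def)
  then show ?thesis using Lip_b_mult[OF Lip_bs_Lip_b[OF assms(1)] assms(2)] by (simp add: Lip_bs_def Lip_b_def)
qed

lemma slope_cong_eventually:
  assumes "\<forall>\<^sub>F y in nhds x. u y = v y"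
  shows "slope u x = slope v x"
proof -
  have "u x = v x" using assms by (rule eventually_nhds_x_imp_x)
  have "\<forall>\<^sub>F y in at x. u y = v y" using assms by (auto simp: eventually_at_filter elim: eventually_mono)
  then have "\<forall>\<^sub>F y in at x. ennreal (\<bar>u y - u x\<bar> / dist y x) = ennreal (\<bar>v y - v x\<bar> / dist y x)"
    by eventually_elim (simp add: \<open>u x = v x\<close>)
  then have "Limsup (at x) (\<lambda>y. ennreal (\<bar>u y - u x\<bar> / dist y x)) = Limsup (at x) (\<lambda>y. ennreal (\<bar>v y - v x\<bar> / dist y x))"
    by (rule Limsup_eq)
  then show ?thesis unfolding slope_def lip_eq_Limsup by simp
qed

lemma slope_zero_outside:
  assumes "closed A" "x \<notin> A" "\<And>y. y \<notin> A \<Longrightarrow> u y = 0"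
  shows "slope u x = 0"
proof -
  have "\<forall>\<^sub>F y in nhds x. y \<in> - A" using assms(1,2) by (intro eventually_nhds_in_open) auto
  then have "\<forall>\<^sub>F y in nhds x. u y = 0" by eventually_elim (use assms(3) in auto)
  then have "slope u x = slope (\<lambda>_. 0) x" by (rule slope_cong_eventually)
  also have "\<dots> \<le> 0" by (rule slope_le_Lipschitz_const) auto
  finally show ?thesis using slope_nonneg[of u x] by linarith
qed

text \<open>
  A Lipschitz function with bounded support that equals \<open>1\<close> on the ball of radius \<open>R\<close>.
\<close>

definition cutoff :: "'a::metric_space \<Rightarrow> real \<Rightarrow> 'a \<Rightarrow> real" where
  "cutoff a R x = max 0 (min 1 (R + 1 - dist x a))"

lemma cutoff_bounds: "0 \<le> cutoff a R x" "cutoff a R x \<le> 1" by (auto simp: cutoff_def)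

lemma cutoff_eq_1: "dist x a \<le> R \<Longrightarrow> cutoff a R x = 1" by (auto simp: cutoff_def)

lemma cutoff_Lipschitz: "\<bar>cutoff a R x - cutoff a R y\<bar> \<le> 1 * dist x y"
proof -
  have "\<bar>dist x a - dist y a\<bar> \<le> dist x y" by (metis abs_dist_diff_le dist_commute)
  then show ?thesis by (auto simp: cutoff_def max_def min_def)
qed

lemma cutoff_Lip_bs: "cutoff a R \<in> Lip_bs"
proof -
  have "{x. cutoff a R x \<noteq> 0} \<subseteq> cball a (R + 1)" by (auto simp: cutoff_def dist_commute)
  then have "bounded {x. cutoff a R x \<noteq> 0}" using bounded_cball bounded_subset by blast
  then show ?thesis using LipI[OF _ cutoff_Lipschitz] by (auto simp: Lip_bs_def)
qed

section \<open>Cheeger energy and strong relaxed gradients\<close>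

locale mm_space =
  fixes m :: "'a::{heine_borel, polish_space} measure"
  assumes mms: "metric_measure_space m"

context mm_space
begin

lemma sets_m [measurable_cong, simp]: "sets m = sets borel"
  using mms by (simp add: metric_measure_space_def radon_measure_def)

lemma space_m [simp]: "space m = UNIV"
  using sets_eq_imp_space_eq[OF sets_m] by simp

lemma borel_measurable_m: "borel_measurable m = borel_measurable borel"
  by (rule measurable_cong_sets) auto

lemma emeasure_bounded: "B \<in> sets borel \<Longrightarrow> bounded B \<Longrightarrow> emeasure m B < \<infinity>"
  using mms by (simp add: metric_measure_space_def)

lemma measurable_Lip [measurable]: "u \<in> Lip \<Longrightarrow> u \<in> borel_measurable m"
  using borel_measurable_continuous_onI[OF continuous_Lip] by (simp add: borel_measurable_m)

lemma measurable_slope [measurable]: "u \<in> Lip \<Longrightarrow> slope u \<in> borel_measurable m"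
  using borel_measurable_slope by (simp add: borel_measurable_m)

lemma nn_integral_lip: "u \<in> Lip \<Longrightarrow> (\<integral>\<^sup>+x. (lip u x)\<^sup>2 \<partial>m) = (\<integral>\<^sup>+x. ennreal ((slope u x)\<^sup>2) \<partial>m)"
  by (simp flip: ennreal_slope add: ennreal_power)

lemma nn_integral_lip_L2:
  assumes "u \<in> Lip" "slope u \<in> L2 m"
  shows "(\<integral>\<^sup>+x. (lip u x)\<^sup>2 \<partial>m) / 2 = ennreal ((\<integral>x. (slope u x)\<^sup>2 \<partial>m) / 2)"
proof -
  have "(\<integral>\<^sup>+x. (lip u x)\<^sup>2 \<partial>m) = ennreal (\<integral>x. (slope u x)\<^sup>2 \<partial>m)"
    unfolding nn_integral_lip[OF assms(1)]
    by (rule nn_integral_eq_integral) (use L2D(2)[OF assms(2)] in auto)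
  then show ?thesis by (simp add: ennreal_divide_numeral)
qed

lemma slope_in_L2:
  assumes u: "u \<in> Lip" and "(\<integral>\<^sup>+x. (lip u x)\<^sup>2 \<partial>m) / 2 < \<infinity>"
  shows "slope u \<in> L2 m"
proof -
  have "(\<integral>\<^sup>+x. ennreal ((slope u x)\<^sup>2) \<partial>m) < \<infinity>"
    using assms(2) unfolding nn_integral_lip[OF u]
    by (cases "\<integral>\<^sup>+x. ennreal ((slope u x)\<^sup>2) \<partial>m = \<infinity>") (auto simp: less_top ennreal_top_divide)
  then have "integrable m (\<lambda>x. (slope u x)\<^sup>2)"
    by (intro integrableI_bounded) (use u in auto)
  then show ?thesis using u by (simp add: L2_def)
qed

text \<open>
  The energy is an infimum over sequences; it is enough to find, at each distance, one Lipschitz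
  function with energy at most \<open>a\<close>. Together with \<open>Ch_approx\<close> this replaces sequences by single
  functions.
\<close>

lemma Ch_leI:
  assumes f: "f \<in> L2 m"
    and "\<And>e. 0 < e \<Longrightarrow> \<exists>u\<in>Lip \<inter> L2 m. sqdist m u f < e \<and> (\<integral>\<^sup>+x. (lip u x)\<^sup>2 \<partial>m) / 2 \<le> a"
  shows "Ch m f \<le> a"
proof -
  have "\<exists>u\<in>Lip \<inter> L2 m. sqdist m u f < 1 / real (Suc n) \<and> (\<integral>\<^sup>+x. (lip u x)\<^sup>2 \<partial>m) / 2 \<le> a" for n
    by (rule assms(2)) simp
  then obtain F where F: "\<And>n. F n \<in> Lip \<inter> L2 m" "\<And>n. sqdist m (F n) f < 1 / real (Suc n)"
    "\<And>n. (\<integral>\<^sup>+x. (lip (F n) x)\<^sup>2 \<partial>m) / 2 \<le> a" by metis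
  have "(\<lambda>n. sqdist m (F n) f) \<longlonglongrightarrow> 0"
    by (rule sqdist_tendsto_zeroI) (rule F(2))
  then have t: "L2_tendsto m F f" using L2_tendsto_iff[of F m f] F(1) f by auto
  have "Ch m f \<le> liminf (\<lambda>n. (\<integral>\<^sup>+x. (lip (F n) x)\<^sup>2 \<partial>m) / 2)"
    unfolding Ch_def by (rule INF_lower) (use F(1) t in auto)
  also have "\<dots> \<le> a" by (rule Liminf_le) (use F(3) in auto)
  finally show ?thesis .
qed

lemma Ch_approx:
  assumes f: "f \<in> L2 m" and "Ch m f < a" "0 < e"
  shows "\<exists>u\<in>Lip \<inter> L2 m. sqdist m u f < e \<and> (\<integral>\<^sup>+x. (lip u x)\<^sup>2 \<partial>m) / 2 < a"
proof -
  obtain F where F: "range F \<subseteq> Lip \<inter> L2 m" "L2_tendsto m F f"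
    and lim: "liminf (\<lambda>n. (\<integral>\<^sup>+x. (lip (F n) x)\<^sup>2 \<partial>m) / 2) < a"
    using assms(2) unfolding Ch_def INF_less_iff by blast
  have ev: "\<forall>\<^sub>F n in sequentially. sqdist m (F n) f < e"
    using F L2_tendsto_iff[of F m f] f assms(3) by (intro order_tendstoD(2)[of _ 0]) auto
  have "\<exists>n. sqdist m (F n) f < e \<and> (\<integral>\<^sup>+x. (lip (F n) x)\<^sup>2 \<partial>m) / 2 < a"
  proof (rule ccontr)
    assume "\<not> ?thesis"
    then have "a \<le> (\<integral>\<^sup>+x. (lip (F n) x)\<^sup>2 \<partial>m) / 2" if "sqdist m (F n) f < e" for n
      using that not_less by blast
    then have "\<forall>\<^sub>F n in sequentially. a \<le> (\<integral>\<^sup>+x. (lip (F n) x)\<^sup>2 \<partial>m) / 2"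
      using ev by (rule eventually_mono[rotated])
    then have "a \<le> liminf (\<lambda>n. (\<integral>\<^sup>+x. (lip (F n) x)\<^sup>2 \<partial>m) / 2)" by (rule Liminf_bounded)
    with lim show False by simp
  qed
  then show ?thesis using F(1) by blast
qed

text \<open>
  The factor \<open>2\<close> makes this the square integral of the minimal relaxed gradient.
\<close>

definition energy :: "('a \<Rightarrow> real) \<Rightarrow> real" where
  "energy f = 2 * enn2real (Ch m f)"

lemma energy_nonneg [simp]: "0 \<le> energy f" by (simp add: energy_def)

lemma W12_L2: "f \<in> W12 m \<Longrightarrow> f \<in> L2 m" by (simp add: W12_def)

lemma Ch_energy: "f \<in> W12 m \<Longrightarrow> Ch m f = ennreal (energy f / 2)"
  by (simp add: W12_def energy_def less_top)

lemma energy_leI: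
  assumes f: "f \<in> L2 m" and a: "0 \<le> a"
    and "\<And>e. 0 < e \<Longrightarrow> \<exists>u\<in>Lip \<inter> L2 m. slope u \<in> L2 m \<and> sqdist m u f < e \<and> (\<integral>x. (slope u x)\<^sup>2 \<partial>m) \<le> a"
  shows "f \<in> W12 m" "energy f \<le> a"
proof -
  have le: "Ch m f \<le> ennreal (a / 2)"
  proof (rule Ch_leI[OF f])
    fix e :: real assume "0 < e"
    from assms(3)[OF this] obtain u where u: "u \<in> Lip \<inter> L2 m" "slope u \<in> L2 m" "sqdist m u f < e"
      "(\<integral>x. (slope u x)\<^sup>2 \<partial>m) \<le> a" by blast
    then have "(\<integral>\<^sup>+x. (lip u x)\<^sup>2 \<partial>m) / 2 \<le> ennreal (a / 2)"
      by (simp add: nn_integral_lip_L2 ennreal_leI)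
    with u show "\<exists>u\<in>Lip \<inter> L2 m. sqdist m u f < e \<and> (\<integral>\<^sup>+x. (lip u x)\<^sup>2 \<partial>m) / 2 \<le> ennreal (a / 2)" by blast
  qed
  then have "Ch m f < \<infinity>" by (rule order_le_less_trans) simp
  then show W: "f \<in> W12 m" using f by (simp add: W12_def)
  show "energy f \<le> a" using le a unfolding Ch_energy[OF W] by simp
qed

text \<open>
  Lower semicontinuity in the form in which it is used: Lipschitz functions near \<open>f\<close> cannot have
  much less energy than \<open>f\<close>.
\<close>

lemma energy_lower:
  assumes f: "f \<in> W12 m" and a: "a < energy f"
  shows "\<exists>e>0. \<forall>u. u \<in> Lip \<longrightarrow> u \<in> L2 m \<longrightarrow> slope u \<in> L2 m \<longrightarrow> sqdist m u f < e \<longrightarrow> a < (\<integral>x. (slope u x)\<^sup>2 \<partial>m)"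
proof (cases "0 \<le> a")
  case False
  have "a < (\<integral>x. (slope u x)\<^sup>2 \<partial>m)" for u
    by (rule less_le_trans[of _ 0]) (use False in auto)
  then show ?thesis by (intro exI[of _ 1]) auto
next
  case True
  show ?thesis
  proof (rule ccontr)
    assume N: "\<not> ?thesis"
    have "\<exists>u\<in>Lip \<inter> L2 m. slope u \<in> L2 m \<and> sqdist m u f < e \<and> (\<integral>x. (slope u x)\<^sup>2 \<partial>m) \<le> a" if "0 < e" for e
    proof -
      from N that obtain u where "u \<in> Lip" "u \<in> L2 m" "slope u \<in> L2 m" "sqdist m u f < e"
        "\<not> a < (\<integral>x. (slope u x)\<^sup>2 \<partial>m)" by blast
      then show ?thesis by (intro bexI[of _ u]) auto
    qed
    from energy_leI(2)[OF W12_L2[OF f] True this] a show False by simp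
  qed
qed

lemma energy_approx:
  assumes f: "f \<in> W12 m" and a: "energy f < a" and e: "0 < e"
  obtains u where "u \<in> Lip" "u \<in> L2 m" "slope u \<in> L2 m" "sqdist m u f < e" "(\<integral>x. (slope u x)\<^sup>2 \<partial>m) < a"
proof -
  have "0 < a" using a energy_nonneg[of f] by linarith
  then have "Ch m f < ennreal (a / 2)" using a unfolding Ch_energy[OF f] by (simp add: ennreal_less_iff)
  from Ch_approx[OF W12_L2[OF f] this e] obtain u where u: "u \<in> Lip" "u \<in> L2 m" "sqdist m u f < e"
    "(\<integral>\<^sup>+x. (lip u x)\<^sup>2 \<partial>m) / 2 < ennreal (a / 2)" by blast
  then have s: "slope u \<in> L2 m" by (intro slope_in_L2) (auto intro: less_trans)
  from u(4) have "(\<integral>x. (slope u x)\<^sup>2 \<partial>m) < a"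
    unfolding nn_integral_lip_L2[OF u(1) s] by (simp add: ennreal_less_iff)
  with u s show ?thesis by (intro that)
qed

text \<open>
  Truncation does not increase the slope. Bounded approximants are needed because products of
  unbounded Lipschitz functions need not be Lipschitz.
\<close>

lemma truncate_Lip:
  assumes u: "u \<in> Lip" "u \<in> L2 m" and e: "0 < e"
  obtains v where "v \<in> Lip_b" "v \<in> L2 m" "sqdist m v u < e" "\<And>x. slope v x \<le> slope u x"
proof -
  define T where "T n x = max (- real n) (min (real n) (u x))" for n x
  have c: "\<bar>max (- real n) (min (real n) s) - max (- real n) (min (real n) t)\<bar> \<le> 1 * \<bar>s - t\<bar>" for s t n
    by (auto simp: max_def min_def)
  have T: "T n \<in> Lip" for n unfolding T_def by (rule Lip_contraction[OF u(1) _ c]) simp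
  have [measurable]: "T n \<in> borel_measurable m" for n using T by measurable
  have [measurable]: "u \<in> borel_measurable m" using u by measurable
  have TL: "T n \<in> L2 m" for n
    by (rule L2_dominated[OF u(2)]) (auto simp: T_def max_def min_def)
  have sl: "slope (T n) x \<le> slope u x" for n x
    using slope_contraction[OF u(1) _ c, of n x] by (simp add: T_def[abs_def])
  have b: "bounded (range (T n))" for n
    by (rule boundedI[of _ "real n"]) (auto simp: T_def)
  have "(\<lambda>n. \<integral>x. (T n x - u x)\<^sup>2 \<partial>m) \<longlonglongrightarrow> (\<integral>x. 0 \<partial>m)"
  proof (rule integral_dominated_convergence[where w = "\<lambda>x. (u x)\<^sup>2"])
    show "AE x in m. (\<lambda>n. (T n x - u x)\<^sup>2) \<longlonglongrightarrow> 0"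
    proof (rule AE_I2, rule tendsto_eventually)
      fix x
      obtain N :: nat where "\<bar>u x\<bar> \<le> real N" using real_arch_simple by blast
      then have "(T n x - u x)\<^sup>2 = 0" if "n \<ge> N" for n
        using that by (auto simp: T_def max_def min_def)
      then show "\<forall>\<^sub>F n in sequentially. (T n x - u x)\<^sup>2 = 0"
        unfolding eventually_sequentially by blast
    qed
    have "\<bar>T n x - u x\<bar> \<le> \<bar>u x\<bar>" for n x by (auto simp: T_def max_def min_def)
    then show "AE x in m. norm ((T n x - u x)\<^sup>2) \<le> (u x)\<^sup>2" for n by (auto simp: abs_le_square_iff)
  qed (use L2D(2)[OF u(2)] in auto)
  then have "(\<lambda>n. sqdist m (T n) u) \<longlonglongrightarrow> 0" by (simp add: sqdist_def)
  then have "\<forall>\<^sub>F n in sequentially. sqdist m (T n) u < e" using e by (rule order_tendstoD)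
  then obtain n where "sqdist m (T n) u < e" by (auto simp: eventually_sequentially)
  then show ?thesis using T[of n] TL[of n] sl[of n] b[of n] by (intro that[of "T n"]) (auto simp: Lip_b_def)
qed

text \<open>
  Strong limits in \<open>L\<^sup>2\<close> of upper bounds of slopes, in place of upper bounds of weak limits.
  Quantifying over \<open>e\<close> instead of sequences makes closedness under limits immediate, and \<open>g\<close> in
  place of the slope itself makes the notion stable under all operations that only estimate
  slopes.
\<close>

definition strong_relaxed :: "('a \<Rightarrow> real) \<Rightarrow> ('a \<Rightarrow> real) \<Rightarrow> bool" where
  "strong_relaxed f G \<longleftrightarrow> G \<in> L2 m \<and>
     (\<forall>e>0. \<exists>u g. u \<in> Lip_b \<and> u \<in> L2 m \<and> g \<in> L2 m \<and> sqdist m u f < e \<and> sqdist m g G < e \<and>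
        (AE x in m. slope u x \<le> g x))"

lemma strong_relaxedE_seq:
  assumes "strong_relaxed f G" "f \<in> L2 m"
  obtains F g where "\<And>n::nat. F n \<in> Lip_b" "\<And>n. F n \<in> L2 m" "\<And>n. g n \<in> L2 m"
    "\<And>n. AE x in m. slope (F n) x \<le> g n x"
    "(\<lambda>n. sqdist m (F n) f) \<longlonglongrightarrow> 0" "(\<lambda>n. sqdist m (g n) G) \<longlonglongrightarrow> 0"
    "AE x in m. (\<lambda>n. F n x) \<longlonglongrightarrow> f x" "AE x in m. (\<lambda>n. g n x) \<longlonglongrightarrow> G x"
proof -
  have G: "G \<in> L2 m" using assms by (simp add: strong_relaxed_def)
  define P where "P e u g \<longleftrightarrow> u \<in> Lip_b \<and> u \<in> L2 m \<and> g \<in> L2 m \<and> sqdist m u f < e \<and>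
      sqdist m g G < e \<and> (AE x in m. slope u x \<le> g x)" for e u g
  have "\<exists>u g. P e u g" if "0 < e" for e
    using assms(1) that unfolding strong_relaxed_def P_def by blast
  then have "\<exists>u g. P (1 / real (Suc n)) u g" for n by simp
  then obtain F g where "\<And>n. P (1 / real (Suc n)) (F n) (g n)" by metis
  then have F: "\<And>n::nat. F n \<in> Lip_b" "\<And>n. F n \<in> L2 m" "\<And>n. g n \<in> L2 m"
    "\<And>n. AE x in m. slope (F n) x \<le> g n x"
    "\<And>n. sqdist m (F n) f < 1 / real (Suc n)" "\<And>n. sqdist m (g n) G < 1 / real (Suc n)"
    unfolding P_def by blast+
  have 1: "(\<lambda>n. sqdist m (F n) f) \<longlonglongrightarrow> 0"
    by (rule sqdist_tendsto_zeroI) (rule F(5))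
  have 2: "(\<lambda>n. sqdist m (g n) G) \<longlonglongrightarrow> 0"
    by (rule sqdist_tendsto_zeroI) (rule F(6))
  from L2_tendsto_AE_subseq[OF F(2) assms(2) 1] obtain r :: "nat \<Rightarrow> nat"
    where r: "strict_mono r" "AE x in m. (\<lambda>n. F (r n) x) \<longlonglongrightarrow> f x" by blast
  have 3: "(\<lambda>n. sqdist m (g (r n)) G) \<longlonglongrightarrow> 0"
    using LIMSEQ_subseq_LIMSEQ[OF 2 r(1)] by (simp add: o_def)
  from L2_tendsto_AE_subseq[OF F(3) G 3] obtain s :: "nat \<Rightarrow> nat"
    where s: "strict_mono s" "AE x in m. (\<lambda>n. g (r (s n)) x) \<longlonglongrightarrow> G x" by blast
  have rs: "strict_mono (r \<circ> s)" by (rule strict_mono_o[OF r(1) s(1)])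
  show ?thesis
  proof (rule that[of "\<lambda>n. F (r (s n))" "\<lambda>n. g (r (s n))"])
    show "(\<lambda>n. sqdist m (F (r (s n))) f) \<longlonglongrightarrow> 0" using LIMSEQ_subseq_LIMSEQ[OF 1 rs] by (simp add: o_def)
    show "(\<lambda>n. sqdist m (g (r (s n))) G) \<longlonglongrightarrow> 0" using LIMSEQ_subseq_LIMSEQ[OF 2 rs] by (simp add: o_def)
    show "AE x in m. (\<lambda>n. F (r (s n)) x) \<longlonglongrightarrow> f x"
      using r(2)
    proof eventually_elim
      case (elim x)
      then show ?case using LIMSEQ_subseq_LIMSEQ[OF elim s(1)] by (simp add: o_def)
    qed
  qed (use F s in auto)
qed

lemma strong_relaxedI_seq:
  assumes "G \<in> L2 m" "\<And>n::nat. F n \<in> Lip_b" "\<And>n. F n \<in> L2 m" "\<And>n. g n \<in> L2 m"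
    "\<And>n. AE x in m. slope (F n) x \<le> g n x"
    "(\<lambda>n. sqdist m (F n) f) \<longlonglongrightarrow> 0" "(\<lambda>n. sqdist m (g n) G) \<longlonglongrightarrow> 0"
  shows "strong_relaxed f G"
  unfolding strong_relaxed_def
proof (intro conjI allI impI assms(1))
  fix e :: real assume "0 < e"
  then have "\<forall>\<^sub>F n in sequentially. sqdist m (F n) f < e \<and> sqdist m (g n) G < e"
    using order_tendstoD(2)[OF assms(6)] order_tendstoD(2)[OF assms(7)] by (auto intro: eventually_conj)
  then obtain n where "sqdist m (F n) f < e" "sqdist m (g n) G < e" by (auto simp: eventually_sequentially)
  then show "\<exists>u g. u \<in> Lip_b \<and> u \<in> L2 m \<and> g \<in> L2 m \<and> sqdist m u f < e \<and> sqdist m g G < e \<and>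
        (AE x in m. slope u x \<le> g x)" using assms by blast
qed

lemma strong_relaxed_nonneg:
  assumes "strong_relaxed f G" "f \<in> L2 m"
  shows "AE x in m. 0 \<le> G x"
proof -
  obtain F g where
    F: "\<And>n::nat. AE x in m. slope (F n) x \<le> g n x" "AE x in m. (\<lambda>n. g n x) \<longlonglongrightarrow> G x"
    by (rule strong_relaxedE_seq[OF assms]) blast
  from F(1) have "AE x in m. \<forall>n. slope (F n) x \<le> g n x" by (simp add: AE_all_countable)
  with F(2) show ?thesis
  proof eventually_elim
    case (elim x)
    then have "0 \<le> g n x" for n using slope_nonneg[of "F n" x] order_trans by blast
    then show ?case using elim(1) by (intro LIMSEQ_le_const[of "\<lambda>n. g n x"]) auto
  qed
qed

lemma strong_relaxed_limit:
  assumes f: "f \<in> L2 m" and G: "G \<in> L2 m"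
    and "\<And>e. 0 < e \<Longrightarrow> \<exists>f' G'. strong_relaxed f' G' \<and> f' \<in> L2 m \<and> sqdist m f' f < e \<and> sqdist m G' G < e"
  shows "strong_relaxed f G"
  unfolding strong_relaxed_def
proof (intro conjI allI impI G)
  fix e :: real assume "0 < e"
  then have e: "0 < e / 4" by simp
  from assms(3)[OF e] obtain f' G' where 1: "strong_relaxed f' G'" "f' \<in> L2 m" "sqdist m f' f < e / 4" "sqdist m G' G < e / 4"
    by blast
  from 1(1) e obtain u g where 2: "u \<in> Lip_b" "u \<in> L2 m" "g \<in> L2 m" "sqdist m u f' < e / 4" "sqdist m g G' < e / 4"
    "AE x in m. slope u x \<le> g x" unfolding strong_relaxed_def by blast
  have G': "G' \<in> L2 m" using 1(1) by (simp add: strong_relaxed_def)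
  have "sqdist m u f < e" "sqdist m g G < e"
    using sqdist_triangle[OF 2(2) 1(2) f] sqdist_triangle[OF 2(3) G' G] 1 2 by auto
  with 2 show "\<exists>u g. u \<in> Lip_b \<and> u \<in> L2 m \<and> g \<in> L2 m \<and> sqdist m u f < e \<and> sqdist m g G < e \<and>
        (AE x in m. slope u x \<le> g x)" by blast
qed

lemma energy_le_strong_relaxed:
  assumes "strong_relaxed f G" "f \<in> L2 m"
  shows "f \<in> W12 m" "energy f \<le> (\<integral>x. (G x)\<^sup>2 \<partial>m)"
proof -
  obtain F g where
    F: "\<And>n::nat. F n \<in> Lip_b" "\<And>n. F n \<in> L2 m" "\<And>n. g n \<in> L2 m"
    "\<And>n. AE x in m. slope (F n) x \<le> g n x"
    "(\<lambda>n. sqdist m (F n) f) \<longlonglongrightarrow> 0" "(\<lambda>n. sqdist m (g n) G) \<longlonglongrightarrow> 0"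
    by (rule strong_relaxedE_seq[OF assms]) blast
  have G: "G \<in> L2 m" using assms by (simp add: strong_relaxed_def)
  have sL: "slope (F n) \<in> L2 m" for n
  proof (rule L2_dominated[OF F(3)])
    show "slope (F n) \<in> borel_measurable m" using Lip_b_Lip[OF F(1)] by measurable
    show "AE x in m. \<bar>slope (F n) x\<bar> \<le> \<bar>g n x\<bar>" using F(4)[of n] by eventually_elim simp
  qed
  have sle: "(\<integral>x. (slope (F n) x)\<^sup>2 \<partial>m) \<le> (\<integral>x. (g n x)\<^sup>2 \<partial>m)" for n
    by (rule integral_mono_AE) (use F(4)[of n] L2D(2)[OF sL] L2D(2)[OF F(3)] in \<open>auto elim!: eventually_mono intro: power_mono\<close>)
  have gt: "(\<lambda>n. \<integral>x. (g n x)\<^sup>2 \<partial>m) \<longlonglongrightarrow> (\<integral>x. (G x)\<^sup>2 \<partial>m)"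
    by (rule tendsto_square_L2[OF F(3) G F(6)])
  have *: "f \<in> W12 m \<and> energy f \<le> (\<integral>x. (G x)\<^sup>2 \<partial>m) + d" if "0 < d" for d
  proof -
    have "\<exists>u\<in>Lip \<inter> L2 m. slope u \<in> L2 m \<and> sqdist m u f < e \<and> (\<integral>x. (slope u x)\<^sup>2 \<partial>m) \<le> (\<integral>x. (G x)\<^sup>2 \<partial>m) + d"
      if "0 < e" for e
    proof -
      have "\<forall>\<^sub>F n in sequentially. sqdist m (F n) f < e \<and> (\<integral>x. (g n x)\<^sup>2 \<partial>m) < (\<integral>x. (G x)\<^sup>2 \<partial>m) + d"
        using order_tendstoD(2)[OF F(5) that] order_tendstoD(2)[OF gt, of "(\<integral>x. (G x)\<^sup>2 \<partial>m) + d"] \<open>0 < d\<close>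
        by (auto intro: eventually_conj)
      then obtain n where "sqdist m (F n) f < e" "(\<integral>x. (g n x)\<^sup>2 \<partial>m) < (\<integral>x. (G x)\<^sup>2 \<partial>m) + d"
        by (auto simp: eventually_sequentially)
      then show ?thesis
        using sL[of n] sle[of n] F(2)[of n] Lip_b_Lip[OF F(1)[of n]] by (intro bexI[of _ "F n"]) auto
    qed
    then show ?thesis using energy_leI[OF assms(2), of "(\<integral>x. (G x)\<^sup>2 \<partial>m) + d"] \<open>0 < d\<close> by simp
  qed
  show "f \<in> W12 m" using *[of 1] by simp
  show "energy f \<le> (\<integral>x. (G x)\<^sup>2 \<partial>m)" by (rule field_le_epsilon) (use * in blast)
qed

end

section \<open>The minimal relaxed gradient\<close>

context mm_space
begin

text \<open>
  Admitting upper bounds, and not only the slopes themselves, makes this set convex.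
\<close>

definition near_slopes :: "('a \<Rightarrow> real) \<Rightarrow> real \<Rightarrow> ('a \<Rightarrow> real) set" where
  "near_slopes f d = {c \<in> L2 m. \<exists>u. u \<in> Lip \<and> u \<in> L2 m \<and> sqdist m u f < d \<and> (AE x in m. slope u x \<le> c x)}"

lemma near_slopes_mono: "d \<le> d' \<Longrightarrow> near_slopes f d \<subseteq> near_slopes f d'"
  unfolding near_slopes_def by fastforce

lemma slope_near_slopes:
  "u \<in> Lip \<Longrightarrow> u \<in> L2 m \<Longrightarrow> slope u \<in> L2 m \<Longrightarrow> sqdist m u f < d \<Longrightarrow> slope u \<in> near_slopes f d"
  unfolding near_slopes_def by auto

lemma near_slopes_convex:
  assumes f: "f \<in> L2 m" and k: "k \<in> near_slopes f d" and l: "l \<in> near_slopes f d" and t: "0 \<le> t" "t \<le> 1"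
  shows "(\<lambda>x. (1 - t) * k x + t * l x) \<in> near_slopes f d"
proof -
  obtain u where u: "u \<in> Lip" "u \<in> L2 m" "sqdist m u f < d" "AE x in m. slope u x \<le> k x"
    using k by (auto simp: near_slopes_def)
  obtain v where v: "v \<in> Lip" "v \<in> L2 m" "sqdist m v f < d" "AE x in m. slope v x \<le> l x"
    using l by (auto simp: near_slopes_def)
  have kl: "k \<in> L2 m" "l \<in> L2 m" using k l by (auto simp: near_slopes_def)
  define w where "w x = (1 - t) * u x + t * v x" for x
  have w: "w \<in> Lip" "w \<in> L2 m"
    unfolding w_def[abs_def] using u v by (auto intro: Lip_lincomb L2_add L2_cmult)
  have "((1 - t) * a + t * b - c)\<^sup>2 \<le> (1 - t) * (a - c)\<^sup>2 + t * (b - c)\<^sup>2" for a b c :: real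
  proof -
    have "(1 - t) * (a - c)\<^sup>2 + t * (b - c)\<^sup>2 - ((1 - t) * a + t * b - c)\<^sup>2 = t * (1 - t) * (a - b)\<^sup>2"
      by algebra
    moreover have "0 \<le> t * (1 - t) * (a - b)\<^sup>2" using t by simp
    ultimately show ?thesis by linarith
  qed
  then have "sqdist m w f \<le> (\<integral>x. (1 - t) * (u x - f x)\<^sup>2 + t * (v x - f x)\<^sup>2 \<partial>m)"
    unfolding sqdist_def w_def
    by (intro integral_mono) (use L2D(2)[OF L2_diff[OF w(2) f]] L2D(2)[OF L2_diff[OF u(2) f]]
      L2D(2)[OF L2_diff[OF v(2) f]] in \<open>auto simp: w_def\<close>)
  also have "\<dots> = (1 - t) * sqdist m u f + t * sqdist m v f"
    unfolding sqdist_def using L2D(2)[OF L2_diff[OF u(2) f]] L2D(2)[OF L2_diff[OF v(2) f]] by simp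
  also have "\<dots> < d" by (rule convex_bound_lt[OF u(3) v(3)]) (use t in auto)
  finally have "sqdist m w f < d" .
  moreover have "AE x in m. slope w x \<le> (1 - t) * k x + t * l x"
    using u(4) v(4)
  proof eventually_elim
    case (elim x)
    have "slope w x \<le> (1 - t) * slope u x + t * slope v x"
      using slope_lincomb[OF u(1) v(1), of "1 - t" t x] t by (simp add: w_def[abs_def])
    also have "\<dots> \<le> (1 - t) * k x + t * l x"
      using elim t by (intro add_mono mult_left_mono) auto
    finally show ?case .
  qed
  ultimately show ?thesis
    unfolding near_slopes_def using w kl by (auto intro!: L2_add L2_cmult)
qed

text \<open>
  Projecting \<open>0\<close> onto the sets of upper bounds at distance \<open>1 / (n + 1)\<close>: the squared norms of the
  projections tend to the energy, by the definition of the energy as a relaxation.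
\<close>

lemma near_slopes_projections:
  assumes f: "f \<in> W12 m"
  obtains c :: "nat \<Rightarrow> 'a \<Rightarrow> real" where
    "\<And>n. c n \<in> L2 m" "\<And>n. AE x in m. 0 \<le> c n x"
    "\<And>n. (\<integral>x. (c n x)\<^sup>2 \<partial>m) \<le> energy f"
    "(\<lambda>n. \<integral>x. (c n x)\<^sup>2 \<partial>m) \<longlonglongrightarrow> energy f"
    "\<And>n k. k \<in> near_slopes f (1 / real (Suc n)) \<Longrightarrow> (\<integral>x. (c n x)\<^sup>2 \<partial>m) \<le> (\<integral>x. c n x * k x \<partial>m)"
    "\<And>n e. 0 < e \<Longrightarrow> \<exists>k \<in> near_slopes f (1 / real (Suc n)). sqdist m k (c n) < e"
proof -
  define K where "K n = near_slopes f (1 / real (Suc n))" for n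
  have fL: "f \<in> L2 m" by (rule W12_L2[OF f])
  have KL: "K n \<subseteq> L2 m" for n by (auto simp: K_def near_slopes_def)
  have KA: "\<exists>k\<in>K n. (\<integral>x. (k x)\<^sup>2 \<partial>m) < a" if a: "energy f < a" for a n
  proof -
    obtain u where "u \<in> Lip" "u \<in> L2 m" "slope u \<in> L2 m" "sqdist m u f < 1 / real (Suc n)"
      "(\<integral>x. (slope u x)\<^sup>2 \<partial>m) < a"
      using energy_approx[OF f a, of "1 / real (Suc n)"] by auto
    then show ?thesis unfolding K_def by (intro bexI[of _ "slope u"] slope_near_slopes) auto
  qed
  define P where "P n c F \<longleftrightarrow> c \<in> L2 m \<and> (\<forall>j::nat. F j \<in> K n) \<and> (\<lambda>j. sqdist m (F j) c) \<longlonglongrightarrow> 0 \<and>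
      (\<forall>k\<in>K n. (\<integral>x. (c x)\<^sup>2 \<partial>m) \<le> (\<integral>x. c x * k x \<partial>m))" for n c F
  have "\<exists>c F. P n c F" for n
  proof -
    have "K n \<noteq> {}" using KA[of "energy f + 1"] by auto
    moreover have "(\<lambda>x. (1 - t) * u x + t * v x) \<in> K n" if "u \<in> K n" "v \<in> K n" "0 \<le> t" "t \<le> 1" for u v t
      using near_slopes_convex[OF fL] that unfolding K_def by blast
    ultimately obtain c F where "c \<in> L2 m" "\<And>j::nat. F j \<in> K n" "(\<lambda>j. sqdist m (F j) c) \<longlonglongrightarrow> 0"
      "\<And>k. k \<in> K n \<Longrightarrow> (\<integral>x. (c x)\<^sup>2 \<partial>m) \<le> (\<integral>x. c x * k x \<partial>m)"
      using L2_projection[OF KL[of n]] by blast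
    then show ?thesis unfolding P_def by blast
  qed
  then obtain c F where "\<And>n. P n (c n) (F n)" by metis
  then have cL: "c n \<in> L2 m" and FK: "F n j \<in> K n" and Fc: "(\<lambda>j. sqdist m (F n j) (c n)) \<longlonglongrightarrow> 0"
    and ck: "k \<in> K n \<Longrightarrow> (\<integral>x. (c n x)\<^sup>2 \<partial>m) \<le> (\<integral>x. c n x * k x \<partial>m)" for n j k
    unfolding P_def by blast+
  have FL: "F n j \<in> L2 m" for n j using FK KL by blast
  have cmin: "(\<integral>x. (c n x)\<^sup>2 \<partial>m) \<le> (\<integral>x. (k x)\<^sup>2 \<partial>m)" if "k \<in> K n" for n k
  proof -
    have kL: "k \<in> L2 m" using that KL by blast
    show ?thesis using ck[OF that] sqdist_expand[OF cL kL, of n] sqdist_nonneg[of m "c n" k] by linarith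
  qed
  have cle: "(\<integral>x. (c n x)\<^sup>2 \<partial>m) \<le> energy f" for n
  proof (rule dense_ge)
    fix a assume "energy f < a"
    from KA[OF this, of n] cmin show "(\<integral>x. (c n x)\<^sup>2 \<partial>m) \<le> a" by fastforce
  qed
  have clim: "(\<lambda>n. \<integral>x. (c n x)\<^sup>2 \<partial>m) \<longlonglongrightarrow> energy f"
  proof (rule order_tendstoI)
    fix a assume "energy f < a"
    then show "\<forall>\<^sub>F n in sequentially. (\<integral>x. (c n x)\<^sup>2 \<partial>m) < a"
      using cle by (intro always_eventually) (meson le_less_trans)
  next
    fix a assume "a < energy f"
    then obtain b where b: "a < b" "b < energy f" using dense by blast
    from energy_lower[OF f b(2)] obtain e where e: "0 < e"
      "\<And>u. u \<in> Lip \<Longrightarrow> u \<in> L2 m \<Longrightarrow> slope u \<in> L2 m \<Longrightarrow> sqdist m u f < e \<Longrightarrow> b < (\<integral>x. (slope u x)\<^sup>2 \<partial>m)"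
      by blast
    obtain N where N: "1 / real (Suc N) < e" using e(1) nat_approx_posE by blast
    have "a < (\<integral>x. (c n x)\<^sup>2 \<partial>m)" if "n \<ge> N" for n
    proof -
      have small: "1 / real (Suc n) \<le> 1 / real (Suc N)" using that by (simp add: field_simps)
      have "b \<le> (\<integral>x. (F n j x)\<^sup>2 \<partial>m)" for j
      proof -
        obtain u where u: "u \<in> Lip" "u \<in> L2 m" "sqdist m u f < 1 / real (Suc n)" "AE x in m. slope u x \<le> F n j x"
          using FK[of n j] by (auto simp: K_def near_slopes_def)
        have s: "slope u \<in> L2 m"
        proof (rule L2_dominated[OF FL])
          show "slope u \<in> borel_measurable m" using u by measurable
          show "AE x in m. \<bar>slope u x\<bar> \<le> \<bar>F n j x\<bar>" using u(4) by eventually_elim simp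
        qed
        have "b < (\<integral>x. (slope u x)\<^sup>2 \<partial>m)"
          by (rule e(2)[OF u(1,2) s]) (use u(3) N small in linarith)
        also have "\<dots> \<le> (\<integral>x. (F n j x)\<^sup>2 \<partial>m)"
          by (rule integral_mono_AE)
            (use u(4) L2D(2)[OF s] L2D(2)[OF FL] in \<open>auto elim!: eventually_mono intro: power_mono\<close>)
        finally show ?thesis by simp
      qed
      then have "b \<le> (\<integral>x. (c n x)\<^sup>2 \<partial>m)"
        using tendsto_square_L2[OF FL cL Fc, of n] by (intro LIMSEQ_le_const) auto
      with b show ?thesis by simp
    qed
    then show "\<forall>\<^sub>F n in sequentially. a < (\<integral>x. (c n x)\<^sup>2 \<partial>m)"
      unfolding eventually_sequentially by blast
  qed
  have cpos: "AE x in m. 0 \<le> c n x" for n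
  proof -
    obtain r :: "nat \<Rightarrow> nat" where r: "strict_mono r" "AE x in m. (\<lambda>j. F n (r j) x) \<longlonglongrightarrow> c n x"
      by (rule L2_tendsto_AE_subseq[OF FL cL Fc]) blast
    have "AE x in m. 0 \<le> F n j x" for j
    proof -
      obtain u where "AE x in m. slope u x \<le> F n j x"
        using FK[of n j] by (auto simp: K_def near_slopes_def)
      then show ?thesis
      proof eventually_elim
        case (elim x)
        with slope_nonneg[of u x] show ?case by linarith
      qed
    qed
    then have "AE x in m. \<forall>j. 0 \<le> F n j x" by (simp add: AE_all_countable)
    with r(2) show ?thesis
    proof eventually_elim
      case (elim x)
      then show ?case by (intro LIMSEQ_le_const[of "\<lambda>j. F n (r j) x"]) auto
    qed
  qed
  have capp: "\<exists>k\<in>K n. sqdist m k (c n) < e" if "0 < e" for n e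
  proof -
    have "\<forall>\<^sub>F j in sequentially. sqdist m (F n j) (c n) < e" by (rule order_tendstoD(2)[OF Fc that])
    then obtain j where "sqdist m (F n j) (c n) < e" by (auto simp: eventually_sequentially)
    with FK show ?thesis by blast
  qed
  show ?thesis
    by (rule that[of c]) (use cL cpos cle clim ck capp in \<open>simp_all add: K_def\<close>)
qed

text \<open>
  Call \<open>H\<close> dominating if it satisfies the variational inequality of every projection \<open>c n\<close>. Then
  \<open>\<parallel>H - c n\<parallel>\<^sup>2 \<le> \<parallel>H\<parallel>\<^sup>2 - \<parallel>c n\<parallel>\<^sup>2\<close>, so that a dominating function has squared norm at least the
  energy, and in the case of equality it is the strong limit of the projections. Every relaxed
  gradient dominates, since the variational inequalities are linear and hence stable under weak
  convergence. Conversely, the projections form a Cauchy sequence whose limit is a relaxed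
  gradient: slopes of nearly optimal functions approach the projections in norm. Thus the minimal
  relaxed gradient exists, is unique, and is a strong limit of upper bounds of slopes.
\<close>

theorem grad_norm_W12:
  assumes f: "f \<in> W12 m"
  shows "strong_relaxed f (grad_norm m f)" "(\<integral>x. (grad_norm m f x)\<^sup>2 \<partial>m) = energy f"
proof -
  have fL: "f \<in> L2 m" by (rule W12_L2[OF f])
  obtain c :: "nat \<Rightarrow> 'a \<Rightarrow> real" where
    cL: "\<And>n. c n \<in> L2 m" and cpos: "\<And>n. AE x in m. 0 \<le> c n x"
    and cle: "\<And>n. (\<integral>x. (c n x)\<^sup>2 \<partial>m) \<le> energy f"
    and clim: "(\<lambda>n. \<integral>x. (c n x)\<^sup>2 \<partial>m) \<longlonglongrightarrow> energy f"
    and ck: "\<And>n k. k \<in> near_slopes f (1 / real (Suc n)) \<Longrightarrow> (\<integral>x. (c n x)\<^sup>2 \<partial>m) \<le> (\<integral>x. c n x * k x \<partial>m)"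
    and capp: "\<And>n e. 0 < e \<Longrightarrow> \<exists>k \<in> near_slopes f (1 / real (Suc n)). sqdist m k (c n) < e"
    by (rule near_slopes_projections[OF f]) blast
  define dom where "dom H \<longleftrightarrow> (\<forall>n. (\<integral>x. (c n x)\<^sup>2 \<partial>m) \<le> (\<integral>x. c n x * H x \<partial>m))" for H
  have dist_dom: "sqdist m (c n) H \<le> (\<integral>x. (H x)\<^sup>2 \<partial>m) - (\<integral>x. (c n x)\<^sup>2 \<partial>m)"
    if "H \<in> L2 m" "(\<integral>x. (c n x)\<^sup>2 \<partial>m) \<le> (\<integral>x. c n x * H x \<partial>m)" for H n
    using sqdist_expand[OF cL[of n] that(1)] that(2) by linarith
  have energy_dom: "energy f \<le> (\<integral>x. (H x)\<^sup>2 \<partial>m)" if H: "H \<in> L2 m" "dom H" for H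
  proof -
    have "(\<integral>x. (c n x)\<^sup>2 \<partial>m) \<le> (\<integral>x. (H x)\<^sup>2 \<partial>m)" for n
    proof -
      have "0 \<le> (\<integral>x. (H x)\<^sup>2 \<partial>m) - (\<integral>x. (c n x)\<^sup>2 \<partial>m)"
        by (rule order_trans[OF sqdist_nonneg[of m "c n" H] dist_dom]) (use H in \<open>auto simp: dom_def\<close>)
      then show ?thesis by simp
    qed
    then show ?thesis using clim by (intro LIMSEQ_le_const2) auto
  qed
  have conv_dom: "(\<lambda>n. sqdist m (c n) H) \<longlonglongrightarrow> 0"
    if H: "H \<in> L2 m" "dom H" "(\<integral>x. (H x)\<^sup>2 \<partial>m) = energy f" for H
  proof (rule tendsto_sandwich[OF _ _ tendsto_const])
    have "(\<lambda>n. energy f - (\<integral>x. (c n x)\<^sup>2 \<partial>m)) \<longlonglongrightarrow> energy f - energy f"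
      by (intro tendsto_intros clim)
    then show "(\<lambda>n. energy f - (\<integral>x. (c n x)\<^sup>2 \<partial>m)) \<longlonglongrightarrow> 0" by simp
    show "\<forall>\<^sub>F n in sequentially. sqdist m (c n) H \<le> energy f - (\<integral>x. (c n x)\<^sup>2 \<partial>m)"
      using dist_dom[OF H(1)] H(2,3) by (simp add: dom_def)
  qed (simp add: sqdist_nonneg)
  have strong: "strong_relaxed f H" if H: "H \<in> L2 m" "(\<lambda>n. sqdist m (c n) H) \<longlonglongrightarrow> 0" for H
    unfolding strong_relaxed_def
  proof (intro conjI allI impI H(1))
    fix e :: real assume "0 < e"
    then have e4: "0 < e / 4" by simp
    have "\<forall>\<^sub>F n in sequentially. sqdist m (c n) H < e / 4 \<and> 1 / real (Suc n) < e / 4"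
    proof (rule eventually_conj)
      show "\<forall>\<^sub>F n in sequentially. sqdist m (c n) H < e / 4" by (rule order_tendstoD(2)[OF H(2) e4])
      show "\<forall>\<^sub>F n in sequentially. 1 / real (Suc n) < e / 4"
        using order_tendstoD(2)[OF LIMSEQ_inverse_real_of_nat e4] by (simp add: inverse_eq_divide)
    qed
    then obtain n where n: "sqdist m (c n) H < e / 4" "1 / real (Suc n) < e / 4"
      by (auto simp: eventually_sequentially)
    from capp[OF e4, of n] obtain k where k: "k \<in> near_slopes f (1 / real (Suc n))" "sqdist m k (c n) < e / 4" by blast
    then obtain u where u: "u \<in> Lip" "u \<in> L2 m" "sqdist m u f < 1 / real (Suc n)" "AE x in m. slope u x \<le> k x"
      by (auto simp: near_slopes_def)
    have kL: "k \<in> L2 m" using k by (simp add: near_slopes_def)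
    obtain v where v: "v \<in> Lip_b" "v \<in> L2 m" "sqdist m v u < e / 4" "\<And>x. slope v x \<le> slope u x"
      by (rule truncate_Lip[OF u(1,2) e4]) blast
    have "sqdist m v f < e" using sqdist_triangle[OF v(2) u(2) fL] v(3) u(3) n(2) by linarith
    moreover have "sqdist m k H < e" using sqdist_triangle[OF kL cL[of n] H(1)] k(2) n(1) by linarith
    moreover have "AE x in m. slope v x \<le> k x"
      using u(4)
    proof eventually_elim
      case (elim x)
      with v(4)[of x] show ?case by linarith
    qed
    ultimately show "\<exists>u g. u \<in> Lip_b \<and> u \<in> L2 m \<and> g \<in> L2 m \<and> sqdist m u f < e \<and> sqdist m g H < e \<and>
        (AE x in m. slope u x \<le> g x)" using v kL by blast
  qed

  \<comment> \<open>Slopes of an approximating sequence eventually satisfy the \<open>n\<close>-th variational inequality; it passes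
      to the weak limit, and then to a larger function because \<open>c n\<close> is nonnegative.\<close>
  have dom_relaxed: "dom G" if rg: "relaxed_gradient m f G" for G
  proof -
    from rg obtain F H where F: "range F \<subseteq> Lip \<inter> L2 m" "L2_tendsto m F f" "\<And>n. slope (F n) \<in> L2 m"
      and H: "H \<in> L2 m" "L2_weak_tendsto m (\<lambda>n x. slope (F n) x) H" "AE x in m. H x \<le> G x" and G: "G \<in> L2 m"
      unfolding relaxed_gradient_def slope_def[abs_def] by blast
    have Ft: "(\<lambda>k. sqdist m (F k) f) \<longlonglongrightarrow> 0"
      using F(1,2) fL L2_tendsto_iff[of F m f] by auto
    show ?thesis unfolding dom_def
    proof
      fix n
      have "\<forall>\<^sub>F k in sequentially. sqdist m (F k) f < 1 / real (Suc n)"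
        by (rule order_tendstoD(2)[OF Ft]) simp
      then have ev: "\<forall>\<^sub>F k in sequentially. (\<integral>x. (c n x)\<^sup>2 \<partial>m) \<le> (\<integral>x. slope (F k) x * c n x \<partial>m)"
      proof eventually_elim
        case (elim k)
        have "slope (F k) \<in> near_slopes f (1 / real (Suc n))"
          using F(1,3) elim by (intro slope_near_slopes) auto
        from ck[OF this] show ?case by (simp add: mult.commute)
      qed
      have "(\<lambda>k. \<integral>x. slope (F k) x * c n x \<partial>m) \<longlonglongrightarrow> (\<integral>x. H x * c n x \<partial>m)"
        using H(2) cL[of n] unfolding L2_weak_tendsto_def by blast
      then have "(\<integral>x. (c n x)\<^sup>2 \<partial>m) \<le> (\<integral>x. H x * c n x \<partial>m)"
        using ev by (intro tendsto_lowerbound) auto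
      also have "\<dots> \<le> (\<integral>x. c n x * G x \<partial>m)"
      proof (rule integral_mono_AE)
        show "AE x in m. H x * c n x \<le> c n x * G x"
          using H(3) cpos[of n] by eventually_elim (simp add: mult.commute[of "c n _"] mult_right_mono)
      qed (use L2_mult_integrable H(1) G cL in auto)
      finally show "(\<integral>x. (c n x)\<^sup>2 \<partial>m) \<le> (\<integral>x. c n x * G x \<partial>m)" .
    qed
  qed

  obtain G where G: "G \<in> L2 m" "(\<lambda>n. sqdist m (c n) G) \<longlonglongrightarrow> 0"
  proof (rule L2_complete[OF cL])
    have "(\<lambda>n. energy f - (\<integral>x. (c n x)\<^sup>2 \<partial>m)) \<longlonglongrightarrow> energy f - energy f"
      by (intro tendsto_intros clim)
    then show "(\<lambda>n. energy f - (\<integral>x. (c n x)\<^sup>2 \<partial>m)) \<longlonglongrightarrow> 0" by simp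
    fix i j :: nat assume "i \<le> j"
    have "(\<integral>x. (c i x)\<^sup>2 \<partial>m) \<le> (\<integral>x. c i x * c j x \<partial>m)"
    proof -
      have "\<exists>k\<in>near_slopes f (1 / real (Suc j)). sqdist m k (c j) < 1 / real (Suc l)" for l
        by (rule capp) simp
      then obtain k where k: "\<And>l. k l \<in> near_slopes f (1 / real (Suc j))" "\<And>l. sqdist m (k l) (c j) < 1 / real (Suc l)"
        by metis
      have sub: "near_slopes f (1 / real (Suc j)) \<subseteq> near_slopes f (1 / real (Suc i))"
        by (rule near_slopes_mono) (use \<open>i \<le> j\<close> in \<open>simp add: field_simps\<close>)
      have kL: "k l \<in> L2 m" for l using k(1)[of l] by (simp add: near_slopes_def)
      have "(\<lambda>l. \<integral>x. k l x * c i x \<partial>m) \<longlonglongrightarrow> (\<integral>x. c j x * c i x \<partial>m)"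
        by (rule tendsto_inner_L2[OF kL cL cL sqdist_tendsto_zeroI[OF k(2)]])
      moreover have "(\<integral>x. (c i x)\<^sup>2 \<partial>m) \<le> (\<integral>x. k l x * c i x \<partial>m)" for l
        using ck[of "k l" i] k(1) sub by (auto simp: mult.commute)
      ultimately show ?thesis by (intro LIMSEQ_le_const) (auto simp: mult.commute)
    qed
    then have "sqdist m (c i) (c j) \<le> (\<integral>x. (c j x)\<^sup>2 \<partial>m) - (\<integral>x. (c i x)\<^sup>2 \<partial>m)"
      by (rule dist_dom[OF cL])
    with cle[of j] show "sqdist m (c i) (c j) \<le> energy f - (\<integral>x. (c i x)\<^sup>2 \<partial>m)" by linarith
  qed
  have IG: "(\<integral>x. (G x)\<^sup>2 \<partial>m) = energy f"
    by (rule LIMSEQ_unique[OF tendsto_square_L2[OF cL G] clim])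

  \<comment> \<open>Nearly optimal Lipschitz functions: their slopes lie in the convex sets and have almost minimal norm,
      hence they converge strongly to \<open>G\<close>.\<close>
  have "relaxed_gradient m f G"
  proof -
    have "\<exists>u. u \<in> Lip \<and> u \<in> L2 m \<and> slope u \<in> L2 m \<and> sqdist m u f < 1 / real (Suc n) \<and>
        (\<integral>x. (slope u x)\<^sup>2 \<partial>m) < energy f + 1 / real (Suc n)" for n
      using energy_approx[OF f, of "energy f + 1 / real (Suc n)" "1 / real (Suc n)"] by auto
    then obtain F where F: "\<And>n. F n \<in> Lip \<and> F n \<in> L2 m \<and> slope (F n) \<in> L2 m \<and> sqdist m (F n) f < 1 / real (Suc n) \<and>
        (\<integral>x. (slope (F n) x)\<^sup>2 \<partial>m) < energy f + 1 / real (Suc n)" by metis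
    have sL: "slope (F n) \<in> L2 m" for n using F by blast
    have FL: "F n \<in> L2 m" for n using F by blast
    have "sqdist m (slope (F n)) G \<le> 2 * (energy f + 1 / real (Suc n) - (\<integral>x. (c n x)\<^sup>2 \<partial>m)) + 2 * sqdist m (c n) G" for n
    proof -
      have "slope (F n) \<in> near_slopes f (1 / real (Suc n))" using F[of n] by (intro slope_near_slopes) auto
      from dist_dom[OF sL ck[OF this]]
      have "sqdist m (c n) (slope (F n)) \<le> energy f + 1 / real (Suc n) - (\<integral>x. (c n x)\<^sup>2 \<partial>m)" using F[of n] by linarith
      then have "sqdist m (slope (F n)) (c n) \<le> energy f + 1 / real (Suc n) - (\<integral>x. (c n x)\<^sup>2 \<partial>m)"
        by (subst sqdist_commute)
      then have "2 * sqdist m (slope (F n)) (c n) + 2 * sqdist m (c n) G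
          \<le> 2 * (energy f + 1 / real (Suc n) - (\<integral>x. (c n x)\<^sup>2 \<partial>m)) + 2 * sqdist m (c n) G"
        by (intro add_right_mono mult_left_mono) auto
      with sqdist_triangle[OF sL[of n] cL[of n] G(1)] show ?thesis by (rule order_trans)
    qed
    moreover have "(\<lambda>n. 2 * (energy f + 1 / real (Suc n) - (\<integral>x. (c n x)\<^sup>2 \<partial>m)) + 2 * sqdist m (c n) G)
        \<longlonglongrightarrow> 2 * (energy f + 0 - energy f) + 2 * 0"
      using LIMSEQ_inverse_real_of_nat by (intro tendsto_intros clim G) (simp add: inverse_eq_divide)
    ultimately have st: "(\<lambda>n. sqdist m (slope (F n)) G) \<longlonglongrightarrow> 0"
      by (intro sqdist_tendsto_zero_le) simp_all
    have w: "L2_weak_tendsto m (\<lambda>n x. slope (F n) x) G"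
      unfolding L2_weak_tendsto_def using tendsto_inner_L2[OF sL G(1) _ st] by blast
    have t: "L2_tendsto m F f"
      unfolding L2_tendsto_iff[of F m f, OF FL fL] by (rule sqdist_tendsto_zeroI) (use F in blast)
    have r: "range F \<subseteq> Lip \<inter> L2 m" using F by blast
    show ?thesis
      unfolding relaxed_gradient_def slope_def[symmetric]
      using G(1) r t sL w by (intro conjI exI[of _ F] exI[of _ G]) auto
  qed
  moreover have "(\<integral>x. (G x)\<^sup>2 \<partial>m) \<le> (\<integral>x. (G' x)\<^sup>2 \<partial>m)" if "relaxed_gradient m f G'" for G'
    using energy_dom[of G'] dom_relaxed[OF that] that IG by (simp add: relaxed_gradient_def)
  ultimately have min: "minimal_relaxed_gradient m f G" by (simp add: minimal_relaxed_gradient_def)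
  then have gm: "minimal_relaxed_gradient m f (grad_norm m f)"
    unfolding grad_norm_def by (rule someI[of "minimal_relaxed_gradient m f"])
  then have rg: "relaxed_gradient m f (grad_norm m f)" by (simp add: minimal_relaxed_gradient_def)
  then have L: "grad_norm m f \<in> L2 m" by (simp add: relaxed_gradient_def)
  have "(\<integral>x. (grad_norm m f x)\<^sup>2 \<partial>m) \<le> energy f"
    using gm min IG by (auto simp: minimal_relaxed_gradient_def)
  then show I: "(\<integral>x. (grad_norm m f x)\<^sup>2 \<partial>m) = energy f"
    using energy_dom[OF L dom_relaxed[OF rg]] by simp
  show "strong_relaxed f (grad_norm m f)"
    by (rule strong[OF L conv_dom[OF L dom_relaxed[OF rg] I]])
qed

end

section \<open>Gluing relaxed gradients\<close>

context mm_space
begin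

lemma strong_relaxed_L2: "strong_relaxed f G \<Longrightarrow> G \<in> L2 m"
  by (simp add: strong_relaxed_def)

text \<open>
  Interpolating between two approximating sequences with a Lipschitz weight costs an error
  \<open>L \<bar>F n - E n\<bar>\<close> in the slope, and this tends to \<open>0\<close> in \<open>L\<^sup>2\<close> since both sequences converge to
  \<open>f\<close>.
\<close>

lemma strong_relaxed_interpolation:
  assumes f: "f \<in> L2 m" and G: "strong_relaxed f G" and H: "strong_relaxed f H"
    and p: "\<And>x. 0 \<le> p x" "\<And>x. p x \<le> 1" "0 \<le> L" "\<And>x y. \<bar>p x - p y\<bar> \<le> L * dist x y"
  shows "strong_relaxed f (\<lambda>x. p x * G x + (1 - p x) * H x)"
proof -
  obtain F g where F: "\<And>n::nat. F n \<in> Lip_b" "\<And>n. F n \<in> L2 m" "\<And>n. g n \<in> L2 m"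
    "\<And>n. AE x in m. slope (F n) x \<le> g n x"
    "(\<lambda>n. sqdist m (F n) f) \<longlonglongrightarrow> 0" "(\<lambda>n. sqdist m (g n) G) \<longlonglongrightarrow> 0"
    by (rule strong_relaxedE_seq[OF G f]) blast
  obtain E h where E: "\<And>n::nat. E n \<in> Lip_b" "\<And>n. E n \<in> L2 m" "\<And>n. h n \<in> L2 m"
    "\<And>n. AE x in m. slope (E n) x \<le> h n x"
    "(\<lambda>n. sqdist m (E n) f) \<longlonglongrightarrow> 0" "(\<lambda>n. sqdist m (h n) H) \<longlonglongrightarrow> 0"
    by (rule strong_relaxedE_seq[OF H f]) blast
  note GL = strong_relaxed_L2[OF G] and HL = strong_relaxed_L2[OF H]
  have pL: "p \<in> Lip" by (rule LipI[OF p(3,4)])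
  have pb: "p \<in> Lip_b" using pL p by (auto simp: Lip_b_def intro!: boundedI[of _ 1])
  have [measurable]: "p \<in> borel_measurable m" using pL by measurable
  have mix: "(\<lambda>x. p x * u x + (1 - p x) * v x) \<in> L2 m" if "u \<in> L2 m" "v \<in> L2 m" for u v
  proof (rule L2_add)
    show "(\<lambda>x. p x * u x) \<in> L2 m"
      by (rule L2_mult_bounded[OF that(1), of p 1]) (use p in auto)
    show "(\<lambda>x. (1 - p x) * v x) \<in> L2 m"
      by (rule L2_mult_bounded[OF that(2), of "\<lambda>x. 1 - p x" 1]) (use p in auto)
  qed
  define W where "W n x = p x * F n x + (1 - p x) * E n x" for n x
  define k where "k n x = (p x * g n x + (1 - p x) * h n x) + L * \<bar>F n x - E n x\<bar>" for n x
  have WL: "W n \<in> L2 m" for n unfolding W_def by (rule mix[OF F(2) E(2)])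
  have kL: "k n \<in> L2 m" for n
    unfolding k_def by (intro L2_add L2_cmult L2_abs L2_diff mix F E)
  have p2: "(p x)\<^sup>2 \<le> 1" "(1 - p x)\<^sup>2 \<le> 1" for x
    using p(1)[of x] p(2)[of x] by (simp_all add: power_le_one)
  have sq2: "(p x * a + (1 - p x) * b)\<^sup>2 \<le> 2 * a\<^sup>2 + 2 * b\<^sup>2" for x a b
  proof -
    have "(p x * a + (1 - p x) * b)\<^sup>2 \<le> 2 * (p x * a)\<^sup>2 + 2 * ((1 - p x) * b)\<^sup>2"
      by (rule power2_add_le)
    also have "\<dots> \<le> 2 * (1 * a\<^sup>2) + 2 * (1 * b\<^sup>2)"
      unfolding power_mult_distrib by (intro add_mono mult_left_mono mult_right_mono p2) auto
    finally show ?thesis by simp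
  qed
  show ?thesis
  proof (rule strong_relaxedI_seq[where F = W and g = k])
    show "(\<lambda>x. p x * G x + (1 - p x) * H x) \<in> L2 m" by (rule mix[OF GL HL])
    show "W n \<in> Lip_b" for n
    proof -
      have "(\<lambda>x. 1 * E n x + 1 * (p x * (1 * F n x + (-1) * E n x))) \<in> Lip_b"
        by (intro Lip_b_lincomb Lip_b_mult pb F E)
      moreover have "W n = (\<lambda>x. 1 * E n x + 1 * (p x * (1 * F n x + (-1) * E n x)))"
        by (simp add: W_def fun_eq_iff algebra_simps)
      ultimately show ?thesis by simp
    qed
    show "AE x in m. slope (W n) x \<le> k n x" for n
      using F(4)[of n] E(4)[of n]
    proof eventually_elim
      case (elim x)
      have "slope (W n) x \<le> p x * slope (F n) x + (1 - p x) * slope (E n) x + L * \<bar>F n x - E n x\<bar>"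
        unfolding W_def[abs_def]
        by (rule slope_interpolation[OF Lip_b_Lip[OF F(1)] Lip_b_Lip[OF E(1)] p])
      also have "\<dots> \<le> k n x" unfolding k_def
        using elim p by (intro add_mono mult_left_mono order_refl) auto
      finally show ?case .
    qed
    show "(\<lambda>n. sqdist m (W n) f) \<longlonglongrightarrow> 0"
    proof (rule sqdist_tendsto_zero_le)
      show "(\<lambda>n. 2 * sqdist m (F n) f + 2 * sqdist m (E n) f) \<longlonglongrightarrow> 0"
        using tendsto_add[OF tendsto_mult_left[OF F(5), of 2] tendsto_mult_left[OF E(5), of 2]] by simp
      fix n
      have "sqdist m (W n) f \<le> (\<integral>x. 2 * (F n x - f x)\<^sup>2 + 2 * (E n x - f x)\<^sup>2 \<partial>m)"
        unfolding sqdist_def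
      proof (rule integral_mono)
        show "integrable m (\<lambda>x. (W n x - f x)\<^sup>2)" by (rule L2D(2)[OF L2_diff[OF WL f]])
        show "integrable m (\<lambda>x. 2 * (F n x - f x)\<^sup>2 + 2 * (E n x - f x)\<^sup>2)"
          using L2D(2)[OF L2_diff[OF F(2) f]] L2D(2)[OF L2_diff[OF E(2) f]] by simp
        fix x
        have "W n x - f x = p x * (F n x - f x) + (1 - p x) * (E n x - f x)"
          by (simp add: W_def algebra_simps)
        then show "(W n x - f x)\<^sup>2 \<le> 2 * (F n x - f x)\<^sup>2 + 2 * (E n x - f x)\<^sup>2"
          using sq2 by presburger
      qed
      also have "\<dots> = 2 * sqdist m (F n) f + 2 * sqdist m (E n) f"
        unfolding sqdist_def using L2D(2)[OF L2_diff[OF F(2) f]] L2D(2)[OF L2_diff[OF E(2) f]] by simp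
      finally show "sqdist m (W n) f \<le> 2 * sqdist m (F n) f + 2 * sqdist m (E n) f" .
    qed
    show "(\<lambda>n. sqdist m (k n) (\<lambda>x. p x * G x + (1 - p x) * H x)) \<longlonglongrightarrow> 0"
    proof (rule sqdist_tendsto_zero_le)
      define Q where "Q n = 4 * sqdist m (g n) G + 4 * sqdist m (h n) H + 2 * L\<^sup>2 * (2 * sqdist m (F n) f + 2 * sqdist m (E n) f)" for n
      have "Q \<longlonglongrightarrow> 4 * 0 + 4 * 0 + 2 * L\<^sup>2 * (2 * 0 + 2 * 0)"
        unfolding Q_def by (intro tendsto_intros F E)
      then show "Q \<longlonglongrightarrow> 0" by simp
      fix n
      have i: "integrable m (\<lambda>x. (g n x - G x)\<^sup>2)" "integrable m (\<lambda>x. (h n x - H x)\<^sup>2)"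
          "integrable m (\<lambda>x. (F n x - E n x)\<^sup>2)"
        by (rule L2D(2)[OF L2_diff[OF F(3) GL]] L2D(2)[OF L2_diff[OF E(3) HL]] L2D(2)[OF L2_diff[OF F(2) E(2)]])+
      have "sqdist m (k n) (\<lambda>x. p x * G x + (1 - p x) * H x)
          \<le> (\<integral>x. 4 * (g n x - G x)\<^sup>2 + 4 * (h n x - H x)\<^sup>2 + 2 * L\<^sup>2 * (F n x - E n x)\<^sup>2 \<partial>m)"
        unfolding sqdist_def
      proof (rule integral_mono)
        show "integrable m (\<lambda>x. (k n x - (p x * G x + (1 - p x) * H x))\<^sup>2)"
          by (rule L2D(2)[OF L2_diff[OF kL mix[OF GL HL]]])
        show "integrable m (\<lambda>x. 4 * (g n x - G x)\<^sup>2 + 4 * (h n x - H x)\<^sup>2 + 2 * L\<^sup>2 * (F n x - E n x)\<^sup>2)"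
          using i by simp
        fix x
        define a b c where "a = g n x - G x" "b = h n x - H x" "c = F n x - E n x"
        have "k n x - (p x * G x + (1 - p x) * H x) = (p x * a + (1 - p x) * b) + L * \<bar>c\<bar>"
          by (simp add: k_def a_b_c_def algebra_simps)
        moreover have "((p x * a + (1 - p x) * b) + L * \<bar>c\<bar>)\<^sup>2 \<le> 2 * (p x * a + (1 - p x) * b)\<^sup>2 + 2 * (L * \<bar>c\<bar>)\<^sup>2"
          by (rule power2_add_le)
        moreover have "(L * \<bar>c\<bar>)\<^sup>2 = L\<^sup>2 * c\<^sup>2" by (simp add: power_mult_distrib)
        ultimately have "(k n x - (p x * G x + (1 - p x) * H x))\<^sup>2 \<le> 4 * a\<^sup>2 + 4 * b\<^sup>2 + 2 * (L\<^sup>2 * c\<^sup>2)"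
          using sq2[of x a b] by simp
        then show "(k n x - (p x * G x + (1 - p x) * H x))\<^sup>2
            \<le> 4 * (g n x - G x)\<^sup>2 + 4 * (h n x - H x)\<^sup>2 + 2 * L\<^sup>2 * (F n x - E n x)\<^sup>2"
          by (simp add: a_b_c_def)
      qed
      also have "\<dots> = 4 * sqdist m (g n) G + 4 * sqdist m (h n) H + 2 * L\<^sup>2 * sqdist m (F n) (E n)"
        unfolding sqdist_def using i by simp
      also have "\<dots> \<le> Q n"
        unfolding Q_def
        using sqdist_triangle[OF F(2) f E(2), of n n] sqdist_commute[of m f "E n"]
        by (intro add_left_mono mult_left_mono) auto
      finally show "sqdist m (k n) (\<lambda>x. p x * G x + (1 - p x) * H x) \<le> Q n" .
    qed
  qed (fact WL kL)+
qed

lemma strong_relaxed_interpolation_limit: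
  assumes f: "f \<in> L2 m" and G: "G \<in> L2 m" and H: "H \<in> L2 m"
    and p: "\<And>n x. 0 \<le> p n x" "\<And>n x. p n x \<le> 1" "\<And>n. p n \<in> borel_measurable m"
    and B: "B \<in> sets m" and lim: "\<And>x. (\<lambda>n. p n x) \<longlonglongrightarrow> indicator B x"
    and sr: "\<And>n::nat. strong_relaxed f (\<lambda>x. p n x * G x + (1 - p n x) * H x)"
  shows "strong_relaxed f (\<lambda>x. if x \<in> B then G x else H x)"
proof -
  note [measurable] = p(3) L2D(1)[OF G] L2D(1)[OF H] B
  define J where "J x = (if x \<in> B then G x else H x)" for x
  define M where "M n x = p n x * G x + (1 - p n x) * H x" for n x
  have [measurable]: "J \<in> borel_measurable m" unfolding J_def[abs_def] by measurable
  have [measurable]: "M n \<in> borel_measurable m" for n unfolding M_def[abs_def] by measurable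
  have JL: "J \<in> L2 m"
    by (rule L2_dominated[OF L2_add[OF L2_abs[OF G] L2_abs[OF H]]]) (auto simp: J_def)
  have "(\<lambda>n. \<integral>x. (M n x - J x)\<^sup>2 \<partial>m) \<longlonglongrightarrow> (\<integral>x. 0 \<partial>m)"
  proof (rule integral_dominated_convergence[where w = "\<lambda>x. (G x - H x)\<^sup>2"])
    show "integrable m (\<lambda>x. (G x - H x)\<^sup>2)" by (rule L2D(2)[OF L2_diff[OF G H]])
    have eq: "M n x - J x = (p n x - indicator B x) * (G x - H x)" for n x
      by (auto simp: M_def J_def algebra_simps)
    show "AE x in m. (\<lambda>n. (M n x - J x)\<^sup>2) \<longlonglongrightarrow> 0"
    proof (rule AE_I2)
      fix x
      have "(\<lambda>n. ((p n x - indicator B x) * (G x - H x))\<^sup>2) \<longlonglongrightarrow> ((indicator B x - indicator B x) * (G x - H x))\<^sup>2"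
        by (intro tendsto_intros lim)
      then show "(\<lambda>n. (M n x - J x)\<^sup>2) \<longlonglongrightarrow> 0" by (simp add: eq)
    qed
    show "AE x in m. norm ((M n x - J x)\<^sup>2) \<le> (G x - H x)\<^sup>2" for n
    proof (rule AE_I2)
      fix x
      have "\<bar>p n x - indicator B x\<bar> \<le> 1" using p(1)[of n x] p(2)[of n x] by (auto split: split_indicator)
      then have "(p n x - indicator B x)\<^sup>2 \<le> 1" by (simp add: abs_square_le_1)
      then have "(p n x - indicator B x)\<^sup>2 * (G x - H x)\<^sup>2 \<le> 1 * (G x - H x)\<^sup>2" by (rule mult_right_mono) simp
      then show "norm ((M n x - J x)\<^sup>2) \<le> (G x - H x)\<^sup>2" by (simp add: eq power_mult_distrib)
    qed
  qed auto
  then have MJ: "(\<lambda>n. sqdist m (M n) J) \<longlonglongrightarrow> 0" by (simp add: sqdist_def)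
  have "strong_relaxed f J"
  proof (rule strong_relaxed_limit[OF f JL])
    fix e :: real assume e: "0 < e"
    have "\<forall>\<^sub>F n in sequentially. sqdist m (M n) J < e" by (rule order_tendstoD(2)[OF MJ e])
    then obtain n where n: "sqdist m (M n) J < e" by (auto simp: eventually_sequentially)
    have "strong_relaxed f (M n)" using sr[of n] by (simp add: M_def[abs_def])
    with n f e show "\<exists>f' G'. strong_relaxed f' G' \<and> f' \<in> L2 m \<and> sqdist m f' f < e \<and> sqdist m G' J < e"
      by (intro exI[of _ f] exI[of _ "M n"]) auto
  qed
  then show ?thesis by (simp add: J_def[abs_def])
qed

text \<open>
  Closed sets are handled by Lipschitz weights \<open>max 0 (1 - n * infdist x B)\<close>, which decrease to
  the indicator function. The sets \<open>B\<close> for which gluing works for all pairs of relaxed gradients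
  form a \<open>\<sigma>\<close>-algebra: complements exchange the two gradients, and unions are obtained by gluing
  twice.
\<close>

lemma strong_relaxed_glue:
  assumes f: "f \<in> L2 m" and "B \<in> sets borel" and "strong_relaxed f G" "strong_relaxed f H"
  shows "strong_relaxed f (\<lambda>x. if x \<in> B then G x else H x)"
proof -
  define good where "good B \<longleftrightarrow> B \<in> sets borel \<and> (\<forall>G H. strong_relaxed f G \<longrightarrow> strong_relaxed f H \<longrightarrow>
      strong_relaxed f (\<lambda>x. if x \<in> B then G x else H x))" for B :: "'a set"
  have goodD: "strong_relaxed f (\<lambda>x. if x \<in> B then G x else H x)"
    if "good B" "strong_relaxed f G" "strong_relaxed f H" for B G H
    using that unfolding good_def by blast
  have compl: "good (UNIV - B)" if "good B" for B
  proof -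
    have "(\<lambda>x. if x \<in> UNIV - B then G x else H x) = (\<lambda>x. if x \<in> B then H x else G x)" for G H :: "'a \<Rightarrow> real"
      by auto
    with that show ?thesis unfolding good_def by auto
  qed
  have un: "good (A \<union> B)" if "good A" "good B" for A B
  proof -
    have "strong_relaxed f (\<lambda>x. if x \<in> A \<union> B then G x else H x)" if GH: "strong_relaxed f G" "strong_relaxed f H" for G H
    proof -
      have "strong_relaxed f (\<lambda>x. if x \<in> A then G x else if x \<in> B then G x else H x)"
        by (intro goodD[OF \<open>good A\<close>] goodD[OF \<open>good B\<close>] GH)
      moreover have "(\<lambda>x. if x \<in> A then G x else if x \<in> B then G x else H x) = (\<lambda>x. if x \<in> A \<union> B then G x else H x)"
        by auto
      ultimately show ?thesis by simp
    qed
    with that show ?thesis unfolding good_def by auto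
  qed
  have emp: "good {}" unfolding good_def by simp
  have cl: "good B" if "closed B" for B
  proof (cases "B = {}")
    case True then show ?thesis using emp by simp
  next
    case False
    have "strong_relaxed f (\<lambda>x. if x \<in> B then G x else H x)" if GH: "strong_relaxed f G" "strong_relaxed f H" for G H
    proof -
      define p where "p n x = max 0 (1 - real n * infdist x B)" for n x
      have pLip: "\<bar>p n x - p n y\<bar> \<le> real n * dist x y" for n x y
      proof -
        have "\<bar>p n x - p n y\<bar> \<le> \<bar>real n * infdist x B - real n * infdist y B\<bar>"
          by (auto simp: p_def max_def)
        also have "\<dots> = real n * \<bar>infdist x B - infdist y B\<bar>" by (simp add: abs_mult flip: right_diff_distrib)
        also have "\<dots> \<le> real n * dist x y" by (intro mult_left_mono infdist_triangle_abs) simp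
        finally show ?thesis .
      qed
      have p01: "0 \<le> p n x" "p n x \<le> 1" for n x using infdist_nonneg[of x B] by (auto simp: p_def)
      show ?thesis
      proof (rule strong_relaxed_interpolation_limit[OF f strong_relaxed_L2[OF GH(1)] strong_relaxed_L2[OF GH(2)], where p = p])
        show "p n \<in> borel_measurable m" for n
          using measurable_Lip[OF LipI[of "real n" "p n"]] pLip by simp
        show "B \<in> sets m" using that \<open>closed B\<close> by simp
        show "strong_relaxed f (\<lambda>x. p n x * G x + (1 - p n x) * H x)" for n
          by (rule strong_relaxed_interpolation[OF f GH, of "p n" "real n"]) (use p01 pLip in auto)
        show "(\<lambda>n. p n x) \<longlonglongrightarrow> indicator B x" for x
        proof (cases "x \<in> B")
          case True
          then show ?thesis by (simp add: p_def)
        next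
          case F: False
          then have d: "infdist x B > 0"
            using in_closed_iff_infdist_zero[OF \<open>closed B\<close> False, of x] infdist_nonneg[of x B] by linarith
          obtain N :: nat where N: "1 / infdist x B \<le> real N" using real_arch_simple by blast
          have "p n x = 0" if "n \<ge> N" for n
          proof -
            have "1 / infdist x B \<le> real n" using N that by linarith
            then show ?thesis using d by (simp add: p_def divide_le_eq)
          qed
          then have "\<forall>\<^sub>F n in sequentially. p n x = 0" unfolding eventually_sequentially by blast
          then show ?thesis using F by (simp add: tendsto_eventually)
        qed
      qed (use p01 in auto)
    qed
    with that show ?thesis unfolding good_def by auto
  qed
  \<comment> \<open>Countable unions are limits of finite ones; the weights are indicator functions here.\<close>
  have Un: "good (\<Union>i. A i)" if A: "\<And>i::nat. good (A i)" for A
  proof -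
    define V where "V n = (\<Union>i<n. A i)" for n
    have V: "good (V n)" for n
    proof (induction n)
      case (Suc n)
      have "V (Suc n) = V n \<union> A n" by (auto simp: V_def less_Suc_eq)
      then show ?case using un[OF Suc A] by simp
    qed (simp add: V_def emp)
    have UB: "(\<Union>i. A i) \<in> sets borel" using A unfolding good_def by blast
    have "strong_relaxed f (\<lambda>x. if x \<in> (\<Union>i. A i) then G x else H x)" if GH: "strong_relaxed f G" "strong_relaxed f H" for G H
    proof (rule strong_relaxed_interpolation_limit[OF f strong_relaxed_L2[OF GH(1)] strong_relaxed_L2[OF GH(2)],
          where p = "\<lambda>n. indicator (V n)"])
      show "(indicator (V n) :: 'a \<Rightarrow> real) \<in> borel_measurable m" for n
        using V[of n] unfolding good_def by (intro borel_measurable_indicator) simp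
      show "(\<Union>i. A i) \<in> sets m" using UB by simp
      have "(\<lambda>x. indicator (V n) x * G x + (1 - indicator (V n) x) * H x) = (\<lambda>x. if x \<in> V n then G x else H x)" for n
        by (auto simp: fun_eq_iff)
      then show "strong_relaxed f (\<lambda>x. indicator (V n) x * G x + (1 - indicator (V n) x) * H x)" for n
        using goodD[OF V GH] by simp
      show "(\<lambda>n. indicator (V n) x :: real) \<longlonglongrightarrow> indicator (\<Union>i. A i) x" for x
        unfolding V_def by (rule LIMSEQ_indicator_UN)
    qed (auto simp: indicator_def)
    with UB show ?thesis unfolding good_def by blast
  qed
  have "good B" if "B \<in> sigma_sets UNIV (Collect closed)" for B
    using that
  proof induction
    case (Basic a) then show ?case using cl by simp
  next
    case Empty show ?case by (rule emp)
  next
    case (Compl a) then show ?case using compl by simp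
  next
    case (Union a) then show ?case using Un by simp
  qed
  then have "good B" using assms(2) unfolding borel_eq_closed by (simp add: sets_measure_of)
  then show ?thesis using goodD assms by blast
qed

lemma grad_norm_L2: "f \<in> W12 m \<Longrightarrow> grad_norm m f \<in> L2 m"
  using strong_relaxed_L2[OF grad_norm_W12(1)] .

lemma grad_norm_nonneg: "f \<in> W12 m \<Longrightarrow> AE x in m. 0 \<le> grad_norm m f x"
  using strong_relaxed_nonneg[OF grad_norm_W12(1) W12_L2] .

text \<open>
  Gluing with the set where \<open>G\<close> is smaller yields the minimum of both gradients as a relaxed
  gradient. Its norm cannot be less than that of the minimal one, so the two agree.
\<close>

theorem grad_norm_le_strong_relaxed:
  assumes G: "strong_relaxed f G" and f: "f \<in> L2 m"
  shows "AE x in m. grad_norm m f x \<le> G x"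
proof -
  have W: "f \<in> W12 m" by (rule energy_le_strong_relaxed(1)[OF G f])
  define g where "g = grad_norm m f"
  have gL: "g \<in> L2 m" and GL: "G \<in> L2 m"
    using grad_norm_L2[OF W] strong_relaxed_L2[OF G] by (auto simp: g_def)
  note [measurable] = L2D(1)[OF gL] L2D(1)[OF GL]
  define B where "B = {x. G x < g x}"
  have "{x \<in> space m. G x < g x} \<in> sets m" by measurable
  then have B: "B \<in> sets borel" by (simp add: B_def)
  define J where "J x = (if x \<in> B then G x else g x)" for x
  have sJ: "strong_relaxed f J"
    unfolding J_def[abs_def] g_def by (rule strong_relaxed_glue[OF f B G grad_norm_W12(1)[OF W]])
  have JL: "J \<in> L2 m" by (rule strong_relaxed_L2[OF sJ])
  have pos: "AE x in m. 0 \<le> J x \<and> J x \<le> g x"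
    using strong_relaxed_nonneg[OF sJ f] by eventually_elim (auto simp: J_def B_def)
  have i: "integrable m (\<lambda>x. (g x)\<^sup>2 - (J x)\<^sup>2)" using L2D(2)[OF gL] L2D(2)[OF JL] by simp
  have nn: "AE x in m. 0 \<le> (g x)\<^sup>2 - (J x)\<^sup>2" using pos by eventually_elim (simp add: power_mono)
  have "(\<integral>x. (g x)\<^sup>2 - (J x)\<^sup>2 \<partial>m) \<le> 0"
    using energy_le_strong_relaxed(2)[OF sJ f] grad_norm_W12(2)[OF W] L2D(2)[OF gL] L2D(2)[OF JL]
    by (simp add: g_def)
  moreover have "0 \<le> (\<integral>x. (g x)\<^sup>2 - (J x)\<^sup>2 \<partial>m)" by (rule integral_nonneg_AE[OF nn])
  ultimately have "AE x in m. (g x)\<^sup>2 - (J x)\<^sup>2 = 0"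
    using integral_nonneg_eq_0_iff_AE[OF i nn] by simp
  with pos show ?thesis
  proof eventually_elim
    case (elim x)
    then have "g x = J x" by (intro power2_eq_imp_eq[of "g x" "J x"]) auto
    then have "\<not> G x < g x" by (auto simp: J_def B_def)
    then show ?case unfolding g_def by simp
  qed
qed

end

section \<open>Calculus of minimal relaxed gradients\<close>

context mm_space
begin

lemma sqdist_lincomb_le:
  assumes "u \<in> L2 m" "u' \<in> L2 m" "v \<in> L2 m" "v' \<in> L2 m"
  shows "sqdist m (\<lambda>x. a * u x + b * v x) (\<lambda>x. a * u' x + b * v' x)
      \<le> 2 * a\<^sup>2 * sqdist m u u' + 2 * b\<^sup>2 * sqdist m v v'"
proof -
  have i: "integrable m (\<lambda>x. (u x - u' x)\<^sup>2)" "integrable m (\<lambda>x. (v x - v' x)\<^sup>2)"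
    by (rule L2D(2)[OF L2_diff[OF assms(1,2)]] L2D(2)[OF L2_diff[OF assms(3,4)]])+
  have "sqdist m (\<lambda>x. a * u x + b * v x) (\<lambda>x. a * u' x + b * v' x)
      \<le> (\<integral>x. 2 * a\<^sup>2 * (u x - u' x)\<^sup>2 + 2 * b\<^sup>2 * (v x - v' x)\<^sup>2 \<partial>m)"
    unfolding sqdist_def
  proof (rule integral_mono)
    show "integrable m (\<lambda>x. (a * u x + b * v x - (a * u' x + b * v' x))\<^sup>2)"
      by (intro L2D(2)[OF L2_diff] L2_add L2_cmult assms)
    show "integrable m (\<lambda>x. 2 * a\<^sup>2 * (u x - u' x)\<^sup>2 + 2 * b\<^sup>2 * (v x - v' x)\<^sup>2)" using i by simp
    fix x
    have "2 * a\<^sup>2 * (u x - u' x)\<^sup>2 + 2 * b\<^sup>2 * (v x - v' x)\<^sup>2 - (a * u x + b * v x - (a * u' x + b * v' x))\<^sup>2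
        = (a * (u x - u' x) - b * (v x - v' x))\<^sup>2" by algebra
    then show "(a * u x + b * v x - (a * u' x + b * v' x))\<^sup>2 \<le> 2 * a\<^sup>2 * (u x - u' x)\<^sup>2 + 2 * b\<^sup>2 * (v x - v' x)\<^sup>2"
      using zero_le_power2[of "a * (u x - u' x) - b * (v x - v' x)"] by linarith
  qed
  also have "\<dots> = 2 * a\<^sup>2 * sqdist m u u' + 2 * b\<^sup>2 * sqdist m v v'"
    unfolding sqdist_def using i by simp
  finally show ?thesis .
qed

lemma sqdist_lincomb_tendsto:
  assumes "\<And>n. F n \<in> L2 m" "f \<in> L2 m" "\<And>n. E n \<in> L2 m" "e \<in> L2 m"
    "(\<lambda>n. sqdist m (F n) f) \<longlonglongrightarrow> 0" "(\<lambda>n. sqdist m (E n) e) \<longlonglongrightarrow> 0"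
  shows "(\<lambda>n. sqdist m (\<lambda>x. a * F n x + b * E n x) (\<lambda>x. a * f x + b * e x)) \<longlonglongrightarrow> 0"
proof (rule sqdist_tendsto_zero_le)
  show "sqdist m (\<lambda>x. a * F n x + b * E n x) (\<lambda>x. a * f x + b * e x)
      \<le> 2 * a\<^sup>2 * sqdist m (F n) f + 2 * b\<^sup>2 * sqdist m (E n) e" for n
    by (rule sqdist_lincomb_le[OF assms(1,2,3,4)])
  have "(\<lambda>n. 2 * a\<^sup>2 * sqdist m (F n) f + 2 * b\<^sup>2 * sqdist m (E n) e) \<longlonglongrightarrow> 2 * a\<^sup>2 * 0 + 2 * b\<^sup>2 * 0"
    by (intro tendsto_intros assms)
  then show "(\<lambda>n. 2 * a\<^sup>2 * sqdist m (F n) f + 2 * b\<^sup>2 * sqdist m (E n) e) \<longlonglongrightarrow> 0" by simp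
qed

lemma strong_relaxed_lincomb:
  assumes u: "u \<in> L2 m" and v: "v \<in> L2 m" and G: "strong_relaxed u G" and H: "strong_relaxed v H"
  shows "strong_relaxed (\<lambda>x. a * u x + b * v x) (\<lambda>x. \<bar>a\<bar> * G x + \<bar>b\<bar> * H x)"
proof -
  obtain F g where F: "\<And>n::nat. F n \<in> Lip_b" "\<And>n. F n \<in> L2 m" "\<And>n. g n \<in> L2 m"
    "\<And>n. AE x in m. slope (F n) x \<le> g n x"
    "(\<lambda>n. sqdist m (F n) u) \<longlonglongrightarrow> 0" "(\<lambda>n. sqdist m (g n) G) \<longlonglongrightarrow> 0"
    by (rule strong_relaxedE_seq[OF G u]) blast
  obtain E h where E: "\<And>n::nat. E n \<in> Lip_b" "\<And>n. E n \<in> L2 m" "\<And>n. h n \<in> L2 m"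
    "\<And>n. AE x in m. slope (E n) x \<le> h n x"
    "(\<lambda>n. sqdist m (E n) v) \<longlonglongrightarrow> 0" "(\<lambda>n. sqdist m (h n) H) \<longlonglongrightarrow> 0"
    by (rule strong_relaxedE_seq[OF H v]) blast
  show ?thesis
  proof (rule strong_relaxedI_seq[where F = "\<lambda>n x. a * F n x + b * E n x" and g = "\<lambda>n x. \<bar>a\<bar> * g n x + \<bar>b\<bar> * h n x"])
    show "AE x in m. slope (\<lambda>x. a * F n x + b * E n x) x \<le> \<bar>a\<bar> * g n x + \<bar>b\<bar> * h n x" for n
      using F(4)[of n] E(4)[of n]
    proof eventually_elim
      case (elim x)
      have "\<bar>a\<bar> * slope (F n) x + \<bar>b\<bar> * slope (E n) x \<le> \<bar>a\<bar> * g n x + \<bar>b\<bar> * h n x"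
        by (intro add_mono mult_left_mono elim) auto
      with slope_lincomb[OF Lip_b_Lip[OF F(1)] Lip_b_Lip[OF E(1)]] show ?case by (rule order_trans)
    qed
  qed (intro Lip_b_lincomb L2_add L2_cmult sqdist_lincomb_tendsto strong_relaxed_L2[OF G] strong_relaxed_L2[OF H] F E u v)+
qed

lemma W12_lincomb:
  assumes "u \<in> W12 m" "v \<in> W12 m"
  shows "(\<lambda>x. a * u x + b * v x) \<in> W12 m"
  using energy_le_strong_relaxed(1)[OF strong_relaxed_lincomb[OF assms[THEN W12_L2] assms[THEN grad_norm_W12(1)]]]
    assms[THEN W12_L2] by (simp add: L2_add L2_cmult)

lemma grad_norm_lincomb:
  assumes "u \<in> W12 m" "v \<in> W12 m"
  shows "AE x in m. grad_norm m (\<lambda>x. a * u x + b * v x) x \<le> \<bar>a\<bar> * grad_norm m u x + \<bar>b\<bar> * grad_norm m v x"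
  by (rule grad_norm_le_strong_relaxed[OF strong_relaxed_lincomb[OF assms[THEN W12_L2] assms[THEN grad_norm_W12(1)]]])
    (intro L2_add L2_cmult assms[THEN W12_L2])

text \<open>
  The derivative at the approximants converges almost everywhere to the derivative at \<open>f\<close> because
  it is continuous; as it is bounded, dominated convergence applies to the product with \<open>G\<close>. The
  hypothesis on \<open>L\<^sup>2\<close> covers both \<open>S 0 = 0\<close> and spaces of finite measure.
\<close>

lemma strong_relaxed_chain:
  fixes S S' :: "real \<Rightarrow> real"
  assumes f: "f \<in> L2 m" and G: "strong_relaxed f G"
    and S: "\<And>s. (S has_real_derivative S' s) (at s)" and S': "continuous_on UNIV S'" "\<And>s. \<bar>S' s\<bar> \<le> C"
    and S_L2: "\<And>u. u \<in> L2 m \<Longrightarrow> (\<lambda>x. S (u x)) \<in> L2 m"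
  shows "strong_relaxed (\<lambda>x. S (f x)) (\<lambda>x. \<bar>S' (f x)\<bar> * G x)"
proof -
  obtain F g where F: "\<And>n::nat. F n \<in> Lip_b" "\<And>n. F n \<in> L2 m" "\<And>n. g n \<in> L2 m"
    "\<And>n. AE x in m. slope (F n) x \<le> g n x"
    "(\<lambda>n. sqdist m (F n) f) \<longlonglongrightarrow> 0" "(\<lambda>n. sqdist m (g n) G) \<longlonglongrightarrow> 0"
    "AE x in m. (\<lambda>n. F n x) \<longlonglongrightarrow> f x"
    by (rule strong_relaxedE_seq[OF G f]) blast
  note GL = strong_relaxed_L2[OF G]
  have C0: "0 \<le> C" using S'(2)[of 0] by linarith
  have SL: "\<bar>S s - S t\<bar> \<le> C * \<bar>s - t\<bar>" for s t
    using field_differentiable_bound[of UNIV S S' C s t] S S'(2) by simp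
  have [measurable]: "S' \<in> borel_measurable borel" using S'(1) by (rule borel_measurable_continuous_onI)
  note [measurable] = L2D(1)[OF f] L2D(1)[OF F(2)] L2D(1)[OF F(3)] L2D(1)[OF GL]
  have b: "\<bar>\<bar>S' s\<bar>\<bar> \<le> C" for s using S'(2) by simp
  have mL: "(\<lambda>x. \<bar>S' (u x)\<bar> * v x) \<in> L2 m" if "u \<in> borel_measurable m" "v \<in> L2 m" for u v
    by (rule L2_mult_bounded[OF that(2) _ b]) (use that(1) in measurable)
  show ?thesis
  proof (rule strong_relaxedI_seq[where F = "\<lambda>n x. S (F n x)" and g = "\<lambda>n x. \<bar>S' (F n x)\<bar> * g n x"])
    show "(\<lambda>x. \<bar>S' (f x)\<bar> * G x) \<in> L2 m" by (rule mL) (use GL in auto)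
    show "(\<lambda>x. S (F n x)) \<in> Lip_b" for n
    proof -
      obtain M where M: "\<And>x. \<bar>F n x\<bar> \<le> M" by (rule Lip_b_bound[OF F(1)]) blast
      have "\<bar>S (F n x)\<bar> \<le> \<bar>S 0\<bar> + C * M" for x
        using SL[of "F n x" 0] mult_left_mono[OF M[of x] C0] by simp
      then have "bounded (range (\<lambda>x. S (F n x)))" by (intro boundedI[of _ "\<bar>S 0\<bar> + C * M"]) auto
      then show ?thesis using Lip_contraction[OF Lip_b_Lip[OF F(1)] C0 SL] by (simp add: Lip_b_def)
    qed
    show "(\<lambda>x. \<bar>S' (F n x)\<bar> * g n x) \<in> L2 m" for n by (rule mL) (use F in auto)
    show "AE x in m. slope (\<lambda>x. S (F n x)) x \<le> \<bar>S' (F n x)\<bar> * g n x" for n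
      using F(4)[of n]
    proof eventually_elim
      case (elim x)
      from slope_chain[OF Lip_b_Lip[OF F(1)] S] mult_left_mono[OF elim, of "\<bar>S' (F n x)\<bar>"]
      show ?case by (meson abs_ge_zero order_trans)
    qed
    show "(\<lambda>n. sqdist m (\<lambda>x. S (F n x)) (\<lambda>x. S (f x))) \<longlonglongrightarrow> 0"
    proof (rule sqdist_tendsto_zero_le)
      fix n
      have "sqdist m (\<lambda>x. S (F n x)) (\<lambda>x. S (f x)) \<le> sqdist m (\<lambda>x. C * F n x) (\<lambda>x. C * f x)"
      proof (rule sqdist_mono)
        show "AE x in m. \<bar>S (F n x) - S (f x)\<bar> \<le> \<bar>C * F n x - C * f x\<bar>"
          using SL C0 by (auto simp: abs_mult simp flip: right_diff_distrib)
      qed (intro S_L2 L2_cmult F f)+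
      also have "\<dots> = C\<^sup>2 * sqdist m (F n) f"
        by (simp add: sqdist_def power_mult_distrib flip: right_diff_distrib)
      finally show "sqdist m (\<lambda>x. S (F n x)) (\<lambda>x. S (f x)) \<le> C\<^sup>2 * sqdist m (F n) f" .
    next
      show "(\<lambda>n. C\<^sup>2 * sqdist m (F n) f) \<longlonglongrightarrow> 0" using tendsto_mult_left[OF F(5), of "C\<^sup>2"] by simp
    qed
    show "(\<lambda>n. sqdist m (\<lambda>x. \<bar>S' (F n x)\<bar> * g n x) (\<lambda>x. \<bar>S' (f x)\<bar> * G x)) \<longlonglongrightarrow> 0"
    proof (rule sqdist_tendsto_zero_le)
      fix n
      have "sqdist m (\<lambda>x. \<bar>S' (F n x)\<bar> * g n x) (\<lambda>x. \<bar>S' (F n x)\<bar> * G x)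
          \<le> sqdist m (\<lambda>x. C * g n x) (\<lambda>x. C * G x)"
      proof (rule sqdist_mono)
        have "\<bar>S' (F n x)\<bar> * \<bar>g n x - G x\<bar> \<le> C * \<bar>g n x - G x\<bar>" for x
          by (rule mult_right_mono[OF S'(2)]) simp
        then show "AE x in m. \<bar>\<bar>S' (F n x)\<bar> * g n x - \<bar>S' (F n x)\<bar> * G x\<bar> \<le> \<bar>C * g n x - C * G x\<bar>"
          using C0 by (auto simp: abs_mult simp flip: right_diff_distrib)
      qed (intro mL L2_cmult F GL L2D(1))+
      also have "\<dots> = C\<^sup>2 * sqdist m (g n) G"
        by (simp add: sqdist_def power_mult_distrib flip: right_diff_distrib)
      finally have 1: "sqdist m (\<lambda>x. \<bar>S' (F n x)\<bar> * g n x) (\<lambda>x. \<bar>S' (F n x)\<bar> * G x) \<le> C\<^sup>2 * sqdist m (g n) G" .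
      show "sqdist m (\<lambda>x. \<bar>S' (F n x)\<bar> * g n x) (\<lambda>x. \<bar>S' (f x)\<bar> * G x)
          \<le> 2 * (C\<^sup>2 * sqdist m (g n) G) + 2 * sqdist m (\<lambda>x. \<bar>S' (F n x)\<bar> * G x) (\<lambda>x. \<bar>S' (f x)\<bar> * G x)"
        using sqdist_triangle[OF mL[OF L2D(1)[OF F(2)] F(3)] mL[OF L2D(1)[OF F(2)] GL] mL[OF L2D(1)[OF f] GL], of n n n] 1
        by linarith
    next
      have "(\<lambda>n. \<integral>x. (\<bar>S' (F n x)\<bar> * G x - \<bar>S' (f x)\<bar> * G x)\<^sup>2 \<partial>m) \<longlonglongrightarrow> (\<integral>x. 0 \<partial>m)"
      proof (rule integral_dominated_convergence[where w = "\<lambda>x. C\<^sup>2 * (G x)\<^sup>2"])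
        show "integrable m (\<lambda>x. C\<^sup>2 * (G x)\<^sup>2)" using L2D(2)[OF GL] by simp
        show "AE x in m. (\<lambda>n. (\<bar>S' (F n x)\<bar> * G x - \<bar>S' (f x)\<bar> * G x)\<^sup>2) \<longlonglongrightarrow> 0"
          using F(7)
        proof eventually_elim
          case (elim x)
          have "(\<lambda>n. S' (F n x)) \<longlonglongrightarrow> S' (f x)"
            by (rule continuous_on_tendsto_compose[OF S'(1) elim]) auto
          then have "(\<lambda>n. (\<bar>S' (F n x)\<bar> * G x - \<bar>S' (f x)\<bar> * G x)\<^sup>2) \<longlonglongrightarrow> (\<bar>S' (f x)\<bar> * G x - \<bar>S' (f x)\<bar> * G x)\<^sup>2"
            by (intro tendsto_intros)
          then show ?case by simp
        qed
        show "AE x in m. norm ((\<bar>S' (F n x)\<bar> * G x - \<bar>S' (f x)\<bar> * G x)\<^sup>2) \<le> C\<^sup>2 * (G x)\<^sup>2" for n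
        proof (rule AE_I2)
          fix x
          have "\<bar>\<bar>S' (F n x)\<bar> - \<bar>S' (f x)\<bar>\<bar> \<le> C" using S'(2)[of "F n x"] S'(2)[of "f x"] by linarith
          then have "(\<bar>S' (F n x)\<bar> - \<bar>S' (f x)\<bar>)\<^sup>2 \<le> C\<^sup>2" using C0 by (simp add: abs_le_square_iff[symmetric])
          then have "(\<bar>S' (F n x)\<bar> - \<bar>S' (f x)\<bar>)\<^sup>2 * (G x)\<^sup>2 \<le> C\<^sup>2 * (G x)\<^sup>2" by (rule mult_right_mono) simp
          then show "norm ((\<bar>S' (F n x)\<bar> * G x - \<bar>S' (f x)\<bar> * G x)\<^sup>2) \<le> C\<^sup>2 * (G x)\<^sup>2"
            by (simp add: power_mult_distrib flip: left_diff_distrib)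
        qed
      qed auto
      then have "(\<lambda>n. sqdist m (\<lambda>x. \<bar>S' (F n x)\<bar> * G x) (\<lambda>x. \<bar>S' (f x)\<bar> * G x)) \<longlonglongrightarrow> 0" by (simp add: sqdist_def)
      then have "(\<lambda>n. 2 * (C\<^sup>2 * sqdist m (g n) G) + 2 * sqdist m (\<lambda>x. \<bar>S' (F n x)\<bar> * G x) (\<lambda>x. \<bar>S' (f x)\<bar> * G x))
         \<longlonglongrightarrow> 2 * (C\<^sup>2 * 0) + 2 * 0" by (intro tendsto_intros F)
      then show "(\<lambda>n. 2 * (C\<^sup>2 * sqdist m (g n) G) + 2 * sqdist m (\<lambda>x. \<bar>S' (F n x)\<bar> * G x) (\<lambda>x. \<bar>S' (f x)\<bar> * G x)) \<longlonglongrightarrow> 0"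
        by simp
    qed
  qed (intro S_L2 F)+
qed

lemma energy_lsc:
  assumes f: "f \<in> W12 m" and F: "\<And>n. F n \<in> W12 m" and lim: "(\<lambda>n. sqdist m (F n) f) \<longlonglongrightarrow> 0"
    and b: "b < energy f"
  shows "\<forall>\<^sub>F n in sequentially. b < energy (F n)"
proof -
  obtain c where c: "b < c" "c < energy f" using dense[OF b] by blast
  obtain e where e: "0 < e"
    "\<And>u. u \<in> Lip \<Longrightarrow> u \<in> L2 m \<Longrightarrow> slope u \<in> L2 m \<Longrightarrow> sqdist m u f < e \<Longrightarrow> c < (\<integral>x. (slope u x)\<^sup>2 \<partial>m)"
    using energy_lower[OF f c(2)] by blast
  have "\<forall>\<^sub>F n in sequentially. sqdist m (F n) f < e / 4"
    using e by (intro order_tendstoD(2)[OF lim]) simp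
  then show ?thesis
  proof eventually_elim
    case (elim n)
    show ?case
    proof (rule ccontr)
      assume "\<not> b < energy (F n)"
      then have "energy (F n) < c" using c by simp
      from energy_approx[OF F this, of "e / 4"] e(1) obtain u where
        u: "u \<in> Lip" "u \<in> L2 m" "slope u \<in> L2 m" "sqdist m u (F n) < e / 4" "(\<integral>x. (slope u x)\<^sup>2 \<partial>m) < c" by auto
      have "sqdist m u f < e"
        using sqdist_triangle[OF u(2) W12_L2[OF F] W12_L2[OF f], of n] u(4) elim e(1) by linarith
      from e(2)[OF u(1-3) this] u(5) show False by simp
    qed
  qed
qed

text \<open>
  The functions \<open>S n s = s - arctan ((n + 1) s) / (n + 1)\<close> converge to the identity, have
  derivatives in \<open>[0, 1)\<close>, and are flat at \<open>0\<close>. By the chain rule the energy of \<open>S n \<circ> u\<close> is at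
  most the integral of \<open>|\<nabla>u|\<^sup>2\<close> over \<open>{u \<noteq> 0}\<close>, and by lower semicontinuity so is the energy of
  \<open>u\<close>.
\<close>

lemma grad_norm_zero_level:
  assumes u: "u \<in> W12 m"
  shows "AE x in m. u x = 0 \<longrightarrow> grad_norm m u x = 0"
proof -
  define S where "S n s = s - arctan (real (Suc n) * s) / real (Suc n)" for n s
  define S' where "S' n s = 1 - 1 / (1 + (real (Suc n) * s)\<^sup>2)" for n s
  have uL: "u \<in> L2 m" by (rule W12_L2[OF u])
  define g where "g = grad_norm m u"
  have gL: "g \<in> L2 m" unfolding g_def by (rule grad_norm_L2[OF u])
  note [measurable] = L2D(1)[OF uL] L2D(1)[OF gL]
  have der: "(S n has_real_derivative S' n s) (at s)" for n s
    unfolding S_def[abs_def] S'_def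
    by (rule derivative_eq_intros refl | simp)+ (simp add: field_simps inverse_eq_divide)
  have pos: "0 < 1 + (real (Suc n) * s)\<^sup>2" for n s by (rule add_pos_nonneg) auto
  have cont: "continuous_on UNIV (S' n)" for n
    unfolding S'_def[abs_def] by (intro continuous_intros ballI) (use pos in \<open>metis less_irrefl\<close>)
  have S'01: "0 \<le> S' n s" "S' n s \<le> 1" for n s
    using pos[of n s] by (auto simp: S'_def divide_le_eq)
  have S'b: "\<bar>S' n s\<bar> \<le> 1" for n s using S'01[of n s] by simp
  have S0: "S n 0 = 0" for n by (simp add: S_def)
  have SL: "\<bar>S n s - S n t\<bar> \<le> 1 * \<bar>s - t\<bar>" for n s t
    using field_differentiable_bound[of UNIV "S n" "S' n" 1 s t] der S'b by simp
  have Sabs: "\<bar>S n s\<bar> \<le> \<bar>s\<bar>" for n s using SL[of n s 0] S0 by simp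
  have [measurable]: "S n \<in> borel_measurable borel" for n
    by (rule borel_measurable_continuous_onI) (meson der DERIV_continuous_on has_field_derivative_at_within)
  have S_L2: "(\<lambda>x. S n (v x)) \<in> L2 m" if "v \<in> L2 m" for v n
    by (rule L2_dominated[OF that]) (use Sabs L2D(1)[OF that] in auto)
  have sr: "strong_relaxed (\<lambda>x. S n (u x)) (\<lambda>x. \<bar>S' n (u x)\<bar> * g x)" for n
    unfolding g_def by (rule strong_relaxed_chain[OF uL grad_norm_W12(1)[OF u] der cont S'b S_L2])
  note W = energy_le_strong_relaxed[OF sr S_L2[OF uL]]
  have lim: "(\<lambda>n. sqdist m (\<lambda>x. S n (u x)) u) \<longlonglongrightarrow> 0"
  proof -
    have "(\<lambda>n. \<integral>x. (S n (u x) - u x)\<^sup>2 \<partial>m) \<longlonglongrightarrow> (\<integral>x. 0 \<partial>m)"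
    proof (rule integral_dominated_convergence[where w = "\<lambda>x. 4 * (u x)\<^sup>2"])
      show "AE x in m. (\<lambda>n. (S n (u x) - u x)\<^sup>2) \<longlonglongrightarrow> 0"
      proof (rule AE_I2)
        fix x
        have "(\<lambda>n. S n (u x) - u x) \<longlonglongrightarrow> 0"
        proof (rule Lim_null_comparison)
          show "\<forall>\<^sub>F n in sequentially. norm (S n (u x) - u x) \<le> (pi / 2) / real (Suc n)"
          proof (intro always_eventually allI)
            fix n
            have "\<bar>arctan (real (Suc n) * u x)\<bar> \<le> pi / 2"
              using arctan_bounded[of "real (Suc n) * u x"] by linarith
            then have "\<bar>arctan (real (Suc n) * u x)\<bar> / real (Suc n) \<le> (pi / 2) / real (Suc n)"
              by (rule divide_right_mono) simp
            moreover have "norm (S n (u x) - u x) = \<bar>arctan (real (Suc n) * u x)\<bar> / real (Suc n)"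
              by (simp add: S_def abs_divide del: of_nat_Suc)
            ultimately show "norm (S n (u x) - u x) \<le> (pi / 2) / real (Suc n)" by linarith
          qed
          show "(\<lambda>n. (pi / 2) / real (Suc n)) \<longlonglongrightarrow> 0"
            by (rule LIMSEQ_Suc[OF lim_const_over_n])
        qed
        from tendsto_power[OF this, of 2] show "(\<lambda>n. (S n (u x) - u x)\<^sup>2) \<longlonglongrightarrow> 0" by simp
      qed
      show "AE x in m. norm ((S n (u x) - u x)\<^sup>2) \<le> 4 * (u x)\<^sup>2" for n
      proof (rule AE_I2)
        fix x
        have "\<bar>S n (u x) - u x\<bar> \<le> \<bar>2 * u x\<bar>" using Sabs[of n "u x"] by linarith
        then have "(S n (u x) - u x)\<^sup>2 \<le> (2 * u x)\<^sup>2" by (simp only: abs_le_square_iff)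
        then show "norm ((S n (u x) - u x)\<^sup>2) \<le> 4 * (u x)\<^sup>2" by (simp add: power_mult_distrib)
      qed
    qed (use L2D(2)[OF uL] in auto)
    then show ?thesis by (simp add: sqdist_def)
  qed
  define B where "B = {x \<in> space m. u x \<noteq> 0}"
  have [measurable]: "B \<in> sets m" unfolding B_def by measurable
  have iB: "integrable m (\<lambda>x. indicator B x * (g x)\<^sup>2)"
    using L2D(2)[OF gL] by (rule integrable_mult_indicator[where f = "\<lambda>x. (g x)\<^sup>2", OF \<open>B \<in> sets m\<close>, unfolded real_scaleR_def])
  have le: "energy (\<lambda>x. S n (u x)) \<le> (\<integral>x. indicator B x * (g x)\<^sup>2 \<partial>m)" for n
  proof -
    have "(\<integral>x. (\<bar>S' n (u x)\<bar> * g x)\<^sup>2 \<partial>m) \<le> (\<integral>x. indicator B x * (g x)\<^sup>2 \<partial>m)"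
    proof (rule integral_mono)
      show "integrable m (\<lambda>x. (\<bar>S' n (u x)\<bar> * g x)\<^sup>2)" by (rule L2D(2)[OF strong_relaxed_L2[OF sr]])
      show "integrable m (\<lambda>x. indicator B x * (g x)\<^sup>2)" by (rule iB)
      fix x
      show "(\<bar>S' n (u x)\<bar> * g x)\<^sup>2 \<le> indicator B x * (g x)\<^sup>2"
      proof (cases "u x = 0")
        case True
        then show ?thesis by (simp add: S'_def)
      next
        case False
        then have B: "indicator B x = (1::real)" by (simp add: B_def)
        have "(S' n (u x))\<^sup>2 \<le> 1" using S'b by (simp add: abs_square_le_1)
        then show ?thesis using mult_right_mono[of "(S' n (u x))\<^sup>2" 1 "(g x)\<^sup>2"] by (simp add: B power_mult_distrib)
      qed
    qed
    with W(2)[of n] show ?thesis by linarith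
  qed
  have "energy u \<le> (\<integral>x. indicator B x * (g x)\<^sup>2 \<partial>m)"
  proof (rule ccontr)
    assume "\<not> ?thesis"
    then have "\<forall>\<^sub>F n in sequentially. (\<integral>x. indicator B x * (g x)\<^sup>2 \<partial>m) < energy (\<lambda>x. S n (u x))"
      by (intro energy_lsc[OF u W(1) lim]) simp
    then obtain n where "(\<integral>x. indicator B x * (g x)\<^sup>2 \<partial>m) < energy (\<lambda>x. S n (u x))"
      by (auto simp: eventually_sequentially)
    with le[of n] show False by simp
  qed
  then have "(\<integral>x. (g x)\<^sup>2 - indicator B x * (g x)\<^sup>2 \<partial>m) \<le> 0"
    using grad_norm_W12(2)[OF u] iB L2D(2)[OF gL] by (simp add: g_def)
  moreover have nn: "AE x in m. 0 \<le> (g x)\<^sup>2 - indicator B x * (g x)\<^sup>2"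
    by (rule AE_I2) (simp split: split_indicator)
  moreover have i: "integrable m (\<lambda>x. (g x)\<^sup>2 - indicator B x * (g x)\<^sup>2)" using iB L2D(2)[OF gL] by simp
  ultimately have "AE x in m. (g x)\<^sup>2 - indicator B x * (g x)\<^sup>2 = 0"
    using integral_nonneg_eq_0_iff_AE[OF i nn] integral_nonneg_AE[OF nn] by simp
  then show ?thesis by eventually_elim (auto simp: B_def g_def split: split_indicator_asm)
qed

text \<open>
  The gradients of \<open>u\<close> and \<open>v\<close> differ by at most that of \<open>u - v\<close>, which vanishes where \<open>u = v\<close>.
\<close>

theorem grad_norm_local:
  assumes u: "u \<in> W12 m" and v: "v \<in> W12 m"
  shows "AE x in m. u x = v x \<longrightarrow> grad_norm m u x = grad_norm m v x"
proof -
  define w where "w x = 1 * u x + (-1) * v x" for x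
  have w: "w \<in> W12 m" unfolding w_def[abs_def] by (rule W12_lincomb[OF u v])
  have uv: "(\<lambda>x. 1 * v x + 1 * w x) = u" "(\<lambda>x. 1 * u x + (-1) * w x) = v"
    by (auto simp: w_def fun_eq_iff)
  show ?thesis
    using grad_norm_zero_level[OF w] grad_norm_lincomb[OF v w, of 1 1, unfolded uv]
      grad_norm_lincomb[OF u w, of 1 "-1", unfolded uv]
    by eventually_elim (auto simp: w_def)
qed

lemma bounded_support_L2:
  assumes u: "u \<in> borel_measurable m" and b: "\<And>x. \<bar>u x\<bar> \<le> C" and A: "bounded A" and z: "\<And>x. x \<notin> A \<Longrightarrow> u x = 0"
  shows "u \<in> L2 m"
proof (rule L2_dominated)
  have cb: "bounded (closure A)" using A by (rule bounded_closure)
  then have "emeasure m (closure A) < \<infinity>" by (intro emeasure_bounded) auto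
  then have "integrable m (indicat_real (closure A))" by (intro integrable_real_indicator) auto
  moreover have "(indicat_real (closure A) x)\<^sup>2 = indicator (closure A) x" for x by (simp add: indicator_def)
  ultimately show "(\<lambda>x. C * indicator (closure A) x) \<in> L2 m"
    by (intro L2_cmult) (simp add: L2_def)
  have "\<bar>u x\<bar> \<le> \<bar>C * indicator (closure A) x\<bar>" for x
    using b[of x] z[of x] closure_subset[of A] by (auto simp: indicator_def)
  then show "AE x in m. \<bar>u x\<bar> \<le> \<bar>C * indicator (closure A) x\<bar>" by simp
qed (rule u)

lemma Lip_bs_facts:
  assumes "u \<in> Lip_bs"
  shows "u \<in> Lip" "u \<in> L2 m" "slope u \<in> L2 m" "strong_relaxed u (slope u)" "u \<in> W12 m"
proof -
  show uL: "u \<in> Lip" using assms by (simp add: Lip_bs_def)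
  have bs: "bounded {x. u x \<noteq> 0}" using assms by (simp add: Lip_bs_def)
  obtain M where M: "\<And>x. \<bar>u x\<bar> \<le> M" by (rule Lip_b_bound[OF Lip_bs_Lip_b[OF assms]]) blast
  show u2: "u \<in> L2 m" by (rule bounded_support_L2[OF measurable_Lip[OF uL] M bs]) simp
  obtain C where C: "0 \<le> C" "\<And>x y. \<bar>u x - u y\<bar> \<le> C * dist x y" by (rule LipE[OF uL]) blast
  show s2: "slope u \<in> L2 m"
  proof (rule bounded_support_L2[OF measurable_slope[OF uL]])
    show "\<bar>slope u x\<bar> \<le> C" for x using slope_le_Lipschitz_const[OF C] by simp
    show "bounded (closure {x. u x \<noteq> 0})" using bs by (rule bounded_closure)
    show "slope u x = 0" if "x \<notin> closure {x. u x \<noteq> 0}" for x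
      by (rule slope_zero_outside[OF closed_closure that]) (use closure_subset[of "{x. u x \<noteq> 0}"] in auto)
  qed
  show sr: "strong_relaxed u (slope u)"
    unfolding strong_relaxed_def using u2 s2 Lip_bs_Lip_b[OF assms]
    by (intro conjI allI impI exI[of _ u] exI[of _ "slope u"]) auto
  show "u \<in> W12 m" by (rule energy_le_strong_relaxed(1)[OF sr u2])
qed

text \<open>
  The slope of \<open>w\<close> need not be square integrable, so it may fail to be a relaxed gradient of \<open>w\<close>.
  It is one for \<open>w\<close> multiplied by a cutoff, and locality transfers the bound to each ball.
\<close>

lemma grad_norm_le_Lipschitz_const:
  assumes w: "w \<in> W12 m" "w \<in> Lip_b" and C: "0 \<le> C" "\<And>x y. \<bar>w x - w y\<bar> \<le> C * dist x y"
  shows "AE x in m. grad_norm m w x \<le> C"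
proof -
  fix a :: 'a
  define v where "v n x = cutoff a (real n) x * w x" for n x
  have v: "v n \<in> Lip_bs" for n unfolding v_def[abs_def] by (rule Lip_bs_mult[OF cutoff_Lip_bs w(2)])
  have "AE x in m. dist x a < real n \<longrightarrow> grad_norm m w x \<le> C" for n
    using grad_norm_local[OF w(1) Lip_bs_facts(5)[OF v[of n]]]
      grad_norm_le_strong_relaxed[OF Lip_bs_facts(4)[OF v[of n]] Lip_bs_facts(2)[OF v[of n]]]
  proof eventually_elim
    case (elim x)
    show ?case
    proof
      assume x: "dist x a < real n"
      have "\<forall>\<^sub>F y in nhds x. y \<in> ball a (real n)" using x by (intro eventually_nhds_in_open) (auto simp: dist_commute)
      then have ev: "\<forall>\<^sub>F y in nhds x. v n y = w y"
        by eventually_elim (simp add: v_def cutoff_eq_1 dist_commute less_imp_le)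
      have "slope (v n) x = slope w x" by (rule slope_cong_eventually[OF ev])
      also have "\<dots> \<le> C" by (rule slope_le_Lipschitz_const[OF C])
      finally have "slope (v n) x \<le> C" .
      moreover have "v n x = w x" using ev by (rule eventually_nhds_x_imp_x)
      ultimately show "grad_norm m w x \<le> C" using elim by simp
    qed
  qed
  then have "AE x in m. \<forall>n. dist x a < real n \<longrightarrow> grad_norm m w x \<le> C" unfolding AE_all_countable by blast
  then show ?thesis
  proof eventually_elim
    case (elim x)
    obtain n where "dist x a < real n" using reals_Archimedean2 by blast
    with elim show ?case by blast
  qed
qed

end

section \<open>Inner products of gradients\<close>

locale hilbertian_space = mm_space +
  assumes hilb: "infinitesimally_Hilbertian m"

context hilbertian_space
begin

text \<open>
  The polar form of \<open>energy\<close>. Its value at \<open>f\<close> and \<open>g\<close> will turn out to be the integral of the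
  inner product of the gradients.
\<close>

definition form :: "('a \<Rightarrow> real) \<Rightarrow> ('a \<Rightarrow> real) \<Rightarrow> real" where
  "form = (SOME B. (\<forall>f\<in>W12 m. \<forall>g\<in>W12 m. B f g = B g f) \<and>
     (\<forall>f\<in>W12 m. \<forall>g\<in>W12 m. \<forall>h\<in>W12 m. \<forall>a b. B (\<lambda>x. a * f x + b * g x) h = a * B f h + b * B g h) \<and>
     (\<forall>f\<in>W12 m. energy f = B f f))"

lemma form_properties:
  "(\<forall>f\<in>W12 m. \<forall>g\<in>W12 m. form f g = form g f) \<and>
   (\<forall>f\<in>W12 m. \<forall>g\<in>W12 m. \<forall>h\<in>W12 m. \<forall>a b. form (\<lambda>x. a * f x + b * g x) h = a * form f h + b * form g h) \<and>
   (\<forall>f\<in>W12 m. energy f = form f f)"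
proof -
  from hilb obtain B where B: "\<forall>f\<in>W12 m. \<forall>g\<in>W12 m. B f g = B g f"
    "\<forall>f\<in>W12 m. \<forall>g\<in>W12 m. \<forall>h\<in>W12 m. \<forall>a b. B (\<lambda>x. a * f x + b * g x) h = a * B f h + b * B g h"
    "\<forall>f\<in>W12 m. enn2real (Ch m f) = B f f"
    unfolding infinitesimally_Hilbertian_def by blast
  define B' where "B' f g = 2 * B f g" for f g
  show ?thesis
    unfolding form_def
  proof (rule someI[of _ B'], intro conjI)
    show "\<forall>f\<in>W12 m. \<forall>g\<in>W12 m. B' f g = B' g f" using B(1) by (simp add: B'_def)
    show "\<forall>f\<in>W12 m. energy f = B' f f" using B(3) by (simp add: B'_def energy_def)
    show "\<forall>f\<in>W12 m. \<forall>g\<in>W12 m. \<forall>h\<in>W12 m. \<forall>a b. B' (\<lambda>x. a * f x + b * g x) h = a * B' f h + b * B' g h"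
      using B(2) by (simp add: B'_def algebra_simps)
  qed
qed

lemma form_commute: "f \<in> W12 m \<Longrightarrow> g \<in> W12 m \<Longrightarrow> form f g = form g f"
  using form_properties by blast

lemma form_lincomb:
  "f \<in> W12 m \<Longrightarrow> g \<in> W12 m \<Longrightarrow> h \<in> W12 m \<Longrightarrow> form (\<lambda>x. a * f x + b * g x) h = a * form f h + b * form g h"
  using form_properties by blast

lemma form_self: "f \<in> W12 m \<Longrightarrow> form f f = energy f"
  using form_properties by simp

lemma W12_line: "u \<in> W12 m \<Longrightarrow> v \<in> W12 m \<Longrightarrow> (\<lambda>x. u x + e * v x) \<in> W12 m"
  using W12_lincomb[of u v 1 e] by simp

lemma energy_line:
  assumes u: "u \<in> W12 m" and v: "v \<in> W12 m"
  shows "energy (\<lambda>x. u x + e * v x) = energy u + 2 * e * form u v + e\<^sup>2 * energy v"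
proof -
  define w where "w x = 1 * u x + e * v x" for x
  have w: "w \<in> W12 m" unfolding w_def[abs_def] by (rule W12_lincomb[OF u v])
  have "energy w = form w w" using form_self[OF w] by simp
  also have "\<dots> = 1 * form u w + e * form v w"
    using form_lincomb[OF u v w, of 1 e] by (simp add: w_def[abs_def])
  also have "form u w = form u u + e * form u v"
    using form_lincomb[OF u v u, of 1 e] form_commute[OF u w] form_commute[OF u v] by (simp add: w_def[abs_def])
  also have "form v w = form u v + e * form v v"
    using form_lincomb[OF u v v, of 1 e] form_commute[OF v w] form_commute[OF u v] by (simp add: w_def[abs_def])
  finally have "energy w = energy u + 2 * e * form u v + e\<^sup>2 * energy v"
    using form_self[OF u] form_self[OF v] by (simp add: power2_eq_square algebra_simps)
  then show ?thesis by (simp add: w_def[abs_def])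
qed

text \<open>
  Weak lower semicontinuity along sequences of bounded energy, without weak compactness: expand
  \<open>energy (F n + t u)\<close> and use its lower semicontinuity. Dividing by \<open>t\<close> makes the unknown
  energies of \<open>F n\<close> and \<open>p\<close> irrelevant when \<open>t\<close> is large.
\<close>

lemma form_weak_limit:
  assumes u: "u \<in> W12 m" and p: "p \<in> W12 m" and F: "\<And>n. F n \<in> W12 m" "\<And>n. energy (F n) \<le> M"
    and lim: "(\<lambda>n. sqdist m (F n) p) \<longlonglongrightarrow> 0" and e: "0 < e"
  shows "\<forall>\<^sub>F n in sequentially. form u p - e < form u (F n)"
proof -
  have "0 \<le> M" using F(2)[of 0] energy_nonneg[of "F 0"] by linarith
  \<comment> \<open>Large enough for \<open>2 * t * e\<close> to absorb both the energy bound \<open>M\<close> and the loss \<open>1\<close> in the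
      semicontinuity below.\<close>
  define t where "t = (M + 1) / (2 * e)"
  have t: "0 < t" "2 * t * e = M + 1" using e \<open>0 \<le> M\<close> by (auto simp: t_def)
  have W: "(\<lambda>x. F n x + t * u x) \<in> W12 m" for n by (rule W12_line[OF F(1) u])
  have "(\<lambda>n. sqdist m (\<lambda>x. F n x + t * u x) (\<lambda>x. p x + t * u x)) \<longlonglongrightarrow> 0"
    using lim by (simp add: sqdist_def)
  from energy_lsc[OF W12_line[OF p u] W this, of "energy (\<lambda>x. p x + t * u x) - 1"]
  have "\<forall>\<^sub>F n in sequentially. energy (\<lambda>x. p x + t * u x) - 1 < energy (\<lambda>x. F n x + t * u x)" by simp
  then show ?thesis
  proof eventually_elim
    case (elim n)
    then have "energy p + 2 * t * form p u - 1 < energy (F n) + 2 * t * form (F n) u"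
      by (simp add: energy_line[OF p u] energy_line[OF F(1) u])
    then have "2 * t * form p u < 2 * t * form (F n) u + 2 * t * e"
      using F(2)[of n] energy_nonneg[of p] t(2) by linarith
    then have "2 * t * form p u < 2 * t * (form (F n) u + e)" by (simp add: distrib_left)
    then have "form p u < form (F n) u + e" using t(1) by simp
    then show ?case using form_commute[OF p u] form_commute[OF F(1)[of n] u] by simp
  qed
qed

definition grad_quotient :: "('a \<Rightarrow> real) \<Rightarrow> ('a \<Rightarrow> real) \<Rightarrow> real \<Rightarrow> 'a \<Rightarrow> real" where
  "grad_quotient u v e x = ((grad_norm m (\<lambda>y. u y + e * v y) x)\<^sup>2 - (grad_norm m u x)\<^sup>2) / (2 * e)"

text \<open>
  The integral is affine in \<open>e\<close> because the energy is a quadratic form.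
\<close>

lemma grad_quotient_integral:
  assumes u: "u \<in> W12 m" and v: "v \<in> W12 m" and e: "e \<noteq> 0"
  shows "integrable m (grad_quotient u v e)" "(\<integral>x. grad_quotient u v e x \<partial>m) = form u v + e * energy v / 2"
proof -
  note i = L2D(2)[OF grad_norm_L2[OF u]] L2D(2)[OF grad_norm_L2[OF W12_line[OF u v, of e]]]
  show "integrable m (grad_quotient u v e)" unfolding grad_quotient_def[abs_def] using i by simp
  have "(\<integral>x. grad_quotient u v e x \<partial>m) = (energy (\<lambda>y. u y + e * v y) - energy u) / (2 * e)"
    unfolding grad_quotient_def using i grad_norm_W12(2)[OF u] grad_norm_W12(2)[OF W12_line[OF u v, of e]] by simp
  also have "\<dots> = form u v + e * energy v / 2"
    unfolding energy_line[OF u v] using e by (simp add: field_simps power2_eq_square)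
  finally show "(\<integral>x. grad_quotient u v e x \<partial>m) = form u v + e * energy v / 2" .
qed

lemma grad_norm_convex:
  assumes u: "u \<in> W12 m" and v: "v \<in> W12 m" and r: "r1 < r2" "r2 < r3"
  shows "AE x in m. (r3 - r1) * (grad_norm m (\<lambda>y. u y + r2 * v y) x)\<^sup>2
     \<le> (r3 - r2) * (grad_norm m (\<lambda>y. u y + r1 * v y) x)\<^sup>2 + (r2 - r1) * (grad_norm m (\<lambda>y. u y + r3 * v y) x)\<^sup>2"
proof -
  define L where "L r y = u y + r * v y" for r y
  have L: "L r \<in> W12 m" for r unfolding L_def[abs_def] by (rule W12_line[OF u v])
  define a b where "a = (r3 - r2) / (r3 - r1)" "b = (r2 - r1) / (r3 - r1)"
  have ab: "0 \<le> a" "0 \<le> b" "a + b = 1" using r by (simp_all add: a_b_def flip: add_divide_distrib)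
  have "L r2 y = a * L r1 y + b * L r3 y" for y
  proof -
    have "a * r1 + b * r3 = r2"
    proof -
      have "a * r1 + b * r3 = ((r3 - r2) * r1 + (r2 - r1) * r3) / (r3 - r1)" by (simp add: a_b_def add_divide_distrib)
      also have "(r3 - r2) * r1 + (r2 - r1) * r3 = r2 * (r3 - r1)" by algebra
      finally show ?thesis using r by simp
    qed
    moreover have "a * L r1 y + b * L r3 y = (a + b) * u y + (a * r1 + b * r3) * v y" by (simp add: L_def algebra_simps)
    ultimately show ?thesis using ab(3) by (simp add: L_def)
  qed
  then have eq: "L r2 = (\<lambda>y. a * L r1 y + b * L r3 y)" by (rule ext)
  have "AE x in m. (r3 - r1) * (grad_norm m (L r2) x)\<^sup>2 \<le> (r3 - r2) * (grad_norm m (L r1) x)\<^sup>2 + (r2 - r1) * (grad_norm m (L r3) x)\<^sup>2"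
    using grad_norm_lincomb[OF L[of r1] L[of r3], of a b, folded eq] grad_norm_nonneg[OF L[of r2]]
  proof eventually_elim
    case (elim x)
    let ?s = "grad_norm m (L r1) x" and ?t = "grad_norm m (L r3) x"
    have "(grad_norm m (L r2) x)\<^sup>2 \<le> (a * ?s + b * ?t)\<^sup>2"
      using elim ab by (intro power_mono) auto
    also have "\<dots> = a * ?s\<^sup>2 + b * ?t\<^sup>2 - a * b * (?s - ?t)\<^sup>2"
    proof -
      have "b = 1 - a" using ab by simp
      then show ?thesis by algebra
    qed
    also have "\<dots> \<le> a * ?s\<^sup>2 + b * ?t\<^sup>2" using ab by simp
    finally have "(r3 - r1) * (grad_norm m (L r2) x)\<^sup>2 \<le> (r3 - r1) * (a * ?s\<^sup>2 + b * ?t\<^sup>2)"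
      using r by (intro mult_left_mono) auto
    also have "\<dots> = (r3 - r2) * ?s\<^sup>2 + (r2 - r1) * ?t\<^sup>2"
      using r by (simp add: a_b_def distrib_left)
    finally show ?case .
  qed
  then show ?thesis by (simp add: L_def[abs_def])
qed

lemma grad_quotient_mono:
  assumes u: "u \<in> W12 m" and v: "v \<in> W12 m" and st: "s < t" "s \<noteq> 0" "t \<noteq> 0"
  shows "AE x in m. grad_quotient u v s x \<le> grad_quotient u v t x"
proof -
  consider "0 < s" | "t < 0" | "s < 0" "0 < t" using st by linarith
  then show ?thesis
  proof cases
    case 1
    with grad_norm_convex[OF u v, of 0 s t] st have "AE x in m. t * (grad_norm m (\<lambda>y. u y + s * v y) x)\<^sup>2
      \<le> (t - s) * (grad_norm m u x)\<^sup>2 + s * (grad_norm m (\<lambda>y. u y + t * v y) x)\<^sup>2" by simp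
    then show ?thesis
    proof eventually_elim
      case (elim x)
      have "0 < t" using 1 st by simp
      then show ?case using 1 elim by (simp add: grad_quotient_def field_simps)
    qed
  next
    case 2
    with grad_norm_convex[OF u v, of s t 0] st have "AE x in m. (- s) * (grad_norm m (\<lambda>y. u y + t * v y) x)\<^sup>2
      \<le> (- t) * (grad_norm m (\<lambda>y. u y + s * v y) x)\<^sup>2 + (t - s) * (grad_norm m u x)\<^sup>2" by simp
    then show ?thesis
    proof eventually_elim
      case (elim x)
      have "s < 0" using 2 st by simp
      then show ?case using 2 elim by (simp add: grad_quotient_def field_simps)
    qed
  next
    case 3
    with grad_norm_convex[OF u v, of s 0 t] st have "AE x in m. (t - s) * (grad_norm m u x)\<^sup>2
      \<le> t * (grad_norm m (\<lambda>y. u y + s * v y) x)\<^sup>2 + (- s) * (grad_norm m (\<lambda>y. u y + t * v y) x)\<^sup>2" by simp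
    then show ?thesis
      by eventually_elim (use 3 in \<open>simp add: grad_quotient_def field_simps\<close>)
  qed
qed

text \<open>
  By monotonicity the \<open>L\<^sup>1\<close> distance of two quotients is the difference of their integrals.
\<close>

lemma grad_quotient_L1_dist:
  assumes u: "u \<in> W12 m" and v: "v \<in> W12 m" and st: "s \<noteq> 0" "t \<noteq> 0"
  shows "(\<integral>x. \<bar>grad_quotient u v s x - grad_quotient u v t x\<bar> \<partial>m) = \<bar>s - t\<bar> * energy v / 2"
proof -
  have *: "(\<integral>x. \<bar>grad_quotient u v s x - grad_quotient u v t x\<bar> \<partial>m) = \<bar>s - t\<bar> * energy v / 2"
    if "s < t" "s \<noteq> 0" "t \<noteq> 0" for s t
  proof -
    note q = grad_quotient_integral[OF u v that(2)] grad_quotient_integral[OF u v that(3)]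
    have "(\<integral>x. \<bar>grad_quotient u v s x - grad_quotient u v t x\<bar> \<partial>m) = (\<integral>x. grad_quotient u v t x - grad_quotient u v s x \<partial>m)"
      by (rule integral_cong_AE)
        (use q grad_quotient_mono[OF u v that] in \<open>auto elim: eventually_mono\<close>)
    also have "\<dots> = (t - s) * energy v / 2" using q by (simp add: field_simps)
    finally show ?thesis using that by simp
  qed
  consider "s < t" | "t < s" | "s = t" by linarith
  then show ?thesis
  proof cases
    case 2
    from *[OF this st(2,1)] show ?thesis by (simp add: abs_minus_commute)
  qed (use * st in auto)
qed

text \<open>
  The quotients at \<open>1 / (n + 1)\<close> decrease almost everywhere, so they have a limit \<open>H\<close>, and the
  Lipschitz dependence on \<open>e\<close> shows that \<open>H\<close> is the \<open>L\<^sup>1\<close> limit over all \<open>e\<close>. The pointwise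
  convergence along this sequence is recorded because bounds and locality are read off from it.
\<close>

theorem grad_inner_facts:
  assumes u: "u \<in> W12 m" and v: "v \<in> W12 m"
  shows "integrable m (grad_inner m u v)" "(\<integral>x. grad_inner m u v x \<partial>m) = form u v"
    "AE x in m. (\<lambda>n. grad_quotient u v (1 / real (Suc n)) x) \<longlonglongrightarrow> grad_inner m u v x"
proof -
  define e where "e n = 1 / real (Suc n)" for n
  have e: "0 < e n" "e n \<noteq> 0" "e n \<le> 1" for n by (auto simp: e_def field_simps)
  have el: "e \<longlonglongrightarrow> 0" unfolding e_def using LIMSEQ_inverse_real_of_nat by (simp add: inverse_eq_divide)
  note qi = grad_quotient_integral(1)[OF u v]
  have [measurable]: "grad_quotient u v r \<in> borel_measurable m" if "r \<noteq> 0" for r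
    using qi[OF that] by simp
  have [measurable]: "grad_quotient u v (e n) \<in> borel_measurable m" for n
    using qi[OF e(2)] by simp
  define H where "H x = lim (\<lambda>n. grad_quotient u v (e n) x)" for x
  have [measurable]: "H \<in> borel_measurable m" unfolding H_def[abs_def] by measurable
  have dec: "AE x in m. \<forall>n. grad_quotient u v (e (Suc n)) x \<le> grad_quotient u v (e n) x"
    unfolding AE_all_countable by (intro allI grad_quotient_mono u v) (auto simp: e_def field_simps)
  have low: "AE x in m. \<forall>n. grad_quotient u v (-1) x \<le> grad_quotient u v (e n) x"
    unfolding AE_all_countable
  proof
    fix n show "AE x in m. grad_quotient u v (-1) x \<le> grad_quotient u v (e n) x"
      by (rule grad_quotient_mono[OF u v]) (use e[of n] in auto)
  qed
  have conv: "AE x in m. (\<lambda>n. grad_quotient u v (e n) x) \<longlonglongrightarrow> H x \<and>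
      (\<forall>n. \<bar>grad_quotient u v (e n) x\<bar> \<le> \<bar>grad_quotient u v (-1) x\<bar> + \<bar>grad_quotient u v 1 x\<bar>)"
    using dec low
  proof eventually_elim
    case (elim x)
    have d: "decseq (\<lambda>n. grad_quotient u v (e n) x)" using elim(1) by (auto intro: decseq_SucI)
    have "convergent (\<lambda>n. grad_quotient u v (e n) x)"
      by (rule decseq_convergent[OF d, of "grad_quotient u v (-1) x"]) (use elim(2) in \<open>auto intro: convergentI\<close>)
    then have c: "(\<lambda>n. grad_quotient u v (e n) x) \<longlonglongrightarrow> H x" unfolding H_def by (simp add: convergent_LIMSEQ_iff)
    have "grad_quotient u v (e n) x \<le> grad_quotient u v 1 x" for n
      using decseqD[OF d, of 0 n] by (simp add: e_def)
    moreover have "grad_quotient u v (-1) x \<le> grad_quotient u v (e n) x" for n using elim(2) by blast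
    moreover have "\<bar>q\<bar> \<le> \<bar>a\<bar> + \<bar>b\<bar>" if "q \<le> b" "a \<le> q" for a b q :: real using that by linarith
    ultimately have "\<bar>grad_quotient u v (e n) x\<bar> \<le> \<bar>grad_quotient u v (-1) x\<bar> + \<bar>grad_quotient u v 1 x\<bar>" for n
      by blast
    with c show ?case by blast
  qed
  have iw: "integrable m (\<lambda>x. \<bar>grad_quotient u v (-1) x\<bar> + \<bar>grad_quotient u v 1 x\<bar>)" using qi[of "-1"] qi[of 1] by simp
  have cH: "AE x in m. (\<lambda>n. grad_quotient u v (e n) x) \<longlonglongrightarrow> H x"
    using conv by eventually_elim blast
  have cb: "AE x in m. norm (grad_quotient u v (e n) x) \<le> \<bar>grad_quotient u v (-1) x\<bar> + \<bar>grad_quotient u v 1 x\<bar>" for n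
    using conv by eventually_elim simp
  have dc: "integrable m H" "(\<lambda>n. \<integral>x. grad_quotient u v (e n) x \<partial>m) \<longlonglongrightarrow> (\<integral>x. H x \<partial>m)"
    using integrable_dominated_convergence[OF _ _ iw cH cb] integral_dominated_convergence[OF _ _ iw cH cb] by auto
  have IH: "(\<integral>x. H x \<partial>m) = form u v"
  proof (rule LIMSEQ_unique[OF dc(2)])
    have "(\<lambda>n. form u v + e n * energy v / 2) \<longlonglongrightarrow> form u v + 0 * energy v / 2"
      by (intro tendsto_intros el) simp
    then show "(\<lambda>n. \<integral>x. grad_quotient u v (e n) x \<partial>m) \<longlonglongrightarrow> form u v"
      using grad_quotient_integral(2)[OF u v e(2)] by simp
  qed
  have dist: "(\<integral>x. \<bar>grad_quotient u v r x - H x\<bar> \<partial>m) \<le> \<bar>r\<bar> * energy v / 2" if r: "r \<noteq> 0" for r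
  proof -
    have "(\<lambda>n. \<integral>x. \<bar>grad_quotient u v r x - grad_quotient u v (e n) x\<bar> \<partial>m) \<longlonglongrightarrow> (\<integral>x. \<bar>grad_quotient u v r x - H x\<bar> \<partial>m)"
    proof (rule integral_dominated_convergence[where
          w = "\<lambda>x. \<bar>grad_quotient u v r x\<bar> + (\<bar>grad_quotient u v (-1) x\<bar> + \<bar>grad_quotient u v 1 x\<bar>)"])
      show "AE x in m. (\<lambda>n. \<bar>grad_quotient u v r x - grad_quotient u v (e n) x\<bar>) \<longlonglongrightarrow> \<bar>grad_quotient u v r x - H x\<bar>"
        using conv by eventually_elim (auto intro!: tendsto_intros)
      show "AE x in m. norm \<bar>grad_quotient u v r x - grad_quotient u v (e n) x\<bar>
          \<le> \<bar>grad_quotient u v r x\<bar> + (\<bar>grad_quotient u v (-1) x\<bar> + \<bar>grad_quotient u v 1 x\<bar>)" for n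
        using conv
      proof eventually_elim
        case (elim x)
        then have "\<bar>grad_quotient u v (e n) x\<bar> \<le> \<bar>grad_quotient u v (-1) x\<bar> + \<bar>grad_quotient u v 1 x\<bar>" by blast
        then show ?case using abs_triangle_ineq4[of "grad_quotient u v r x" "grad_quotient u v (e n) x"] by simp
      qed
    qed (use iw qi[OF r] r in auto)
    then have "(\<lambda>n. \<bar>r - e n\<bar> * energy v / 2) \<longlonglongrightarrow> (\<integral>x. \<bar>grad_quotient u v r x - H x\<bar> \<partial>m)"
      unfolding grad_quotient_L1_dist[OF u v r e(2)] .
    moreover have "(\<lambda>n. \<bar>r - e n\<bar> * energy v / 2) \<longlonglongrightarrow> \<bar>r - 0\<bar> * energy v / 2"
      by (intro tendsto_intros el) simp
    ultimately have "(\<integral>x. \<bar>grad_quotient u v r x - H x\<bar> \<partial>m) = \<bar>r - 0\<bar> * energy v / 2"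
      by (rule LIMSEQ_unique)
    then show ?thesis by simp
  qed
  have nn: "(\<integral>\<^sup>+x. ennreal \<bar>grad_quotient u v r x - H x\<bar> \<partial>m) = ennreal (\<integral>x. \<bar>grad_quotient u v r x - H x\<bar> \<partial>m)" if "r \<noteq> 0" for r
    by (rule nn_integral_eq_integral) (use qi[OF that] dc(1) in auto)
  have isg: "is_grad_inner m u v H"
    unfolding is_grad_inner_def grad_quotient_def[symmetric]
  proof (intro conjI dc(1))
    show "((\<lambda>r. \<integral>\<^sup>+x. ennreal \<bar>grad_quotient u v r x - H x\<bar> \<partial>m) \<longlongrightarrow> 0) (at 0)"
    proof (rule tendsto_sandwich[OF _ _ tendsto_const])
      show "\<forall>\<^sub>F r in at 0. (\<integral>\<^sup>+x. ennreal \<bar>grad_quotient u v r x - H x\<bar> \<partial>m) \<le> ennreal (\<bar>r\<bar> * energy v / 2)"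
        unfolding eventually_at_filter by (intro always_eventually) (use nn dist in \<open>auto intro: ennreal_leI\<close>)
      have "((\<lambda>r. ennreal (\<bar>r\<bar> * energy v / 2)) \<longlongrightarrow> ennreal (\<bar>0\<bar> * energy v / 2)) (at 0)"
        by (intro tendsto_intros) simp
      then show "((\<lambda>r. ennreal (\<bar>r\<bar> * energy v / 2)) \<longlongrightarrow> 0) (at 0)" by simp
    qed simp
  qed
  then have isg': "is_grad_inner m u v (grad_inner m u v)"
    unfolding grad_inner_def by (rule someI[of "is_grad_inner m u v"])
  \<comment> \<open>The chosen inner product is some \<open>L\<^sup>1\<close> limit, hence equal to \<open>H\<close> almost everywhere.\<close>
  define H' where "H' = grad_inner m u v"
  have H'i: "integrable m H'" using isg' by (simp add: is_grad_inner_def H'_def)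
  have HH: "AE x in m. H x = H' x"
  proof -
    have "((\<lambda>r. (\<integral>\<^sup>+x. ennreal \<bar>grad_quotient u v r x - H x\<bar> \<partial>m) + (\<integral>\<^sup>+x. ennreal \<bar>grad_quotient u v r x - H' x\<bar> \<partial>m)) \<longlongrightarrow> 0 + 0) (at 0)"
      using isg isg' unfolding is_grad_inner_def grad_quotient_def[symmetric] H'_def by (intro tendsto_add) auto
    moreover have "\<forall>\<^sub>F r in at 0. (\<integral>\<^sup>+x. ennreal \<bar>H x - H' x\<bar> \<partial>m)
        \<le> (\<integral>\<^sup>+x. ennreal \<bar>grad_quotient u v r x - H x\<bar> \<partial>m) + (\<integral>\<^sup>+x. ennreal \<bar>grad_quotient u v r x - H' x\<bar> \<partial>m)"
      unfolding eventually_at_filter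
    proof (intro always_eventually allI impI)
      fix r :: real assume r: "r \<noteq> 0"
      have [measurable]: "H' \<in> borel_measurable m" "grad_quotient u v r \<in> borel_measurable m" using H'i qi[OF r] by auto
      have "(\<integral>\<^sup>+x. ennreal \<bar>H x - H' x\<bar> \<partial>m) \<le> (\<integral>\<^sup>+x. ennreal \<bar>grad_quotient u v r x - H x\<bar> + ennreal \<bar>grad_quotient u v r x - H' x\<bar> \<partial>m)"
        by (intro nn_integral_mono) (simp flip: ennreal_plus add: ennreal_leI)
      also have "\<dots> = (\<integral>\<^sup>+x. ennreal \<bar>grad_quotient u v r x - H x\<bar> \<partial>m) + (\<integral>\<^sup>+x. ennreal \<bar>grad_quotient u v r x - H' x\<bar> \<partial>m)"
        by (rule nn_integral_add) measurable
      finally show "(\<integral>\<^sup>+x. ennreal \<bar>H x - H' x\<bar> \<partial>m)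
        \<le> (\<integral>\<^sup>+x. ennreal \<bar>grad_quotient u v r x - H x\<bar> \<partial>m) + (\<integral>\<^sup>+x. ennreal \<bar>grad_quotient u v r x - H' x\<bar> \<partial>m)" .
    qed
    ultimately have "(\<integral>\<^sup>+x. ennreal \<bar>H x - H' x\<bar> \<partial>m) \<le> 0 + 0"
      by (intro tendsto_lowerbound) auto
    then have "(\<integral>\<^sup>+x. ennreal \<bar>H x - H' x\<bar> \<partial>m) = 0" by simp
    then have "AE x in m. ennreal \<bar>H x - H' x\<bar> = 0"
      using H'i by (subst (asm) nn_integral_0_iff_AE) auto
    then show ?thesis by eventually_elim (simp add: ennreal_eq_0_iff)
  qed
  show "integrable m (grad_inner m u v)" using H'i by (simp add: H'_def)
  show "(\<integral>x. grad_inner m u v x \<partial>m) = form u v"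
    using integral_cong_AE[OF _ _ HH] dc(1) H'i IH by (simp add: H'_def)
  show "AE x in m. (\<lambda>n. grad_quotient u v (1 / real (Suc n)) x) \<longlonglongrightarrow> grad_inner m u v x"
    using conv HH by eventually_elim (simp add: H'_def e_def)
qed

end

section \<open>The measure-valued Laplacian\<close>

text \<open>
  An inequality between signed measures, written with one sum on each side so that all terms are
  nonnegative and the usual induction over measurable functions applies.
\<close>

lemma nn_integral_add_measures_mono:
  fixes M N P Q :: "'b measure"
  assumes s: "sets N = sets M" "sets P = sets M" "sets Q = sets M"
    and le: "\<And>S. S \<in> sets M \<Longrightarrow> emeasure N S + emeasure P S \<le> emeasure M S + emeasure Q S"
    and u: "u \<in> borel_measurable M"
  shows "(\<integral>\<^sup>+x. u x \<partial>N) + (\<integral>\<^sup>+x. u x \<partial>P) \<le> (\<integral>\<^sup>+x. u x \<partial>M) + (\<integral>\<^sup>+x. u x \<partial>Q)"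
  using u
proof (induction u rule: borel_measurable_induct)
  case (cong f g)
  have sp: "space N = space M" "space P = space M" "space Q = space M"
    using s by (auto dest: sets_eq_imp_space_eq)
  have "(\<integral>\<^sup>+x. f x \<partial>L) = (\<integral>\<^sup>+x. g x \<partial>L)" if "space L = space M" for L
    by (rule nn_integral_cong) (use cong that in auto)
  then show ?case using cong sp by metis
next
  case (set A)
  then show ?case using le[OF set] s by simp
next
  case (mult u c)
  have "u \<in> borel_measurable N" "u \<in> borel_measurable P" "u \<in> borel_measurable Q"
    using mult s measurable_cong_sets by blast+
  then show ?case
    using mult by (simp add: nn_integral_cmult mult_left_mono flip: distrib_left)
next
  case (add u v)
  have m: "u \<in> borel_measurable N" "u \<in> borel_measurable P" "u \<in> borel_measurable Q"
     "v \<in> borel_measurable N" "v \<in> borel_measurable P" "v \<in> borel_measurable Q"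
    using add s measurable_cong_sets by blast+
  have "a + b + (c + d) \<le> a' + b' + (c' + d')" if "a + c \<le> a' + c'" "b + d \<le> b' + d'" for a b c d a' b' c' d' :: ennreal
    using add_mono[OF that] by (simp add: ac_simps)
  then show ?case using add m by (simp add: nn_integral_add)
next
  case (seq U)
  have m: "U i \<in> borel_measurable N" "U i \<in> borel_measurable P" "U i \<in> borel_measurable Q" for i
    using seq s measurable_cong_sets by blast+
  have eq: "(\<integral>\<^sup>+x. (SUP i. U i) x \<partial>L) = (SUP i. \<integral>\<^sup>+x. U i x \<partial>L)" if "\<And>i. U i \<in> borel_measurable L" for L :: "'b measure"
    using nn_integral_monotone_convergence_SUP[OF \<open>incseq U\<close> that] by (simp add: image_comp)
  have inc: "incseq (\<lambda>i. \<integral>\<^sup>+x. U i x \<partial>L)" for L :: "'b measure"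
    using \<open>incseq U\<close> by (auto simp: incseq_def le_fun_def intro!: nn_integral_mono)
  have "(SUP i. \<integral>\<^sup>+x. U i x \<partial>N) + (SUP i. \<integral>\<^sup>+x. U i x \<partial>P) = (SUP i. (\<integral>\<^sup>+x. U i x \<partial>N) + (\<integral>\<^sup>+x. U i x \<partial>P))"
    by (rule ennreal_SUP_add[OF inc inc, symmetric])
  also have "\<dots> \<le> (SUP i. (\<integral>\<^sup>+x. U i x \<partial>M) + (\<integral>\<^sup>+x. U i x \<partial>Q))"
    by (rule SUP_mono) (use seq.IH in auto)
  also have "\<dots> = (SUP i. \<integral>\<^sup>+x. U i x \<partial>M) + (SUP i. \<integral>\<^sup>+x. U i x \<partial>Q)"
    by (rule ennreal_SUP_add[OF inc inc])
  finally show ?case unfolding eq[OF seq(1)] eq[OF m(1)] eq[OF m(2)] eq[OF m(3)] .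
qed

context mm_space
begin

text \<open>
  The decomposition is known only on bounded Borel sets, and both parts of \<open>\<mu>\<close> may be infinite.
  Restricted to the support \<open>A\<close> of \<open>g\<close>, all measures are finite, and nonnegativity of the singular
  part reads \<open>\<mu>\<^sub>2 + h\<^sup>+ m \<le> \<mu>\<^sub>1 + h\<^sup>- m\<close>.
\<close>

lemma Lebesgue_decomposition_integral_le:
  assumes dec: "Lebesgue_decomposition m \<mu> h \<sigma>" and pos: "smeasure_nonneg \<sigma>" and \<mu>: "signed_radon_measure \<mu>"
    and g: "g \<in> Lip_bs" "\<And>x. 0 \<le> g x"
  shows "integrable m (\<lambda>x. g x * h x)" "(\<integral>x. g x * h x \<partial>m) \<le> sintegral \<mu> g"
proof -
  define M N where "M = fst \<mu>" "N = snd \<mu>"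
  have MN: "sets M = sets borel" "sets N = sets borel"
    and fin: "\<And>K. compact K \<Longrightarrow> emeasure M K < \<infinity>" "\<And>K. compact K \<Longrightarrow> emeasure N K < \<infinity>"
    using \<mu> by (auto simp: signed_radon_measure_def radon_measure_def M_N_def)
  have hm [measurable]: "h \<in> borel_measurable borel"
    using dec by (simp add: Lebesgue_decomposition_def borel_measurable_m)
  have gL: "g \<in> Lip" using g(1) by (simp add: Lip_bs_def)
  have gm [measurable]: "g \<in> borel_measurable borel"
    by (rule borel_measurable_continuous_onI[OF continuous_Lip[OF gL]])
  obtain C where C: "\<And>x. \<bar>g x\<bar> \<le> C" by (rule Lip_b_bound[OF Lip_bs_Lip_b[OF g(1)]]) blast
  define A where "A = closure {x. g x \<noteq> 0}"
  have bA: "bounded A" unfolding A_def using g(1) by (intro bounded_closure) (simp add: Lip_bs_def)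
  have cA: "compact A" using bA by (simp add: compact_eq_bounded_closed A_def)
  have A [measurable]: "A \<in> sets borel" unfolding A_def by simp
  have gA: "g x = 0" if "x \<notin> A" for x using that closure_subset[of "{x. g x \<noteq> 0}"] by (auto simp: A_def)
  have bd: "set_integrable m S h" "smeasure \<mu> S \<ge> (LINT x:S|m. h x)" if "S \<in> sets borel" "bounded S" for S
    using dec pos that by (auto simp: Lebesgue_decomposition_def smeasure_nonneg_def)
  have iA: "integrable m (\<lambda>x. indicator A x * h x)"
    using bd(1)[OF A bA] by (simp add: set_integrable_def)
  show igh: "integrable m (\<lambda>x. g x * h x)"
  proof (rule Bochner_Integration.integrable_bound[OF integrable_mult_right[OF iA, of C]])
    show "(\<lambda>x. g x * h x) \<in> borel_measurable m" by measurable
    have "\<bar>g x * h x\<bar> \<le> \<bar>C * (indicator A x * h x)\<bar>" for x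
      using gA[of x] mult_right_mono[OF order_trans[OF C abs_ge_self], of "\<bar>h x\<bar>" x]
      by (cases "x \<in> A") (auto simp: abs_mult)
    then show "AE x in m. norm (g x * h x) \<le> norm (C * (indicator A x * h x))" by simp
  qed
  have ig: "integrable L g" if "sets L = sets borel" "emeasure L A < \<infinity>" for L
  proof (rule Bochner_Integration.integrable_bound)
    show "integrable L (\<lambda>x. C * indicator A x)"
      by (intro integrable_mult_right integrable_real_indicator) (use that in auto)
    show "g \<in> borel_measurable L" using that(1) gm measurable_cong_sets by blast
    have "\<bar>g x\<bar> \<le> \<bar>C * indicator A x\<bar>" for x using gA[of x] C[of x] by (cases "x \<in> A") auto
    then show "AE x in L. norm (g x) \<le> norm (C * indicator A x)" by simp
  qed
  define P Q where "P x = indicator A x * max 0 (h x)" "Q x = indicator A x * max 0 (- h x)" for x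
  have PQ0: "0 \<le> P x" "0 \<le> Q x" for x by (auto simp: P_Q_def)
  have PQh: "P x - Q x = indicator A x * h x" for x by (auto simp: P_Q_def indicator_def)
  have [measurable]: "P \<in> borel_measurable borel" "Q \<in> borel_measurable borel"
    unfolding P_Q_def[abs_def] by measurable
  have bPQ: "\<bar>P x\<bar> \<le> \<bar>indicator A x * h x\<bar>" "\<bar>Q x\<bar> \<le> \<bar>indicator A x * h x\<bar>" for x
    by (auto simp: P_Q_def indicator_def)
  have iP: "integrable m P" by (rule Bochner_Integration.integrable_bound[OF iA]) (use bPQ in auto)
  have iQ: "integrable m Q" by (rule Bochner_Integration.integrable_bound[OF iA]) (use bPQ in auto)
  have iS: "integrable m (\<lambda>x. P x * indicator S x)" "integrable m (\<lambda>x. Q x * indicator S x)" if "S \<in> sets borel" for S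
    using integrable_real_mult_indicator[OF _ iP, of S] integrable_real_mult_indicator[OF _ iQ, of S] that by auto
  have dMN: "emeasure (density L (indicator A)) S = ennreal (measure L (S \<inter> A))"
    if "sets L = sets borel" "emeasure L A < \<infinity>" "S \<in> sets borel" for L S
  proof -
    have "emeasure (density L (indicator A)) S = (\<integral>\<^sup>+x. indicator A x * indicator S x \<partial>L)"
      by (rule emeasure_density) (use that in auto)
    also have "\<dots> = (\<integral>\<^sup>+x. indicator (S \<inter> A) x \<partial>L)" by (rule nn_integral_cong) (auto simp: indicator_def)
    also have "\<dots> = emeasure L (S \<inter> A)" by (rule nn_integral_indicator) (use that A in auto)
    also have "\<dots> = ennreal (measure L (S \<inter> A))"
    proof (rule emeasure_eq_ennreal_measure)
      have "emeasure L (S \<inter> A) \<le> emeasure L A" by (rule emeasure_mono) (use that A in auto)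
      then show "emeasure L (S \<inter> A) \<noteq> top" using that(2) by (auto simp: top_unique)
    qed
    finally show ?thesis .
  qed
  have dPQ: "emeasure (density m (\<lambda>x. ennreal (R x))) S = ennreal (\<integral>x. R x * indicator S x \<partial>m)"
    if "R \<in> borel_measurable borel" "\<And>x. 0 \<le> R x" "S \<in> sets borel" "integrable m (\<lambda>x. R x * indicator S x)" for R S
  proof -
    have "emeasure (density m (\<lambda>x. ennreal (R x))) S = (\<integral>\<^sup>+x. ennreal (R x) * indicator S x \<partial>m)"
      by (rule emeasure_density) (use that in \<open>auto simp: borel_measurable_m\<close>)
    also have "\<dots> = (\<integral>\<^sup>+x. ennreal (R x * indicator S x) \<partial>m)" by (rule nn_integral_cong) (simp add: indicator_def)
    also have "\<dots> = ennreal (\<integral>x. R x * indicator S x \<partial>m)"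
      by (rule nn_integral_eq_integral) (use that in auto)
    finally show ?thesis .
  qed
  have finA: "emeasure M A < \<infinity>" "emeasure N A < \<infinity>" by (rule fin[OF cA])+
  have key: "(\<integral>\<^sup>+x. ennreal (g x) \<partial>density N (indicator A)) + (\<integral>\<^sup>+x. ennreal (g x) \<partial>density m (\<lambda>x. ennreal (P x)))
      \<le> (\<integral>\<^sup>+x. ennreal (g x) \<partial>density M (indicator A)) + (\<integral>\<^sup>+x. ennreal (g x) \<partial>density m (\<lambda>x. ennreal (Q x)))"
  proof (rule nn_integral_add_measures_mono)
    fix S assume "S \<in> sets (density M (indicator A))"
    then have S: "S \<in> sets borel" using MN by simp
    have bS: "bounded (S \<inter> A)" using bA bounded_subset by blast
    have "(LINT x:S \<inter> A|m. h x) = (\<integral>x. P x * indicator S x - Q x * indicator S x \<partial>m)"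
      unfolding set_lebesgue_integral_def
      by (rule Bochner_Integration.integral_cong) (auto simp: left_diff_distrib[symmetric] PQh indicator_def)
    also have "\<dots> = (\<integral>x. P x * indicator S x \<partial>m) - (\<integral>x. Q x * indicator S x \<partial>m)"
      by (rule Bochner_Integration.integral_diff[OF iS[OF S]])
    finally have "measure N (S \<inter> A) + (\<integral>x. P x * indicator S x \<partial>m) \<le> measure M (S \<inter> A) + (\<integral>x. Q x * indicator S x \<partial>m)"
      using bd(2)[of "S \<inter> A"] S A bS by (simp add: smeasure_def M_N_def)
    moreover have "0 \<le> (\<integral>x. P x * indicator S x \<partial>m)" "0 \<le> (\<integral>x. Q x * indicator S x \<partial>m)"
      using PQ0 by (auto intro!: integral_nonneg_AE)
    ultimately show "emeasure (density N (indicator A)) S + emeasure (density m (\<lambda>x. ennreal (P x))) S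
        \<le> emeasure (density M (indicator A)) S + emeasure (density m (\<lambda>x. ennreal (Q x))) S"
      using MN finA S iS[OF S] PQ0 by (simp add: dMN dPQ ennreal_leI flip: ennreal_plus)
  next
    have "(\<lambda>x. ennreal (g x)) \<in> borel_measurable borel" by measurable
    moreover have "sets (density M (indicator A)) = sets borel" using MN by simp
    ultimately show "(\<lambda>x. ennreal (g x)) \<in> borel_measurable (density M (indicator A))"
      using measurable_cong_sets by blast
  qed (simp_all add: MN)
  have nMN: "(\<integral>\<^sup>+x. ennreal (g x) \<partial>density L (indicator A)) = ennreal (\<integral>x. g x \<partial>L)"
    if "sets L = sets borel" "emeasure L A < \<infinity>" for L
  proof -
    have "(\<lambda>x. ennreal (g x)) \<in> borel_measurable borel" by measurable
    then have gL: "(\<lambda>x. ennreal (g x)) \<in> borel_measurable L" using that(1) measurable_cong_sets by blast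
    have "(\<integral>\<^sup>+x. ennreal (g x) \<partial>density L (indicator A)) = (\<integral>\<^sup>+x. indicator A x * ennreal (g x) \<partial>L)"
      by (rule nn_integral_density) (use that gL in auto)
    also have "\<dots> = (\<integral>\<^sup>+x. ennreal (g x) \<partial>L)" by (rule nn_integral_cong) (use gA in \<open>auto simp: indicator_def\<close>)
    also have "\<dots> = ennreal (\<integral>x. g x \<partial>L)" by (rule nn_integral_eq_integral[OF ig[OF that]]) (use g(2) in auto)
    finally show ?thesis .
  qed
  have igR: "integrable m (\<lambda>x. R x * g x)" if "integrable m R" for R
  proof (rule Bochner_Integration.integrable_bound[OF integrable_mult_right[OF that, of C]])
    show "(\<lambda>x. R x * g x) \<in> borel_measurable m" using that by measurable
    have "\<bar>R x\<bar> * \<bar>g x\<bar> \<le> \<bar>R x\<bar> * \<bar>C\<bar>" for x using C[of x] by (intro mult_left_mono) auto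
    then show "AE x in m. norm (R x * g x) \<le> norm (C * R x)" by (auto simp: abs_mult mult.commute)
  qed
  have nPQ: "(\<integral>\<^sup>+x. ennreal (g x) \<partial>density m (\<lambda>x. ennreal (R x))) = ennreal (\<integral>x. R x * g x \<partial>m)"
    if "integrable m R" "\<And>x. 0 \<le> R x" for R
  proof -
    have "(\<integral>\<^sup>+x. ennreal (g x) \<partial>density m (\<lambda>x. ennreal (R x))) = (\<integral>\<^sup>+x. ennreal (R x) * ennreal (g x) \<partial>m)"
      by (rule nn_integral_density) (use that in auto)
    also have "\<dots> = (\<integral>\<^sup>+x. ennreal (R x * g x) \<partial>m)" using that(2) by (simp add: ennreal_mult' )
    also have "\<dots> = ennreal (\<integral>x. R x * g x \<partial>m)"
      by (rule nn_integral_eq_integral[OF igR[OF that(1)]]) (use g(2) that(2) in auto)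
    finally show ?thesis .
  qed
  have i0: "0 \<le> (\<integral>x. g x \<partial>L)" for L using g(2) by (auto intro!: integral_nonneg_AE)
  have i1: "0 \<le> (\<integral>x. P x * g x \<partial>m)" "0 \<le> (\<integral>x. Q x * g x \<partial>m)" using g(2) PQ0 by (auto intro!: integral_nonneg_AE)
  have "(\<integral>x. g x \<partial>N) + (\<integral>x. P x * g x \<partial>m) \<le> (\<integral>x. g x \<partial>M) + (\<integral>x. Q x * g x \<partial>m)"
    using key MN finA iP iQ PQ0 i0 i1 by (simp add: nMN nPQ flip: ennreal_plus)
  moreover have "(\<integral>x. g x * h x \<partial>m) = (\<integral>x. P x * g x \<partial>m) - (\<integral>x. Q x * g x \<partial>m)"
  proof -
    have "g x * h x = P x * g x - Q x * g x" for x
      using gA[of x] PQh[of x] by (cases "x \<in> A") (simp_all flip: left_diff_distrib)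
    then show ?thesis using igR[OF iP] igR[OF iQ] by simp
  qed
  ultimately show "(\<integral>x. g x * h x \<partial>m) \<le> sintegral \<mu> g"
    by (simp add: sintegral_def M_N_def)
qed

end

context hilbertian_space
begin

text \<open>
  Both bounds come from \<open>|\<nabla>(u + e v)|\<close> lying within \<open>e |\<nabla>v|\<close> of \<open>|\<nabla>u|\<close>, with positive \<open>e\<close> only.
\<close>

lemma grad_inner_bound:
  assumes u: "u \<in> W12 m" and v: "v \<in> W12 m"
  shows "AE x in m. \<bar>grad_inner m u v x\<bar> \<le> grad_norm m u x * grad_norm m v x"
proof -
  define e where "e n = 1 / real (Suc n)" for n
  have e: "0 < e n" for n by (simp add: e_def)
  have el: "e \<longlonglongrightarrow> 0" unfolding e_def using LIMSEQ_inverse_real_of_nat by (simp add: inverse_eq_divide)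
  have q: "AE x in m. - (grad_norm m u x * grad_norm m v x) \<le> grad_quotient u v (e n) x \<and>
      grad_quotient u v (e n) x \<le> grad_norm m u x * grad_norm m v x + e n * (grad_norm m v x)\<^sup>2 / 2" for n
  proof -
    define L where "L y = u y + e n * v y" for y
    have L: "L \<in> W12 m" unfolding L_def[abs_def] by (rule W12_line[OF u v])
    have eq: "L = (\<lambda>x. 1 * u x + e n * v x)" "u = (\<lambda>x. 1 * L x + (- e n) * v x)"
      by (auto simp: L_def fun_eq_iff)
    show ?thesis
      using grad_norm_lincomb[OF u v, of 1 "e n", folded eq(1)] grad_norm_lincomb[OF L v, of 1 "- e n", folded eq(2)]
        grad_norm_nonneg[OF u] grad_norm_nonneg[OF v] grad_norm_nonneg[OF L]
    proof eventually_elim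
      case (elim x)
      define a b c where "a = grad_norm m L x" "b = grad_norm m u x" "c = grad_norm m v x"
      have h: "a \<le> b + e n * c" "b \<le> a + e n * c" "0 \<le> a" "0 \<le> b" "0 \<le> c"
        using elim e[of n] by (auto simp: a_b_c_def)
      have 1: "a\<^sup>2 - b\<^sup>2 \<le> 2 * e n * (b * c + e n * c\<^sup>2 / 2)"
      proof -
        have "a\<^sup>2 \<le> (b + e n * c)\<^sup>2" using h by (intro power_mono) auto
        also have "\<dots> = b\<^sup>2 + 2 * e n * (b * c + e n * c\<^sup>2 / 2)"
          by (simp add: power2_eq_square algebra_simps)
        finally show ?thesis by simp
      qed
      have 2: "- (2 * e n * (b * c)) \<le> a\<^sup>2 - b\<^sup>2"
      proof -
        have "b\<^sup>2 - a\<^sup>2 = (b - a) * (b + a)" by algebra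
        show ?thesis
        proof (cases "a \<le> b")
          case True
          have "(b - a) * (b + a) \<le> (e n * c) * (2 * b)"
            using h True e[of n] by (intro mult_mono) auto
          then show ?thesis using \<open>b\<^sup>2 - a\<^sup>2 = (b - a) * (b + a)\<close> by (simp add: algebra_simps)
        next
          case False
          then have "b\<^sup>2 \<le> a\<^sup>2" using h by (intro power_mono) auto
          moreover have "0 \<le> 2 * e n * (b * c)" using h e[of n] by (simp add: less_imp_le)
          ultimately show ?thesis by linarith
        qed
      qed
      have "grad_quotient u v (e n) x = (a\<^sup>2 - b\<^sup>2) / (2 * e n)"
        by (simp add: grad_quotient_def a_b_c_def L_def[abs_def])
      then have "a\<^sup>2 - b\<^sup>2 = 2 * e n * grad_quotient u v (e n) x" using e[of n] by simp
      with 1 2 have "2 * e n * (- (b * c)) \<le> 2 * e n * grad_quotient u v (e n) x"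
        "2 * e n * grad_quotient u v (e n) x \<le> 2 * e n * (b * c + e n * c\<^sup>2 / 2)" by auto
      then have "- (b * c) \<le> grad_quotient u v (e n) x" "grad_quotient u v (e n) x \<le> b * c + e n * c\<^sup>2 / 2"
        using e[of n] by (simp_all only: mult_le_cancel_left_pos zero_less_mult_iff zero_less_numeral simp_thms)
      then show ?case by (simp add: a_b_c_def)
    qed
  qed
  then have "AE x in m. \<forall>n. - (grad_norm m u x * grad_norm m v x) \<le> grad_quotient u v (e n) x \<and>
      grad_quotient u v (e n) x \<le> grad_norm m u x * grad_norm m v x + e n * (grad_norm m v x)\<^sup>2 / 2"
    unfolding AE_all_countable by blast
  with grad_inner_facts(3)[OF u v] show ?thesis
  proof eventually_elim
    case (elim x)
    have l: "(\<lambda>n. grad_quotient u v (e n) x) \<longlonglongrightarrow> grad_inner m u v x" using elim(1) by (simp add: e_def)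
    have 1: "- (grad_norm m u x * grad_norm m v x) \<le> grad_inner m u v x"
      using elim(2) by (intro LIMSEQ_le_const[OF l]) auto
    have "(\<lambda>n. grad_norm m u x * grad_norm m v x + e n * (grad_norm m v x)\<^sup>2 / 2)
        \<longlonglongrightarrow> grad_norm m u x * grad_norm m v x + 0 * (grad_norm m v x)\<^sup>2 / 2"
      by (intro tendsto_intros el) simp
    then have "grad_inner m u v x \<le> grad_norm m u x * grad_norm m v x + 0 * (grad_norm m v x)\<^sup>2 / 2"
      using elim(2) by (intro LIMSEQ_le[OF l]) auto
    with 1 show ?case by (simp add: abs_le_iff)
  qed
qed

lemma grad_inner_local:
  assumes u: "u \<in> W12 m" and v: "v \<in> W12 m" and u': "u' \<in> W12 m" and v': "v' \<in> W12 m"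
  shows "AE x in m. u x = u' x \<and> v x = v' x \<longrightarrow> grad_inner m u v x = grad_inner m u' v' x"
proof -
  have "AE x in m. u x = u' x \<and> v x = v' x \<longrightarrow> grad_quotient u v (1 / real (Suc n)) x = grad_quotient u' v' (1 / real (Suc n)) x" for n
    using grad_norm_local[OF W12_line[OF u v, of "1 / real (Suc n)"] W12_line[OF u' v', of "1 / real (Suc n)"]]
      grad_norm_local[OF u u']
    by eventually_elim (simp add: grad_quotient_def)
  then have "AE x in m. \<forall>n. u x = u' x \<and> v x = v' x \<longrightarrow> grad_quotient u v (1 / real (Suc n)) x = grad_quotient u' v' (1 / real (Suc n)) x"
    unfolding AE_all_countable by blast
  with grad_inner_facts(3)[OF u v] grad_inner_facts(3)[OF u' v'] show ?thesis
  proof eventually_elim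
    case (elim x)
    show ?case
    proof
      assume "u x = u' x \<and> v x = v' x"
      with elim(3) have "(\<lambda>n. grad_quotient u v (1 / real (Suc n)) x) = (\<lambda>n. grad_quotient u' v' (1 / real (Suc n)) x)" by auto
      with elim(1,2) show "grad_inner m u v x = grad_inner m u' v' x" by (simp add: LIMSEQ_unique)
    qed
  qed
qed

text \<open>
  By locality the global inner product satisfies the defining property of the local one, and on
  the balls where a cutoff is \<open>1\<close> any function with this property agrees with it.
\<close>

lemma integral_grad_inner_loc:
  assumes f: "f \<in> W12 m" "f \<in> W12_loc m" and g: "g \<in> Lip_bs"
  shows "(\<integral>x. grad_inner_loc m f g x \<partial>m) = form f g"
proof -
  note gW = Lip_bs_facts(5)[OF g]
  have loc: "AE x in m. \<eta> x = 1 \<longrightarrow> grad_inner m f g x = grad_inner m (\<lambda>y. \<eta> y * f y) (\<lambda>y. \<eta> y * g y) x"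
    if \<eta>: "\<eta> \<in> Lip_bs" for \<eta>
  proof -
    have "(\<lambda>y. \<eta> y * f y) \<in> W12 m" using f(2) \<eta> by (simp add: W12_loc_def)
    moreover have "(\<lambda>y. \<eta> y * g y) \<in> W12 m" by (rule Lip_bs_facts(5)[OF Lip_bs_mult[OF \<eta> Lip_bs_Lip_b[OF g]]])
    ultimately have "AE x in m. f x = \<eta> x * f x \<and> g x = \<eta> x * g x \<longrightarrow>
        grad_inner m f g x = grad_inner m (\<lambda>y. \<eta> y * f y) (\<lambda>y. \<eta> y * g y) x"
      by (rule grad_inner_local[OF f(1) gW])
    then show ?thesis by eventually_elim simp
  qed
  have gm: "grad_inner m f g \<in> borel_measurable m" using grad_inner_facts(1)[OF f(1) gW] by simp
  have "is_grad_inner_loc m f g (grad_inner m f g)"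
    unfolding is_grad_inner_loc_def using gm loc by blast
  then have L: "is_grad_inner_loc m f g (grad_inner_loc m f g)"
    unfolding grad_inner_loc_def by (rule someI[of "is_grad_inner_loc m f g"])
  then have Lm: "grad_inner_loc m f g \<in> borel_measurable m" by (simp add: is_grad_inner_loc_def)
  fix a :: 'a
  have "AE x in m. cutoff a (real n) x = 1 \<longrightarrow> grad_inner_loc m f g x = grad_inner m f g x" for n
  proof -
    have "AE x in m. cutoff a (real n) x = 1 \<longrightarrow>
        grad_inner_loc m f g x = grad_inner m (\<lambda>y. cutoff a (real n) y * f y) (\<lambda>y. cutoff a (real n) y * g y) x"
      using L cutoff_Lip_bs[of a "real n"] unfolding is_grad_inner_loc_def by blast
    with loc[OF cutoff_Lip_bs[of a "real n"]] show ?thesis by eventually_elim simp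
  qed
  then have "AE x in m. \<forall>n. cutoff a (real n) x = 1 \<longrightarrow> grad_inner_loc m f g x = grad_inner m f g x"
    unfolding AE_all_countable by blast
  then have "AE x in m. grad_inner_loc m f g x = grad_inner m f g x"
  proof eventually_elim
    case (elim x)
    obtain n where "dist x a \<le> real n" using real_arch_simple by blast
    then show ?case using elim cutoff_eq_1 by blast
  qed
  then have "(\<integral>x. grad_inner_loc m f g x \<partial>m) = (\<integral>x. grad_inner m f g x \<partial>m)"
    by (rule integral_cong_AE[OF Lm gm])
  then show ?thesis using grad_inner_facts(2)[OF f(1) gW] by simp
qed

end

section \<open>Test functions built from a truncation\<close>

definition excess :: "real \<Rightarrow> real \<Rightarrow> real" where
  "excess c s = max 0 (s - c)"

text \<open>
  With \<open>r\<close> the positive part of \<open>s - c\<close> this is \<open>r\<^sup>2 / (1 + r\<^sup>2)\<close>. It is continuously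
  differentiable, unlike \<open>r\<close> itself, and bounded with bounded derivative, unlike \<open>r\<^sup>2\<close>.
\<close>

definition test_fun :: "real \<Rightarrow> real \<Rightarrow> real" where
  "test_fun c s = 1 - 1 / (1 + (excess c s)\<^sup>2)"

definition test_fun' :: "real \<Rightarrow> real \<Rightarrow> real" where
  "test_fun' c s = 2 * excess c s / (1 + (excess c s)\<^sup>2)\<^sup>2"

lemma DERIV_square_pos_part:
  "((\<lambda>s. (max 0 (s - c))\<^sup>2) has_real_derivative 2 * max 0 (s - c)) (at (s::real))"
proof -
  consider "s < c" | "c < s" | "s = c" by linarith
  then show ?thesis
  proof cases
    case 1
    have "((\<lambda>s. 0) has_real_derivative 0) (at s)" by simp
    moreover have "\<forall>\<^sub>F t in nhds s. 0 = (max 0 (t - c))\<^sup>2"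
      using eventually_nhds_in_open[of "{..<c}" s] 1 by (auto elim: eventually_mono)
    ultimately show ?thesis using 1 by (subst (asm) DERIV_cong_ev[OF refl _ refl]) auto
  next
    case 2
    have "((\<lambda>s. (s - c)\<^sup>2) has_real_derivative 2 * (s - c)) (at s)"
      by (auto intro!: derivative_eq_intros)
    moreover have "\<forall>\<^sub>F t in nhds s. (t - c)\<^sup>2 = (max 0 (t - c))\<^sup>2"
      using eventually_nhds_in_open[of "{c<..}" s] 2 by (auto elim: eventually_mono)
    ultimately show ?thesis using 2 by (subst (asm) DERIV_cong_ev[OF refl _ refl]) auto
  next
    case 3
    have "((\<lambda>t. ((max 0 (t - c))\<^sup>2 - (max 0 (c - c))\<^sup>2) / (t - c)) \<longlongrightarrow> 0) (at c)"
    proof (rule Lim_null_comparison)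
      show "\<forall>\<^sub>F t in at c. norm (((max 0 (t - c))\<^sup>2 - (max 0 (c - c))\<^sup>2) / (t - c)) \<le> \<bar>t - c\<bar>"
        by (rule always_eventually) (auto simp: max_def power2_eq_square)
      have "((\<lambda>t. \<bar>t - c\<bar>) \<longlongrightarrow> \<bar>c - c\<bar>) (at c)" by (intro tendsto_intros)
      then show "((\<lambda>t. \<bar>t - c\<bar>) \<longlongrightarrow> 0) (at c)" by simp
    qed
    then show ?thesis unfolding 3 has_field_derivative_iff by simp
  qed
qed

lemma excess_nonneg [simp]: "0 \<le> excess c s" by (simp add: excess_def)

lemma one_plus_square_pos: "0 < 1 + (x::real)\<^sup>2" by (rule add_pos_nonneg) auto

lemma DERIV_test_fun: "(test_fun c has_real_derivative test_fun' c s) (at s)"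
proof -
  have "((\<lambda>s. 1 - 1 / (1 + (max 0 (s - c))\<^sup>2)) has_real_derivative
      2 * max 0 (s - c) / (1 + (max 0 (s - c))\<^sup>2)\<^sup>2) (at s)"
    by (rule derivative_eq_intros DERIV_square_pos_part refl | simp)+
      (use one_plus_square_pos[of "max 0 (s - c)"] in \<open>auto simp: power2_eq_square\<close>)
  then show ?thesis by (simp add: test_fun_def[abs_def] test_fun'_def excess_def)
qed

lemma continuous_test_fun': "continuous_on UNIV (test_fun' c)"
  unfolding test_fun'_def[abs_def] excess_def
  by (intro continuous_intros) (use one_plus_square_pos in \<open>auto simp: less_imp_neq[symmetric]\<close>)

lemma test_fun_bounds: "0 \<le> test_fun c s" "test_fun c s \<le> 1"
  using one_plus_square_pos[of "excess c s"] by (auto simp: test_fun_def divide_le_eq)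

lemma test_fun_zero: "s \<le> c \<Longrightarrow> test_fun c s = 0" by (simp add: test_fun_def excess_def)

lemma test_fun_pos: "c < s \<Longrightarrow> 0 < test_fun c s"
  using one_plus_square_pos[of "excess c s"] by (auto simp: test_fun_def excess_def divide_less_eq)

lemma test_fun'_bounds: "0 \<le> test_fun' c s" "test_fun' c s \<le> 2" "\<bar>test_fun' c s\<bar> \<le> 2"
proof -
  define p where "p = excess c s"
  have p: "0 \<le> p" by (simp add: p_def)
  show 0: "0 \<le> test_fun' c s" using p by (simp add: test_fun'_def p_def)
  have "2 * p \<le> 1 + p\<^sup>2" using sum_squares_bound[of 1 p] by simp
  also have "\<dots> \<le> (1 + p\<^sup>2)\<^sup>2" using mult_left_mono[of 1 "1 + p\<^sup>2" "1 + p\<^sup>2"] by (simp add: power2_eq_square)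
  also have "\<dots> \<le> 2 * (1 + p\<^sup>2)\<^sup>2" by simp
  finally show 2: "test_fun' c s \<le> 2"
    using one_plus_square_pos[of p] by (simp add: test_fun'_def p_def divide_le_eq)
  show "\<bar>test_fun' c s\<bar> \<le> 2" using 0 2 by simp
qed

lemma test_fun_Lipschitz: "\<bar>test_fun c s - test_fun c t\<bar> \<le> 2 * \<bar>s - t\<bar>"
  using field_differentiable_bound[of UNIV "test_fun c" "test_fun' c" 2 s t] DERIV_test_fun test_fun'_bounds by simp

text \<open>
  Completing the square bounds the left-hand side by \<open>L\<^sup>2 \<theta>\<^sup>2 / (4 \<theta>')\<close>, where \<open>\<theta>\<close> and \<open>\<theta>'\<close> are the
  values of the test function and of its derivative at \<open>s\<close>. At height \<open>r = s - c \<le> d \<le> 1\<close> above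
  the truncation level, \<open>\<theta> / \<theta>' = r (1 + r\<^sup>2) / 2 \<le> r\<close>.
\<close>

lemma test_fun_absorption:
  assumes s: "s \<le> c + d" and d: "d \<le> 1"
  shows "L * test_fun c s * G - test_fun' c s * G\<^sup>2 \<le> L\<^sup>2 * d / 4 * test_fun c s"
proof (cases "s \<le> c")
  case True
  then show ?thesis by (simp add: test_fun_zero test_fun'_def excess_def)
next
  case False
  define p where "p = s - c"
  have p: "0 < p" "p \<le> d" "excess c s = p" using False s by (auto simp: p_def excess_def)
  define th th' where "th = test_fun c s" "th' = test_fun' c s"
  have th0: "0 < th" using False test_fun_pos[of c s] by (simp add: th_th'_def)
  have th'0: "0 < th'"
    using p one_plus_square_pos[of p] by (simp add: th_th'_def test_fun'_def)
  have "th * 2 = p * (1 + p\<^sup>2) * th'"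
  proof -
    define q where "q = 1 + p\<^sup>2"
    have q: "q \<noteq> 0" using one_plus_square_pos[of p] by (simp add: q_def)
    have "1 - 1 / q = p\<^sup>2 / q" using q by (simp add: q_def field_simps)
    moreover have "p * q * (2 * p / q\<^sup>2) = 2 * (p\<^sup>2 / q)" using q by (simp add: power2_eq_square)
    ultimately show ?thesis unfolding th_th'_def test_fun_def test_fun'_def p(3) q_def by simp
  qed
  also have "\<dots> \<le> p * 2 * th'"
    using p d th'0 by (intro mult_right_mono mult_left_mono) (auto simp: power_le_one)
  finally have "th \<le> p * th'" by simp
  also have "\<dots> \<le> d * th'" using p th'0 by (intro mult_right_mono) auto
  finally have le: "th \<le> d * th'" .
  have "0 \<le> (2 * th' * G - L * th)\<^sup>2" by simp
  then have "4 * th' * (L * th * G - th' * G\<^sup>2) \<le> L\<^sup>2 * th * th"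
    by (simp add: power2_eq_square algebra_simps)
  also have "\<dots> \<le> L\<^sup>2 * th * (d * th')" using le th0 by (intro mult_left_mono) auto
  also have "\<dots> = 4 * th' * (L\<^sup>2 * d / 4 * th)" by simp
  finally have "L * th * G - th' * G\<^sup>2 \<le> L\<^sup>2 * d / 4 * th" using th'0 by simp
  then show ?thesis by (simp add: th_th'_def)
qed

context mm_space
begin

text \<open>
  The chain rule for \<open>s - t \<theta>(s)\<close> requires that this function preserve square integrability. The
  alternative \<open>0 \<le> c\<close> makes the test function vanish at \<open>0\<close>; if \<open>c\<close> is negative, then constants
  have to be square integrable.
\<close>

lemma test_fun_energy_le:
  assumes f: "f \<in> W12 m" and zero: "0 \<le> c \<or> emeasure m UNIV < \<infinity>"
  shows "energy (\<lambda>x. f x - t * test_fun c (f x)) \<le> (\<integral>x. (1 - t * test_fun' c (f x))\<^sup>2 * (grad_norm m f x)\<^sup>2 \<partial>m)"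
proof -
  define S S' where "S s = s - t * test_fun c s" "S' s = 1 - t * test_fun' c s" for s
  have der: "(S has_real_derivative S' s) (at s)" for s
    unfolding S_S'_def by (intro DERIV_diff DERIV_ident DERIV_cmult DERIV_test_fun)
  have cont: "continuous_on UNIV S'"
    unfolding S_S'_def[abs_def] by (intro continuous_intros continuous_test_fun')
  have b: "\<bar>S' s\<bar> \<le> 1 + \<bar>t\<bar> * 2" for s
  proof -
    have "\<bar>t * test_fun' c s\<bar> \<le> \<bar>t\<bar> * 2" unfolding abs_mult by (rule mult_left_mono[OF test_fun'_bounds(3)]) simp
    then show ?thesis by (simp add: S_S'_def)
  qed
  have [measurable]: "test_fun c \<in> borel_measurable borel"
    by (rule borel_measurable_continuous_onI) (meson DERIV_test_fun DERIV_continuous_on has_field_derivative_at_within)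
  have T: "(\<lambda>x. test_fun c (u x)) \<in> L2 m" if u: "u \<in> L2 m" for u
  proof -
    have um [measurable]: "u \<in> borel_measurable m" by (rule L2D(1)[OF u])
    show ?thesis
    proof (cases "0 \<le> c")
      case True
      have "\<bar>test_fun c (u x)\<bar> \<le> \<bar>2 * u x\<bar>" for x
        using test_fun_Lipschitz[of c "u x" 0] test_fun_zero[of 0 c] True by simp
      then show ?thesis by (intro L2_dominated[OF L2_cmult[OF u, of 2]]) auto
    next
      case False
      then have "emeasure m UNIV < \<infinity>" using zero by blast
      then have "finite_measure m" by (intro finite_measureI) simp
      then have "integrable m (\<lambda>x. 1 :: real)" by (rule finite_measure.integrable_const)
      then have "(\<lambda>x. 1) \<in> L2 m" by (simp add: L2_def)
      then show ?thesis by (rule L2_dominated) (use test_fun_bounds in auto)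
    qed
  qed
  have SL: "(\<lambda>x. S (u x)) \<in> L2 m" if "u \<in> L2 m" for u
    unfolding S_S'_def by (intro L2_diff L2_cmult T that)
  have sr: "strong_relaxed (\<lambda>x. S (f x)) (\<lambda>x. \<bar>S' (f x)\<bar> * grad_norm m f x)"
    by (rule strong_relaxed_chain[OF W12_L2[OF f] grad_norm_W12(1)[OF f] der cont b SL])
  show ?thesis
    using energy_le_strong_relaxed(2)[OF sr SL[OF W12_L2[OF f]]]
    by (simp add: S_S'_def power_mult_distrib)
qed

text \<open>
  Lipschitz approximants of \<open>f\<close> give approximants of \<open>\<theta>(f)\<close>, but their supports are not bounded.
  Taking the minimum with a cutoff that is \<open>1\<close> on \<open>U\<close> makes the supports bounded without changing
  the limit, since \<open>\<theta>(f)\<close> is at most \<open>1\<close> and vanishes almost everywhere outside \<open>U\<close>.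
\<close>

lemma test_fun_approximation:
  assumes f: "f \<in> W12 m" and U: "bounded U" and off: "AE x in m. x \<notin> U \<longrightarrow> f x \<le> c"
  obtains g A M where "\<And>n::nat. g n \<in> Lip_bs" "\<And>n x. 0 \<le> g n x" "\<And>n x. g n x \<le> indicator A x"
    "A \<in> sets borel" "bounded A" "\<And>n. energy (g n) \<le> M"
    "(\<lambda>x. test_fun c (f x)) \<in> W12 m"
    "(\<lambda>n. sqdist m (g n) (\<lambda>x. test_fun c (f x))) \<longlonglongrightarrow> 0"
    "AE x in m. (\<lambda>n. g n x) \<longlonglongrightarrow> test_fun c (f x)"
    "AE x in m. test_fun c (f x) \<le> indicator A x"
proof -
  fix a :: 'a
  obtain R where R: "\<And>x. x \<in> U \<Longrightarrow> dist a x \<le> R" using U unfolding bounded_any_center[of _ a] by blast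
  define \<eta> where "\<eta> = cutoff a R"
  define A where "A = cball a (R + 1)"
  have \<eta>0: "\<eta> x = 0" if "x \<notin> A" for x using that by (auto simp: \<eta>_def cutoff_def A_def dist_commute)
  have \<eta>01: "0 \<le> \<eta> x" "\<eta> x \<le> 1" for x by (simp_all add: \<eta>_def cutoff_bounds)
  have \<eta>U: "\<eta> x = 1" if "x \<in> U" for x using R[OF that] by (simp add: \<eta>_def cutoff_eq_1 dist_commute)
  have \<eta>L: "\<eta> \<in> Lip" using cutoff_Lip_bs[of a R] by (simp add: Lip_bs_def \<eta>_def)
  have AB: "A \<in> sets borel" "bounded A" "closed A" by (simp_all add: A_def)
  have \<eta>A: "\<eta> x \<le> indicator A x" for x using \<eta>0[of x] \<eta>01[of x] by (simp add: indicator_def)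
  have [measurable]: "A \<in> sets m" using AB by simp
  have iA: "integrable m (indicat_real A)"
    by (rule integrable_real_indicator) (use emeasure_bounded[OF AB(1,2)] AB in auto)
  have AL: "indicat_real A \<in> L2 m"
  proof -
    have "(indicat_real A x)\<^sup>2 = indicat_real A x" for x by (simp add: indicator_def)
    then show ?thesis using iA by (simp add: L2_def)
  qed
  have fL: "f \<in> L2 m" by (rule W12_L2[OF f])
  have gL: "grad_norm m f \<in> L2 m" by (rule grad_norm_L2[OF f])
  obtain F k where F: "\<And>n::nat. F n \<in> Lip_b" "\<And>n. F n \<in> L2 m" "\<And>n. k n \<in> L2 m"
    "\<And>n. AE x in m. slope (F n) x \<le> k n x"
    "(\<lambda>n. sqdist m (F n) f) \<longlonglongrightarrow> 0" "(\<lambda>n. sqdist m (k n) (grad_norm m f)) \<longlonglongrightarrow> 0"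
    "AE x in m. (\<lambda>n. F n x) \<longlonglongrightarrow> f x"
    by (rule strong_relaxedE_seq[OF grad_norm_W12(1)[OF f] fL]) blast
  have FLip: "F n \<in> Lip" for n by (rule Lip_b_Lip[OF F(1)])
  define g where "g n x = min (test_fun c (F n x)) (\<eta> x)" for n x
  define p where "p x = test_fun c (f x)" for x
  have pmin: "AE x in m. p x = min (p x) (\<eta> x)"
    using off
  proof eventually_elim
    case (elim x)
    show ?case
    proof (cases "x \<in> U")
      case True
      then show ?thesis using \<eta>U test_fun_bounds(2)[of c "f x"] by (simp add: p_def)
    next
      case False
      then show ?thesis using elim \<eta>01(1)[of x] by (simp add: p_def test_fun_zero)
    qed
  qed
  have min_diff: "\<bar>min s e - min t e'\<bar> \<le> \<bar>s - t\<bar> + \<bar>e - e'\<bar>" for s t e e' :: real by (auto simp: min_def abs_if)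
  have gdiff: "\<bar>g n y - g n x\<bar> \<le> 2 * \<bar>F n y - F n x\<bar> + 1 * dist y x" for n x y
  proof -
    have "\<bar>g n y - g n x\<bar> \<le> \<bar>test_fun c (F n y) - test_fun c (F n x)\<bar> + \<bar>\<eta> y - \<eta> x\<bar>"
      unfolding g_def by (rule min_diff)
    also have "\<dots> \<le> 2 * \<bar>F n y - F n x\<bar> + 1 * dist y x"
      unfolding \<eta>_def by (intro add_mono test_fun_Lipschitz cutoff_Lipschitz)
    finally show ?thesis .
  qed
  have g0: "0 \<le> g n x" for n x using test_fun_bounds(1) \<eta>01(1) by (simp add: g_def)
  have gA: "g n x \<le> indicator A x" for n x
    by (rule order_trans[OF _ \<eta>A]) (simp add: g_def)
  have gz: "g n x = 0" if "x \<notin> A" for n x using g0[of n x] gA[of n x] that by simp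
  have gLip: "g n \<in> Lip" for n
  proof -
    obtain C where C: "0 \<le> C" "\<And>x y. \<bar>F n x - F n y\<bar> \<le> C * dist x y" by (rule LipE[OF FLip[of n]]) blast
    show ?thesis
    proof (rule LipI[of "2 * C + 1"])
      show "\<bar>g n x - g n y\<bar> \<le> (2 * C + 1) * dist x y" for x y
        using gdiff[of n x y] C(2)[of x y] by (simp add: algebra_simps)
    qed (use C in auto)
  qed
  have gbs: "g n \<in> Lip_bs" for n
  proof -
    have "{x. g n x \<noteq> 0} \<subseteq> A" using gz by blast
    then show ?thesis using gLip AB(2) bounded_subset by (auto simp: Lip_bs_def)
  qed
  have gL2: "g n \<in> L2 m" for n by (rule Lip_bs_facts(2)[OF gbs])
  have gslope: "AE x in m. slope (g n) x \<le> 2 * k n x + indicator A x" for n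
    using F(4)[of n]
  proof eventually_elim
    case (elim x)
    show ?case
    proof (cases "x \<in> A")
      case True
      have "slope (g n) x \<le> 2 * slope (F n) x + 1"
        by (rule slope_dominated[OF FLip]) (use gdiff in auto)
      then show ?thesis using elim True by simp
    next
      case False
      have "slope (g n) x = 0" by (rule slope_zero_outside[OF AB(3) False gz])
      moreover have "0 \<le> k n x" using elim slope_nonneg[of "F n" x] by linarith
      ultimately show ?thesis using False by simp
    qed
  qed
  have sl: "(\<integral>x. (slope (g n) x)\<^sup>2 \<partial>m) \<le> 8 * (\<integral>x. (k n x)\<^sup>2 \<partial>m) + 2 * (\<integral>x. indicat_real A x \<partial>m)" for n
  proof -
    have "(\<integral>x. (slope (g n) x)\<^sup>2 \<partial>m) \<le> (\<integral>x. 8 * (k n x)\<^sup>2 + 2 * indicat_real A x \<partial>m)"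
    proof (rule integral_mono_AE)
      show "integrable m (\<lambda>x. (slope (g n) x)\<^sup>2)" by (rule L2D(2)[OF Lip_bs_facts(3)[OF gbs]])
      show "integrable m (\<lambda>x. 8 * (k n x)\<^sup>2 + 2 * indicat_real A x)" using L2D(2)[OF F(3)] iA by simp
      show "AE x in m. (slope (g n) x)\<^sup>2 \<le> 8 * (k n x)\<^sup>2 + 2 * indicat_real A x"
        using gslope[of n]
      proof eventually_elim
        case (elim x)
        have "(slope (g n) x)\<^sup>2 \<le> (2 * k n x + indicat_real A x)\<^sup>2" using elim by (intro power_mono) auto
        also have "\<dots> \<le> 2 * (2 * k n x)\<^sup>2 + 2 * (indicat_real A x)\<^sup>2" by (rule power2_add_le)
        also have "\<dots> = 8 * (k n x)\<^sup>2 + 2 * indicat_real A x" by (simp add: power_mult_distrib indicator_def)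
        finally show ?case .
      qed
    qed
    also have "\<dots> = 8 * (\<integral>x. (k n x)\<^sup>2 \<partial>m) + 2 * (\<integral>x. indicat_real A x \<partial>m)"
      using L2D(2)[OF F(3)[of n]] iA by simp
    finally show ?thesis .
  qed
  have "Bseq (\<lambda>n. \<integral>x. (k n x)\<^sup>2 \<partial>m)"
    by (rule convergent_imp_Bseq, rule convergentI, rule tendsto_square_L2[OF F(3) gL F(6)])
  then obtain B where B: "\<And>n. norm (\<integral>x. (k n x)\<^sup>2 \<partial>m) \<le> B" by (auto simp: Bseq_def)
  define M where "M = 8 * B + 2 * (\<integral>x. indicat_real A x \<partial>m)"
  have slM: "(\<integral>x. (slope (g n) x)\<^sup>2 \<partial>m) \<le> M" for n using sl[of n] B[of n] by (simp add: M_def)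
  have enM: "energy (g n) \<le> M" for n
    by (rule order_trans[OF energy_le_strong_relaxed(2)[OF Lip_bs_facts(4)[OF gbs] gL2] slM])
  have M0: "0 \<le> M" using enM[of 0] energy_nonneg[of "g 0"] by linarith
  have [measurable]: "test_fun c \<in> borel_measurable borel"
    by (rule borel_measurable_continuous_onI) (meson DERIV_test_fun DERIV_continuous_on has_field_derivative_at_within)
  have [measurable]: "p \<in> borel_measurable m" unfolding p_def[abs_def] using L2D(1)[OF fL] by measurable
  have pA: "AE x in m. p x \<le> indicator A x"
    using pmin by eventually_elim (use \<eta>A in \<open>metis min.cobounded2 order_trans\<close>)
  have pL: "p \<in> L2 m"
  proof (rule L2_dominated[OF AL])
    show "AE x in m. \<bar>p x\<bar> \<le> \<bar>indicat_real A x\<bar>"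
      using pA by eventually_elim (use test_fun_bounds(1) in \<open>simp add: p_def\<close>)
  qed measurable
  have gp: "(\<lambda>n. sqdist m (g n) p) \<longlonglongrightarrow> 0"
  proof (rule sqdist_tendsto_zero_le)
    fix n
    have "sqdist m (g n) p \<le> sqdist m (\<lambda>x. 2 * F n x) (\<lambda>x. 2 * f x)"
    proof (rule sqdist_mono)
      show "AE x in m. \<bar>g n x - p x\<bar> \<le> \<bar>2 * F n x - 2 * f x\<bar>"
        using pmin
      proof eventually_elim
        case (elim x)
        have "\<bar>g n x - min (p x) (\<eta> x)\<bar> \<le> \<bar>test_fun c (F n x) - test_fun c (f x)\<bar>"
          using min_diff[of "test_fun c (F n x)" "\<eta> x" "p x" "\<eta> x"] by (simp add: g_def p_def)
        also have "\<dots> \<le> \<bar>2 * F n x - 2 * f x\<bar>"           unfolding right_diff_distrib[symmetric] abs_mult using test_fun_Lipschitz[of c "F n x" "f x"] by simp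
        finally show ?case using elim by simp
      qed
    qed (intro L2_cmult F fL gL2 pL)+
    also have "\<dots> = 4 * sqdist m (F n) f"
      unfolding sqdist_def right_diff_distrib[symmetric] power_mult_distrib by simp
    finally show "sqdist m (g n) p \<le> 4 * sqdist m (F n) f" .
  next
    show "(\<lambda>n. 4 * sqdist m (F n) f) \<longlonglongrightarrow> 0" using tendsto_mult_left[OF F(5), of 4] by simp
  qed
  have pW: "p \<in> W12 m"
  proof (rule energy_leI(1)[OF pL M0])
    fix e :: real assume "0 < e"
    then have "\<forall>\<^sub>F n in sequentially. sqdist m (g n) p < e" by (rule order_tendstoD(2)[OF gp])
    then obtain n where n: "sqdist m (g n) p < e" by (auto simp: eventually_sequentially)
    then show "\<exists>u\<in>Lip \<inter> L2 m. slope u \<in> L2 m \<and> sqdist m u p < e \<and> (\<integral>x. (slope u x)\<^sup>2 \<partial>m) \<le> M"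
      using gLip[of n] gL2[of n] Lip_bs_facts(3)[OF gbs[of n]] slM[of n] by blast
  qed
  have gae: "AE x in m. (\<lambda>n. g n x) \<longlonglongrightarrow> p x"
    using F(7) pmin
  proof eventually_elim
    case (elim x)
    have "(\<lambda>n. test_fun c (F n x)) \<longlonglongrightarrow> test_fun c (f x)"
      by (rule isCont_tendsto_compose[OF DERIV_isCont[OF DERIV_test_fun] elim(1)])
    then have "(\<lambda>n. g n x) \<longlonglongrightarrow> min (p x) (\<eta> x)" unfolding g_def p_def by (intro tendsto_min tendsto_const)
    then show ?case using elim(2) by simp
  qed
  show ?thesis
  proof (rule that)
    show "(\<lambda>x. test_fun c (f x)) \<in> W12 m" using pW by (simp add: p_def[abs_def])
    show "(\<lambda>n. sqdist m (g n) (\<lambda>x. test_fun c (f x))) \<longlonglongrightarrow> 0" using gp by (simp add: p_def[abs_def])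
    show "AE x in m. (\<lambda>n. g n x) \<longlonglongrightarrow> test_fun c (f x)" using gae by (simp add: p_def)
    show "AE x in m. test_fun c (f x) \<le> indicator A x" using pA by (simp add: p_def)
  qed (fact gbs g0 gA AB enM)+
qed

end

context hilbertian_space
begin

text \<open>
  First variation: the function \<open>f - t \<theta>(f)\<close> has gradient at most \<open>\<bar>1 - t \<theta>'(f)\<bar> |\<nabla>f|\<close>. Comparing
  the terms of first order in \<open>t\<close> of its energy gives the inequality without a chain rule for
  inner products.
\<close>

lemma form_test_fun_ge:
  assumes f: "f \<in> W12 m" and p: "(\<lambda>x. test_fun c (f x)) \<in> W12 m" and zero: "0 \<le> c \<or> emeasure m UNIV < \<infinity>"
  shows "(\<integral>x. test_fun' c (f x) * (grad_norm m f x)\<^sup>2 \<partial>m) \<le> form f (\<lambda>x. test_fun c (f x))"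
proof -
  let ?p = "\<lambda>x. test_fun c (f x)" and ?g = "grad_norm m f"
  have gL: "?g \<in> L2 m" by (rule grad_norm_L2[OF f])
  have [measurable]: "test_fun' c \<in> borel_measurable borel"
    by (rule borel_measurable_continuous_onI[OF continuous_test_fun'])
  note [measurable] = L2D(1)[OF gL] L2D(1)[OF W12_L2[OF f]]
  have i1: "integrable m (\<lambda>x. (?g x)\<^sup>2)" by (rule L2D(2)[OF gL])
  have i3: "integrable m (\<lambda>x. (test_fun' c (f x))\<^sup>2 * (?g x)\<^sup>2)"
  proof -
    have "(\<lambda>x. test_fun' c (f x) * ?g x) \<in> L2 m"
      by (rule L2_mult_bounded[OF gL _ test_fun'_bounds(3)]) measurable
    from L2D(2)[OF this] show ?thesis by (simp add: power_mult_distrib)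
  qed
  have i2: "integrable m (\<lambda>x. test_fun' c (f x) * (?g x)\<^sup>2)"
  proof (rule Bochner_Integration.integrable_bound[OF integrable_mult_right[OF i1, of 2]])
    have "test_fun' c (f x) * (?g x)\<^sup>2 \<le> 2 * (?g x)\<^sup>2" for x
      by (rule mult_right_mono[OF test_fun'_bounds(2)]) simp
    then show "AE x in m. norm (test_fun' c (f x) * (?g x)\<^sup>2) \<le> norm (2 * (?g x)\<^sup>2)"
      by (simp add: abs_mult test_fun'_bounds)
  qed measurable
  define X Y where "X = (\<integral>x. test_fun' c (f x) * (?g x)\<^sup>2 \<partial>m)" "Y = (\<integral>x. (test_fun' c (f x))\<^sup>2 * (?g x)\<^sup>2 \<partial>m)"
  have Y0: "0 \<le> Y" by (simp add: X_Y_def)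
  have t: "X \<le> form f ?p + t * Y / 2" if t: "0 < t" for t
  proof -
    have "energy (\<lambda>x. f x + (- t) * ?p x) = energy f + 2 * (- t) * form f ?p + (- t)\<^sup>2 * energy ?p"
      by (rule energy_line[OF f p])
    then have "energy f - 2 * t * form f ?p \<le> energy (\<lambda>x. f x - t * ?p x)"
      using energy_nonneg[of ?p] by simp
    also have "\<dots> \<le> (\<integral>x. (1 - t * test_fun' c (f x))\<^sup>2 * (?g x)\<^sup>2 \<partial>m)"
      by (rule test_fun_energy_le[OF f zero])
    also have "\<dots> = (\<integral>x. (?g x)\<^sup>2 - 2 * t * (test_fun' c (f x) * (?g x)\<^sup>2) + t\<^sup>2 * ((test_fun' c (f x))\<^sup>2 * (?g x)\<^sup>2) \<partial>m)"
      by (rule Bochner_Integration.integral_cong) (simp_all add: power2_eq_square algebra_simps)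
    also have "\<dots> = energy f - 2 * t * X + t\<^sup>2 * Y"
      using i1 i2 i3 grad_norm_W12(2)[OF f] by (simp add: X_Y_def)
    finally have "2 * t * X \<le> 2 * t * (form f ?p + t * Y / 2)" by (simp add: power2_eq_square algebra_simps)
    then show ?thesis using t by simp
  qed
  have "X \<le> form f ?p"
  proof (rule field_le_epsilon)
    fix e :: real assume e: "0 < e"
    have "X \<le> form f ?p + (e / (Y + 1)) * Y / 2" by (rule t) (use e Y0 in auto)
    also have "(e / (Y + 1)) * Y / 2 \<le> e" using e Y0 by (simp add: field_simps)
    finally show "X \<le> form f ?p + e" by simp
  qed
  then show ?thesis by (simp add: X_Y_def)
qed

text \<open>
  Integration by parts against the discontinuous function \<open>\<theta>(f)\<close>. For the Lipschitz approximants
  the singular part has a sign; what remains is an integral against \<open>h m\<close>, to which dominated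
  convergence applies, and the weak lower semicontinuity of the form has the right direction.
\<close>

theorem test_fun_laplacian_le:
  assumes f: "f \<in> W12 m" and lap: "has_measure_laplacian m f \<mu>"
    and dec: "Lebesgue_decomposition m \<mu> h \<sigma>" and pos: "smeasure_nonneg \<sigma>"
    and U: "bounded U" and off: "AE x in m. x \<notin> U \<longrightarrow> f x \<le> c"
    and zero: "0 \<le> c \<or> emeasure m UNIV < \<infinity>"
  shows "integrable m (\<lambda>x. test_fun c (f x) * h x)" "integrable m (\<lambda>x. test_fun c (f x))"
    "(\<integral>x. test_fun c (f x) * h x \<partial>m) \<le> - (\<integral>x. test_fun' c (f x) * (grad_norm m f x)\<^sup>2 \<partial>m)"
proof -
  obtain g A M where g: "\<And>n::nat. g n \<in> Lip_bs" "\<And>n x. 0 \<le> g n x" "\<And>n x. g n x \<le> indicator A x"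
    and A: "A \<in> sets borel" "bounded A" and M: "\<And>n. energy (g n) \<le> M"
    and pW: "(\<lambda>x. test_fun c (f x)) \<in> W12 m"
    and gp: "(\<lambda>n. sqdist m (g n) (\<lambda>x. test_fun c (f x))) \<longlonglongrightarrow> 0"
    and gae: "AE x in m. (\<lambda>n. g n x) \<longlonglongrightarrow> test_fun c (f x)"
    and pA: "AE x in m. test_fun c (f x) \<le> indicator A x"
    by (rule test_fun_approximation[OF f U off]) blast
  define p where "p x = test_fun c (f x)" for x
  note pW = pW[folded p_def] and gp = gp[folded p_def] and gae = gae[folded p_def] and pA = pA[folded p_def]
  have p0: "0 \<le> p x" for x by (simp add: p_def test_fun_bounds)
  have [measurable]: "h \<in> borel_measurable m" using dec by (simp add: Lebesgue_decomposition_def)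
  have [measurable]: "p \<in> borel_measurable m" by (rule L2D(1)[OF W12_L2[OF pW]])
  have [measurable]: "g n \<in> borel_measurable m" for n by (rule L2D(1)[OF Lip_bs_facts(2)[OF g(1)]])
  have iAh: "integrable m (\<lambda>x. \<bar>indicator A x * h x\<bar>)"
    using dec A by (auto simp: Lebesgue_decomposition_def set_integrable_def)
  have W: "f \<in> W12_loc m" "signed_radon_measure \<mu>"
    and ibp: "\<And>u. u \<in> Lip_bs \<Longrightarrow> - (\<integral>x. grad_inner_loc m f u x \<partial>m) = sintegral \<mu> u"
    using lap by (auto simp: has_measure_laplacian_def)
  have bound: "\<bar>u * h x\<bar> \<le> \<bar>indicator A x * h x\<bar>" if "0 \<le> u" "u \<le> indicator A x" for u x
  proof -
    have "\<bar>u\<bar> * \<bar>h x\<bar> \<le> \<bar>indicator A x\<bar> * \<bar>h x\<bar>" using that by (intro mult_right_mono) auto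
    then show ?thesis by (simp add: abs_mult)
  qed
  have ghl: "(\<lambda>n. \<integral>x. g n x * h x \<partial>m) \<longlonglongrightarrow> (\<integral>x. p x * h x \<partial>m)"
  proof (rule integral_dominated_convergence[OF _ _ iAh])
    show "AE x in m. (\<lambda>n. g n x * h x) \<longlonglongrightarrow> p x * h x"
      using gae by eventually_elim (intro tendsto_intros)
    show "AE x in m. norm (g n x * h x) \<le> \<bar>indicator A x * h x\<bar>" for n using bound g by simp
  qed measurable
  have "AE x in m. norm (p x * h x) \<le> norm \<bar>indicator A x * h x\<bar>"
    using pA by eventually_elim (use bound p0 in simp)
  then show "integrable m (\<lambda>x. test_fun c (f x) * h x)"
    unfolding p_def[symmetric] by (intro Bochner_Integration.integrable_bound[OF iAh]) simp
  have iA: "integrable m (indicat_real A)"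
    by (rule integrable_real_indicator) (use emeasure_bounded[OF A] A in auto)
  have "AE x in m. norm (p x) \<le> norm (indicat_real A x)"
    using pA by eventually_elim (use p0 in simp)
  then show "integrable m (\<lambda>x. test_fun c (f x))"
    unfolding p_def[symmetric] by (intro Bochner_Integration.integrable_bound[OF iA]) simp
  have fg: "form f (g n) \<le> - (\<integral>x. g n x * h x \<partial>m)" for n
    using Lebesgue_decomposition_integral_le(2)[OF dec pos W(2) g(1,2), of n] ibp[OF g(1), of n]
      integral_grad_inner_loc[OF f W(1) g(1), of n] by simp
  have "form f p \<le> - (\<integral>x. p x * h x \<partial>m)"
  proof (rule field_le_epsilon)
    fix e :: real assume "0 < e"
    from form_weak_limit[OF f pW Lip_bs_facts(5)[OF g(1)] M gp this]
    have "\<forall>\<^sub>F n in sequentially. form f p - e \<le> - (\<integral>x. g n x * h x \<partial>m)"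
    proof eventually_elim
      case (elim n)
      then show ?case using fg[of n] by linarith
    qed
    then have "form f p - e \<le> - (\<integral>x. p x * h x \<partial>m)"
      by (rule tendsto_lowerbound[OF tendsto_minus[OF ghl]]) simp
    then show "form f p \<le> - (\<integral>x. p x * h x \<partial>m) + e" by simp
  qed
  then show "(\<integral>x. test_fun c (f x) * h x \<partial>m) \<le> - (\<integral>x. test_fun' c (f x) * (grad_norm m f x)\<^sup>2 \<partial>m)"
    using form_test_fun_ge[OF f pW[unfolded p_def] zero] by (simp add: p_def[abs_def])
qed

end

section \<open>The maximum principle\<close>

context mm_space
begin

lemma restrict_space_m_UNIV: "restrict_space m UNIV = m"
  by (rule measure_eqI) (auto simp: sets_restrict_space emeasure_restrict_space)

lemma AE_le_ess_sup_on:
  assumes "A \<in> sets borel"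
  shows "AE x in m. x \<in> A \<longrightarrow> ereal (f x) \<le> ess_sup_on m A f"
proof -
  have "AE x in restrict_space m A. ereal (f x) \<le> ess_sup_on m A f"
    unfolding ess_sup_on_def by (rule esssup_AE)
  then show ?thesis using assms by (simp add: AE_restrict_space_iff)
qed

lemma ess_sup_on_le:
  assumes "A \<in> sets borel" "f \<in> borel_measurable m" "AE x in m. x \<in> A \<longrightarrow> ereal (f x) \<le> c"
  shows "ess_sup_on m A f \<le> c"
  unfolding ess_sup_on_def
proof (rule esssup_I)
  have "f \<in> borel_measurable (restrict_space m A)" using assms(2) by (rule measurable_restrict_space1)
  then show "(\<lambda>x. ereal (f x)) \<in> borel_measurable (restrict_space m A)" by simp
  show "AE x in restrict_space m A. ereal (f x) \<le> c"
    using assms by (simp add: AE_restrict_space_iff)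
qed

text \<open>
  Outside \<open>U\<close> the integrable function \<open>f\<^sup>2\<close> is at least \<open>c\<^sup>2 > 0\<close>.
\<close>

lemma finite_measure_if_negative_outside:
  assumes f: "f \<in> L2 m" and U: "bounded U" and off: "AE x in m. x \<notin> U \<longrightarrow> f x \<le> c" and c: "c < 0"
  shows "emeasure m UNIV < \<infinity>"
proof -
  note [measurable] = L2D(1)[OF f]
  have cU: "bounded (closure U)" using U by (rule bounded_closure)
  have "emeasure m (closure U) < \<infinity>" using cU by (intro emeasure_bounded) auto
  then have i1: "integrable m (indicat_real (closure U))" by (intro integrable_real_indicator) auto
  have i2: "integrable m (\<lambda>x. (f x)\<^sup>2 / c\<^sup>2 + indicat_real (closure U) x)" using L2D(2)[OF f] i1 by simp
  have "AE x in m. norm (1 :: real) \<le> norm ((f x)\<^sup>2 / c\<^sup>2 + indicat_real (closure U) x)"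
    using off
  proof eventually_elim
    case (elim x)
    show ?case
    proof (cases "x \<in> U")
      case True
      then have "x \<in> closure U" using closure_subset by blast
      then show ?thesis by simp
    next
      case False
      then have "\<bar>c\<bar> \<le> \<bar>f x\<bar>" using elim c by auto
      then have "c\<^sup>2 \<le> (f x)\<^sup>2" by (simp only: abs_le_square_iff)
      then have "1 \<le> (f x)\<^sup>2 / c\<^sup>2" using c by simp
      then show ?thesis by (simp add: indicator_def)
    qed
  qed
  then have "integrable m (\<lambda>x. 1 :: real)"
    by (intro Bochner_Integration.integrable_bound[OF i2]) auto
  then have "(\<integral>\<^sup>+x. ennreal (norm (1 :: real)) \<partial>m) < \<infinity>" by (simp only: integrable_iff_bounded)
  then show ?thesis by simp
qed

end

context hilbertian_space
begin

text \<open>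
  The level \<open>c\<close> is at least the values of \<open>f\<close> outside \<open>U\<close> and within \<open>d\<close> of the supremum, with \<open>d\<close>
  so small that \<open>L\<^sup>2 d / 4 < e\<close>. On \<open>{f > c}\<close> the assumption to be refuted bounds the operator from
  below by \<open>e\<close>, while testing with \<open>\<theta>(f)\<close> allows an average of at most \<open>L\<^sup>2 d / 4\<close>.
\<close>

theorem maximum_principle_AE:
  assumes f: "f \<in> W12 m" and lap: "has_measure_laplacian m f \<mu>"
    and dec: "Lebesgue_decomposition m \<mu> h \<sigma>" and pos: "smeasure_nonneg \<sigma>"
    and w: "w \<in> W12 m" "w \<in> Lip_b"
    and U: "bounded U" and off: "AE x in m. x \<notin> U \<longrightarrow> f x \<le> a" and aM: "a < M"
    and fM: "AE x in m. f x \<le> M" and big: "\<And>c. c < M \<Longrightarrow> 0 < emeasure m {x. c < f x}"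
    and e: "0 < e"
  shows "\<not> (AE x in m. M - e \<le> f x \<longrightarrow> e < h x + grad_inner m f w x)"
proof
  assume contra: "AE x in m. M - e \<le> f x \<longrightarrow> e < h x + grad_inner m f w x"
  obtain L where L: "0 \<le> L" "\<And>x y. \<bar>w x - w y\<bar> \<le> L * dist x y" by (rule LipE[OF Lip_b_Lip[OF w(2)]]) blast
  define d where "d = min 1 (min e (2 * e / (L\<^sup>2 + 1)))"
  have "0 < 2 * e / (L\<^sup>2 + 1)" using e by (intro divide_pos_pos) (auto intro: add_nonneg_pos)
  then have d: "0 < d" "d \<le> 1" "d \<le> e" "d \<le> 2 * e / (L\<^sup>2 + 1)" using e by (auto simp: d_def)
  have Ld: "L\<^sup>2 * d / 4 < e"
  proof -
    have "0 < L\<^sup>2 + 1" by (simp add: add_nonneg_pos)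
    then have "d * (L\<^sup>2 + 1) \<le> 2 * e" using d(4) by (simp only: pos_le_divide_eq)
    then show ?thesis using d(1) e by (simp add: algebra_simps)
  qed
  define c where "c = max a (M - d)"
  have c: "c < M" "a \<le> c" "M \<le> c + d" using aM d by (auto simp: c_def)
  have offc: "AE x in m. x \<notin> U \<longrightarrow> f x \<le> c" using off by eventually_elim (use c in auto)
  \<comment> \<open>A negative level is possible only on a space of finite measure.\<close>
  have zero: "0 \<le> c \<or> emeasure m UNIV < \<infinity>"
    using finite_measure_if_negative_outside[OF W12_L2[OF f] U offc] by linarith
  define p G T where "p x = test_fun c (f x)" and "G x = grad_norm m f x" and "T x = test_fun' c (f x)" for x
  note main = test_fun_laplacian_le[OF f lap dec pos U offc zero, folded p_def T_def G_def]
  have p01: "0 \<le> p x" "p x \<le> 1" for x by (simp_all add: p_def test_fun_bounds)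
  have GL: "G \<in> L2 m" unfolding G_def[abs_def] using grad_norm_L2[OF f] by simp
  have [measurable]: "test_fun' c \<in> borel_measurable borel"
    by (rule borel_measurable_continuous_onI[OF continuous_test_fun'])
  note [measurable] = L2D(1)[OF W12_L2[OF f]] L2D(1)[OF GL]
  have [measurable]: "T \<in> borel_measurable m" unfolding T_def[abs_def] by measurable
  have [measurable]: "p \<in> borel_measurable m" using main(2) by simp
  have T2: "0 \<le> T x" "T x \<le> 2" for x by (simp_all add: T_def test_fun'_bounds)
  have iTG: "integrable m (\<lambda>x. T x * (G x)\<^sup>2)"
  proof (rule Bochner_Integration.integrable_bound[OF integrable_mult_right[OF L2D(2)[OF GL], of 2]])
    have "T x * (G x)\<^sup>2 \<le> 2 * (G x)\<^sup>2" for x by (rule mult_right_mono[OF T2(2)]) simp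
    then show "AE x in m. norm (T x * (G x)\<^sup>2) \<le> norm (2 * (G x)\<^sup>2)" using T2(1) by (simp add: abs_mult)
  qed measurable
  define I where "I x = grad_inner m f w x" for x
  have iI: "integrable m I" unfolding I_def[abs_def] using grad_inner_facts(1)[OF f w(1)] by simp
  have ipI: "integrable m (\<lambda>x. p x * I x)"
  proof (rule Bochner_Integration.integrable_bound[OF iI])
    have "\<bar>p x\<bar> * \<bar>I x\<bar> \<le> 1 * \<bar>I x\<bar>" for x by (rule mult_right_mono) (use p01 in auto)
    then show "AE x in m. norm (p x * I x) \<le> norm (I x)" by (simp add: abs_mult)
  qed (use iI in measurable)
  have IL: "AE x in m. \<bar>I x\<bar> \<le> L * G x"
    using grad_inner_bound[OF f w(1)] grad_norm_le_Lipschitz_const[OF w L] grad_norm_nonneg[OF f]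
  proof eventually_elim
    case (elim x)
    have "grad_norm m f x * grad_norm m w x \<le> grad_norm m f x * L" using elim by (intro mult_left_mono) auto
    then show ?case using elim by (simp add: I_def G_def mult.commute)
  qed
  have "AE x in m. e * p x \<le> p x * h x + p x * I x"
    using contra
  proof eventually_elim
    case (elim x)
    show ?case
    proof (cases "f x \<le> c")
      case True
      then show ?thesis by (simp add: p_def test_fun_zero)
    next
      case False
      then have "e < h x + I x" using elim c d by (simp add: I_def)
      then have "p x * e \<le> p x * (h x + I x)" using p01 by (intro mult_left_mono) auto
      then show ?thesis by (simp add: algebra_simps)
    qed
  qed
  then have "(\<integral>x. e * p x \<partial>m) \<le> (\<integral>x. p x * h x + p x * I x \<partial>m)"
    by (intro integral_mono_AE) (use main ipI in auto)
  also have "\<dots> = (\<integral>x. p x * h x \<partial>m) + (\<integral>x. p x * I x \<partial>m)" using main ipI by simp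
  also have "\<dots> \<le> - (\<integral>x. T x * (G x)\<^sup>2 \<partial>m) + (\<integral>x. p x * I x \<partial>m)" using main(3) by simp
  also have "\<dots> = (\<integral>x. p x * I x - T x * (G x)\<^sup>2 \<partial>m)" using iTG ipI by simp
  also have "\<dots> \<le> (\<integral>x. L\<^sup>2 * d / 4 * p x \<partial>m)"
  proof (rule integral_mono_AE)
    show "AE x in m. p x * I x - T x * (G x)\<^sup>2 \<le> L\<^sup>2 * d / 4 * p x"
      using IL fM
    proof eventually_elim
      case (elim x)
      have "p x * I x \<le> p x * (L * G x)" using elim p01 by (intro mult_left_mono) auto
      moreover have "L * p x * G x - T x * (G x)\<^sup>2 \<le> L\<^sup>2 * d / 4 * p x"
        unfolding p_def T_def by (rule test_fun_absorption) (use elim c d in auto)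
      ultimately show ?case by (simp add: mult_ac)
    qed
  qed (use iTG ipI main in auto)
  finally have le: "e * (\<integral>x. p x \<partial>m) \<le> L\<^sup>2 * d / 4 * (\<integral>x. p x \<partial>m)" by simp
  have p_pos: "0 < (\<integral>x. p x \<partial>m)"
  proof (rule ccontr)
    assume "\<not> ?thesis"
    moreover have nn: "AE x in m. 0 \<le> p x" using p01 by simp
    ultimately have "AE x in m. p x = 0"
      using integral_nonneg_eq_0_iff_AE[OF main(2) nn] integral_nonneg_AE[OF nn] by simp
    then have "AE x in m. \<not> c < f x"
      by eventually_elim (use test_fun_pos in \<open>auto simp: p_def less_le\<close>)
    then have "emeasure m {x \<in> space m. c < f x} = 0"
      by (subst (asm) AE_iff_measurable[OF _ refl]) auto
    with big[OF c(1)] show False by simp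
  qed
  from le p_pos Ld show False by simp
qed

end

theorem lemmaA2:
  fixes m :: "'a::{heine_borel, polish_space} measure" and K :: real
    and f w ac_f :: "'a \<Rightarrow> real" and lap_f sing_f :: "'a smeasure"
  assumes "RCD K m"
    and "f \<in> W12 m" and "f \<in> Linf m"
    and "has_measure_laplacian m f lap_f"
    and "Lebesgue_decomposition m lap_f ac_f sing_f"
    and "smeasure_nonneg sing_f"
    and "\<exists>U\<in>sets m. bounded U \<and> emeasure m U > 0 \<and> emeasure m (UNIV - U) > 0 \<and>
           ess_sup_on m U f > ess_sup_on m (UNIV - U) f"
    and "w \<in> W12 m" and "w \<in> Lip_b"
  shows "(\<forall>\<epsilon>>0. emeasure m {x. ereal (f x) \<ge> ess_sup_on m UNIV f - ereal \<epsilon> \<and>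
                              ac_f x + grad_inner m f w x \<le> \<epsilon>} > 0) \<and>
         (\<forall>f' h G. (AE x in m. f' x = f x) \<and> (AE x in m. h x = ac_f x) \<and>
                   (AE x in m. G x = grad_inner m f w x) \<longrightarrow>
            (\<exists>x::nat \<Rightarrow> 'a. \<forall>j\<ge>1.
               ereal (f' (x j)) \<ge> ess_sup_on m UNIV f - ereal (1 / real j) \<and>
               h (x j) + G (x j) \<le> 1 / real j))"
proof -
  interpret hilbertian_space m
    using assms(1) by unfold_locales (auto simp: RCD_def)
  note f = assms(2) and w = assms(8,9)
  obtain U where U: "U \<in> sets borel" "bounded U" "ess_sup_on m (UNIV - U) f < ess_sup_on m U f"
    using assms(7) by auto
  have [measurable]: "f \<in> borel_measurable m" by (rule L2D(1)[OF W12_L2[OF f]])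
  have [measurable]: "ac_f \<in> borel_measurable m" using assms(5) by (simp add: Lebesgue_decomposition_def)
  have [measurable]: "grad_inner m f w \<in> borel_measurable m" using grad_inner_facts(1)[OF f w(1)] by simp
  define M where "M = ess_sup_on m UNIV f"
  have fM: "AE x in m. ereal (f x) \<le> M" using AE_le_ess_sup_on[of UNIV f] by (simp add: M_def)
  have UM: "ess_sup_on m U f \<le> M"
    by (rule ess_sup_on_le[OF U(1)]) (use fM in \<open>auto elim: eventually_mono\<close>)
  then have VM: "ess_sup_on m (UNIV - U) f < M" using U(3) by simp
  have "M < \<infinity>"
  proof -
    have fin: "Linf_norm m f < top" using assms(3) by (simp add: Linf_def)
    have "AE x in m. ennreal \<bar>f x\<bar> \<le> Linf_norm m f" unfolding Linf_norm_def by (rule esssup_AE)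
    then have "AE x in m. ereal (f x) \<le> ereal (enn2real (Linf_norm m f))"
    proof eventually_elim
      case (elim x)
      from enn2real_mono[OF elim fin] show ?case by simp
    qed
    then have "M \<le> ereal (enn2real (Linf_norm m f))"
      unfolding M_def by (intro ess_sup_on_le) (auto elim: eventually_mono)
    then show ?thesis by (rule order_le_less_trans) simp
  qed
  then obtain r where r: "M = ereal r" using VM by (cases M) auto
  obtain a where a: "ess_sup_on m (UNIV - U) f < ereal a" "a < r"
    using ereal_dense2[OF VM] unfolding r by auto
  have off: "AE x in m. x \<notin> U \<longrightarrow> f x \<le> a"
    using AE_le_ess_sup_on[OF sets.Diff[OF _ U(1)], of UNIV f, simplified]
  proof eventually_elim
    case (elim x)
    show ?case
    proof
      assume "x \<notin> U"
      with elim have "ereal (f x) \<le> ess_sup_on m (UNIV - U) f" by blast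
      also note a(1)
      finally have "ereal (f x) < ereal a" .
      then show "f x \<le> a" by simp
    qed
  qed
  have fr: "AE x in m. f x \<le> r" using fM by (simp add: r)
  have big: "0 < emeasure m {x. c < f x}" if "c < r" for c
  proof -
    have "ereal c < esssup m (\<lambda>x. ereal (f x))"
      using that r by (simp add: M_def ess_sup_on_def restrict_space_m_UNIV)
    from esssup_pos_measure[OF _ this] show ?thesis by simp
  qed
  have main: "0 < emeasure m {x. ereal (f x) \<ge> M - ereal e \<and> ac_f x + grad_inner m f w x \<le> e}" if e: "0 < e" for e
  proof (rule ccontr)
    assume "\<not> ?thesis"
    then have z: "emeasure m {x \<in> space m. \<not> (r - e \<le> f x \<longrightarrow> e < ac_f x + grad_inner m f w x)} = 0"
      by (simp add: r not_less)
    have "AE x in m. r - e \<le> f x \<longrightarrow> e < ac_f x + grad_inner m f w x"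
      by (subst AE_iff_measurable[OF _ refl]) (use z in \<open>auto simp del: not_less\<close>)
    with maximum_principle_AE[OF f assms(4,5,6) w U(2) off a(2) fr big e] show False by blast
  qed
  show ?thesis
  proof (intro conjI allI impI)
    show "0 < emeasure m {x. ereal (f x) \<ge> ess_sup_on m UNIV f - ereal \<epsilon> \<and> ac_f x + grad_inner m f w x \<le> \<epsilon>}"
      if "0 < \<epsilon>" for \<epsilon> using main[OF that] by (simp add: M_def)
    fix f' h G
    assume ae: "(AE x in m. f' x = f x) \<and> (AE x in m. h x = ac_f x) \<and> (AE x in m. G x = grad_inner m f w x)"
    have "\<exists>x. ereal (f' x) \<ge> M - ereal (1 / real j) \<and> h x + G x \<le> 1 / real j" if j: "1 \<le> j" for j
    proof (rule ccontr)
      assume no: "\<not> ?thesis"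
      let ?S = "{x. ereal (f x) \<ge> M - ereal (1 / real j) \<and> ac_f x + grad_inner m f w x \<le> 1 / real j}"
      from ae have "(AE x in m. f' x = f x)" "(AE x in m. h x = ac_f x)" "(AE x in m. G x = grad_inner m f w x)"
        by auto
      then have "AE x in m. x \<notin> ?S"
      proof eventually_elim
        case (elim x)
        have "\<not> (ereal (f' x) \<ge> M - ereal (1 / real j) \<and> h x + G x \<le> 1 / real j)" using no by blast
        with elim show ?case by simp
      qed
      moreover have "{x \<in> space m. x \<in> ?S} \<in> sets m" by measurable
      ultimately have "emeasure m ?S = 0"
        by (subst (asm) AE_iff_measurable[of "{x \<in> space m. x \<in> ?S}"]) auto
      with main[of "1 / real j"] j show False by simp
    qed
    then have "\<forall>j. \<exists>x. 1 \<le> j \<longrightarrow> ereal (f' x) \<ge> M - ereal (1 / real j) \<and> h x + G x \<le> 1 / real j" by blast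
    from choice[OF this] show "\<exists>x::nat \<Rightarrow> 'a. \<forall>j\<ge>1. ereal (f' (x j)) \<ge> ess_sup_on m UNIV f - ereal (1 / real j) \<and>
        h (x j) + G (x j) \<le> 1 / real j" unfolding M_def by blast
  qed
qed

end
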